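(* Let $\left\{\mathcal{N}^{(i)}_{A \to B }\right\}_{i=1}^s$ be a compound quantum channel. Let $A'\equiv A$ be a purifying register. Let $C$ satisfy \begin{equation*} C \leq \min_{i\in [1:s]} \left(\max_{|\psi\rangle\langle\psi|_{AA'}}\mathrm{I}(B:A')_{\mathcal{N}^{(i)}_{A\to B}(|\psi\rangle\langle\psi|_{AA'})}\right). \end{equation*} For every $\varepsilon \in (0,1), \delta>0$, there exists a large enough $n$ such that there exists a $(n(C - \delta), 2\varepsilon)$-entanglement assisted code for the compound quantum channel $\left\{\mathcal{N}^{(i) \otimes n}_{A \to B }\right\}_{i=1}^s$, in the case of the informed sender.
   Context: $\mathrm{I}(B:A')_\rho = \mathrm{D}(\rho_{BA'}\|\rho_B\otimes\rho_{A'})$ is the quantum mutual information, with $\mathrm{D}(\rho\|\sigma)=\mathrm{Tr}[\rho(\log\rho-\log\sigma)]$. An $(R,\varepsilon)$-entanglement assisted code for a compound channel $\{\mathcal{N}^{(i)}\}_{i=1}^s$ in the case of informed sender consists of a shared entangled state $|\theta\rangle_{E_AE_B}$, encoding operations $\mathcal{E}_i: ME_A\to A$ that may depend on the channel index $i$ (known to Alice only), messages in $[1:2^R]$, and a single decoding $\mathcal{D}: BE_B\to M'$ for Bob with $\Pr\{M'\neq m\mid M=m\}\leq\varepsilon$ for all $m$ and all $i$. *)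

theory Defs
  imports "HOL-Analysis.Analysis" "HOL-Library.Extended_Real" "Jordan_Normal_Form.Matrix"
begin

type_synonym cmat = "complex mat"
type_synonym cvec = "complex vec"

definition mtrace :: "cmat \<Rightarrow> complex" where
  "mtrace A = (\<Sum>i<dim_row A. A $$ (i,i))"

definition dag :: "cmat \<Rightarrow> cmat" where
  "dag A = mat (dim_col A) (dim_row A) (\<lambda>(i,j). cnj (A $$ (j,i)))"

text \<open>Kronecker (tensor) product; the first factor is the more significant index.\<close>
definition kron :: "cmat \<Rightarrow> cmat \<Rightarrow> cmat" where
  "kron A B = mat (dim_row A * dim_row B) (dim_col A * dim_col B)
     (\<lambda>(i,j). A $$ (i div dim_row B, j div dim_col B) * B $$ (i mod dim_row B, j mod dim_col B))"

definition ptrace_second :: "nat \<Rightarrow> nat \<Rightarrow> cmat \<Rightarrow> cmat" where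
  "ptrace_second a b R = mat a a (\<lambda>(i,j). \<Sum>k<b. R $$ (i*b+k, j*b+k))"

definition ptrace_first :: "nat \<Rightarrow> nat \<Rightarrow> cmat \<Rightarrow> cmat" where
  "ptrace_first a b R = mat b b (\<lambda>(i,j). \<Sum>k<a. R $$ (k*b+i, k*b+j))"

definition psd :: "nat \<Rightarrow> cmat \<Rightarrow> bool" where
  "psd n A \<longleftrightarrow> A \<in> carrier_mat n n \<and>
     (\<forall>v \<in> carrier_vec n. let q = (\<Sum>i<n. \<Sum>j<n. cnj (v $ i) * A $$ (i,j) * v $ j)
                         in Im q = 0 \<and> Re q \<ge> 0)"

definition density :: "nat \<Rightarrow> cmat \<Rightarrow> bool" where
  "density n \<rho> \<longleftrightarrow> psd n \<rho> \<and> mtrace \<rho> = 1"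

definition unit_vec_c :: "nat \<Rightarrow> cvec \<Rightarrow> bool" where
  "unit_vec_c n v \<longleftrightarrow> v \<in> carrier_vec n \<and> (\<Sum>i<n. (cmod (v $ i))\<^sup>2) = 1"

definition proj :: "cvec \<Rightarrow> cmat" where
  "proj v = mat (dim_vec v) (dim_vec v) (\<lambda>(i,j). v $ i * cnj (v $ j))"

definition unitary :: "nat \<Rightarrow> cmat \<Rightarrow> bool" where
  "unitary n U \<longleftrightarrow> U \<in> carrier_mat n n \<and> dag U * U = 1\<^sub>m n"

text \<open>f(A) for Hermitian A, via a spectral decomposition A = U diag(lam) U^dagger
  (the result does not depend on the chosen decomposition).\<close>
definition mfun :: "(real \<Rightarrow> real) \<Rightarrow> nat \<Rightarrow> cmat \<Rightarrow> cmat" where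
  "mfun f n A = (SOME B. \<exists>U lam. unitary n U \<and>
       A = U * mat_diag n (\<lambda>i. complex_of_real (lam i)) * dag U \<and>
       B = U * mat_diag n (\<lambda>i. complex_of_real (f (lam i))) * dag U)"

text \<open>Binary matrix logarithm (log 2 0 = 0 in Isabelle, i.e. the log is taken on the support).\<close>
definition mlog :: "nat \<Rightarrow> cmat \<Rightarrow> cmat" where
  "mlog n A = mfun (log 2) n A"

definition rel_entropy :: "nat \<Rightarrow> cmat \<Rightarrow> cmat \<Rightarrow> ereal" where
  "rel_entropy n \<rho> \<sigma> =
     (if \<forall>v \<in> carrier_vec n. \<sigma> *\<^sub>v v = 0\<^sub>v n \<longrightarrow> \<rho> *\<^sub>v v = 0\<^sub>v n
      then ereal (Re (mtrace (\<rho> * (mlog n \<rho> - mlog n \<sigma>))))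
      else \<infinity>)"

definition mutual_info :: "nat \<Rightarrow> nat \<Rightarrow> cmat \<Rightarrow> ereal" where
  "mutual_info b a \<rho> =
     rel_entropy (b*a) \<rho> (kron (ptrace_second b a \<rho>) (ptrace_first b a \<rho>))"

definition is_channel :: "nat \<Rightarrow> nat \<Rightarrow> cmat list \<Rightarrow> bool" where
  "is_channel din dout Ks \<longleftrightarrow> (\<forall>K \<in> set Ks. K \<in> carrier_mat dout din) \<and>
     foldr (\<lambda>K acc. dag K * K + acc) Ks (0\<^sub>m din din) = 1\<^sub>m din"

definition apply_channel :: "nat \<Rightarrow> cmat list \<Rightarrow> cmat \<Rightarrow> cmat" where
  "apply_channel dout Ks \<rho> = foldr (\<lambda>K acc. K * \<rho> * dag K + acc) Ks (0\<^sub>m dout dout)"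

definition tensor_id :: "nat \<Rightarrow> cmat list \<Rightarrow> cmat list" where
  "tensor_id d Ks = map (\<lambda>K. kron K (1\<^sub>m d)) Ks"

definition compose_channel :: "cmat list \<Rightarrow> cmat list \<Rightarrow> cmat list" where
  "compose_channel Ns Es = [K * E. K \<leftarrow> Ns, E \<leftarrow> Es]"

fun channel_pow :: "nat \<Rightarrow> cmat list \<Rightarrow> cmat list" where
  "channel_pow 0 Ks = [1\<^sub>m 1]"
| "channel_pow (Suc n) Ks = [kron K L. K \<leftarrow> Ks, L \<leftarrow> channel_pow n Ks]"

definition max_mutual_info :: "nat \<Rightarrow> nat \<Rightarrow> cmat list \<Rightarrow> ereal" where
  "max_mutual_info dA dB Ks =
     (SUP \<psi> \<in> {\<psi>. unit_vec_c (dA*dA) \<psi>}.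
        mutual_info dB dA (apply_channel (dB*dA) (tensor_id dA Ks) (proj \<psi>)))"

text \<open>An (R, eps)-entanglement assisted code for the compound channel {N i | i < s}
  (each N i a channel from dimension dA to dB), informed sender:
  shared pure state theta on E_A \<otimes> E_B, encoders Enc i m : E_A \<rightarrow> A (depending on the
  channel index i and the message m), a single decoding POVM Lam m (m < M) on B \<otimes> E_B,
  with M = ceiling(2^R) messages.\<close>
definition ea_code_informed ::
  "nat \<Rightarrow> nat \<Rightarrow> nat \<Rightarrow> (nat \<Rightarrow> cmat list) \<Rightarrow> real \<Rightarrow> real \<Rightarrow> bool" where
  "ea_code_informed s dA dB N R eps \<longleftrightarrow>
     (let M = nat \<lceil>2 powr R\<rceil> in
      \<exists>eA eB \<theta> Enc Lam.
        unit_vec_c (eA*eB) \<theta> \<and>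
        (\<forall>i<s. \<forall>m<M. is_channel eA dA (Enc i m)) \<and>
        (\<forall>m<M. psd (dB*eB) (Lam m)) \<and>
        foldr (\<lambda>m acc. Lam m + acc) [0..<M] (0\<^sub>m (dB*eB) (dB*eB)) = 1\<^sub>m (dB*eB) \<and>
        (\<forall>i<s. \<forall>m<M.
           let \<rho> = apply_channel (dB*eB) (tensor_id eB (compose_channel (N i) (Enc i m)))
                      (proj \<theta>)
           in 1 - Re (mtrace (Lam m * \<rho>)) \<le> eps))"

end

theory Submission
  imports Defs "Jordan_Normal_Form.Spectral_Radius" "HOL-Real_Asymp.Real_Asymp"
begin

text \<open>
  Position-based coding. For every channel index \<open>i\<close> and message \<open>m\<close> the parties share a copy of
  an almost optimal input \<open>\<psi>\<^sub>i\<^sup>\<otimes>\<^sup>n\<close>; to send \<open>m\<close> over channel \<open>i\<close>, Alice feeds her half of copy \<open>(i, m)\<close>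
  into the channel and discards the others. Bob decides which copy is correlated with the channel
  output. For a wrong copy the joint state is a product \<open>\<sigma> \<otimes> \<psi>\<^sub>A\<^sub>'\<close>, where \<open>\<sigma>\<close> is the output of
  the actual, unknown channel. A test consisting of the typical projectors of \<open>\<rho>\<^sub>B\<^sub>A\<^sub>'\<close> and
  \<open>\<rho>\<^sub>B \<otimes> \<rho>\<^sub>A\<^sub>'\<close> rejects \<open>\<rho>\<^sub>B \<otimes> \<psi>\<^sub>A\<^sub>'\<close> up to \<open>2\<^sup>-\<^sup>n\<^sup>I\<close>; damping its input on \<open>B\<close> by a resolvent
  makes it reject \<open>\<sigma> \<otimes> \<psi>\<^sub>A\<^sub>'\<close> for all \<open>\<sigma>\<close> at once, so a single decoder serves all channels.
  The tests are combined into a measurement as in the Hayashi--Nagaoka lemma.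

  Vectors are functions on finite index sets, and positive operators are represented by families
  of vectors \<open>t\<^sub>j\<close>, standing for \<open>\<Sum>\<^sub>j |t\<^sub>j\<rangle>\<langle>t\<^sub>j|\<close>.
\<close>

section \<open>Resolvents and measurements\<close>

text \<open>Why damping is almost free: the expectation of \<open>\<tau>\<close> in the correct
  output on \<open>B\<close> is the acceptance probability of the product state, about 2^(-nI). With
  \<open>\<lambda>\<close> = 2^(-nR) and R slightly below I, the expectation of
  \<open>\<tau>/\<lambda>\<close> tends to 0, while every product
  \<open>\<beta> \<otimes> \<psi>\<close> is accepted with weight at most \<open>\<lambda>\<close>.
  All wrong copies together then cost a constant times s 2^(n(C - delta)) 2^(-nR): the number of
  channels is only a constant factor. Mixed states are treated like the operators. For a fixed Kraus
  index and fixed values of the discarded halves the received state is an unnormalised vector, so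
  each operator inequality is proved for one vector and then summed. Tensor powers enter through
  kernels, i.e. density matrix entries, which factorise over the copies; the Kraus lists of powers
  are never indexed by tuples. Relative entropy is infinite when supports do not match, and
  \<open>log 2 0 = 0\<close> hides zero eigenvalues. It therefore has to be shown that the output
  state is supported in the product of its marginals; this is the purpose of the lemma on vanishing
  traces.\<close>

definition ip :: "'i set \<Rightarrow> ('i \<Rightarrow> complex) \<Rightarrow> ('i \<Rightarrow> complex) \<Rightarrow> complex" where
  "ip X u v = (\<Sum>i\<in>X. cnj (u i) * v i)"

definition nsq :: "'i set \<Rightarrow> ('i \<Rightarrow> complex) \<Rightarrow> real" where
  "nsq X u = (\<Sum>i\<in>X. (cmod (u i))\<^sup>2)"

definition ap :: "'i set \<Rightarrow> ('i \<Rightarrow> 'i \<Rightarrow> complex) \<Rightarrow> ('i \<Rightarrow> complex) \<Rightarrow> 'i \<Rightarrow> complex" where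
  "ap X R v = (\<lambda>x. \<Sum>y\<in>X. R x y * v y)"

lemma ip_cong: "(\<And>x. x \<in> X \<Longrightarrow> u x = u' x) \<Longrightarrow> (\<And>x. x \<in> X \<Longrightarrow> v x = v' x) \<Longrightarrow> ip X u v = ip X u' v'"
  unfolding ip_def by (intro sum.cong) auto

text \<open>The expectation of the rank-one operator of \<open>u\<close> in the unnormalised state
  \<open>v\<close>. Summed over a family it is the expectation of the operator that the family
  stands for.\<close>

abbreviation prb :: "'i set \<Rightarrow> ('i \<Rightarrow> complex) \<Rightarrow> ('i \<Rightarrow> complex) \<Rightarrow> real" where
  "prb X u v \<equiv> (cmod (ip X u v))\<^sup>2"

lemma sum_Times: "(\<Sum>p\<in>P \<times> Q. f p) = (\<Sum>x\<in>P. \<Sum>y\<in>Q. f (x, y))"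
  by (simp add: sum.cartesian_product)

lemma nsq_cong: "(\<And>x. x \<in> X \<Longrightarrow> u x = u' x) \<Longrightarrow> nsq X u = nsq X u'"
  unfolding nsq_def by (intro sum.cong) auto

lemma ip_add_right: "ip X u (\<lambda>i. v i + w i) = ip X u v + ip X u w"
  by (simp add: ip_def algebra_simps sum.distrib)

lemma ip_diff_right: "ip X u (\<lambda>i. v i - w i) = ip X u v - ip X u w"
  by (simp add: ip_def algebra_simps sum_subtractf)

lemma ip_scale_right: "ip X u (\<lambda>i. c * v i) = c * ip X u v"
  by (simp add: ip_def algebra_simps sum_distrib_left)

lemma ip_sum_right: "ip X u (\<lambda>i. \<Sum>j\<in>J. v j i) = (\<Sum>j\<in>J. ip X u (v j))"
  unfolding ip_def sum_distrib_left by (rule sum.swap)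

lemma cnj_ip: "cnj (ip X u v) = ip X v u"
  by (simp add: ip_def mult.commute)

lemma ip_self: "ip X u u = complex_of_real (nsq X u)"
  unfolding ip_def nsq_def of_real_sum
  by (intro sum.cong refl) (metis complex_norm_square mult.commute)

lemma nsq_nonneg [simp]: "nsq X u \<ge> 0"
  unfolding nsq_def by (intro sum_nonneg) auto

lemma cmod_diff_sq: "(cmod (a - b))\<^sup>2 = (cmod a)\<^sup>2 - 2 * Re (cnj a * b) + (cmod b)\<^sup>2"
  unfolding cmod_power2 by (simp add: power2_eq_square algebra_simps)

lemma nsq_diff: "nsq X (\<lambda>i. u i - v i) = nsq X u - 2 * Re (ip X u v) + nsq X v"
  by (simp add: nsq_def ip_def cmod_diff_sq sum.distrib sum_subtractf sum_distrib_left)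

lemma nsq_scale: "nsq X (\<lambda>i. c * v i) = (cmod c)\<^sup>2 * nsq X v"
  by (simp add: nsq_def norm_mult power_mult_distrib sum_distrib_left)

lemma cmod_sq_le: "(cmod a)\<^sup>2 \<le> 2 * (cmod b)\<^sup>2 + 2 * (cmod (a - b))\<^sup>2"
proof -
  \<comment> \<open>The right-hand side of the claim exceeds the left by exactly this
    square.\<close>
  have "0 \<le> (cmod (a - 2 * b))\<^sup>2" by simp
  then show ?thesis
    unfolding cmod_power2 by (simp add: power2_eq_square algebra_simps)
qed

lemma ip_ap_swap:
  assumes herm: "\<And>x y. x \<in> X \<Longrightarrow> y \<in> X \<Longrightarrow> R y x = cnj (R x y)"
  shows "ip X u (ap X R v) = ip X (ap X R u) v"
proof -
  have "ip X u (ap X R v) = (\<Sum>x\<in>X. \<Sum>y\<in>X. cnj (u x) * (R x y * v y))"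
    by (simp add: ip_def ap_def sum_distrib_left)
  also have "\<dots> = (\<Sum>y\<in>X. \<Sum>x\<in>X. cnj (u x) * (R x y * v y))"
    by (rule sum.swap)
  also have "\<dots> = (\<Sum>y\<in>X. \<Sum>x\<in>X. cnj (R y x * u x) * v y)"
    by (intro sum.cong refl) (simp add: herm[symmetric])
  also have "\<dots> = ip X (ap X R u) v"
    by (simp add: ip_def ap_def sum_distrib_right)
  finally show ?thesis .
qed

lemma ip_scale_right': "ip X u (\<lambda>i. v i * c) = ip X u v * c"
  by (simp add: ip_def sum_distrib_right mult.assoc)

text \<open>On the right of \<open>ip\<close> stands \<open>S u\<close> for the operator
  \<open>S\<close> of the family \<open>t\<close>; the result is the sesquilinear form of
  \<open>S\<close>, so that \<open>S\<close> itself never has to be named.\<close>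

lemma family_ip:
  "ip X v (\<lambda>x. \<Sum>j\<in>J. t j x * ip X (t j) u) = (\<Sum>j\<in>J. cnj (ip X (t j) v) * ip X (t j) u)"
  by (simp add: ip_sum_right ip_scale_right' cnj_ip)

lemma family_ip_self:
  "ip X v (\<lambda>x. \<Sum>j\<in>J. t j x * ip X (t j) v) = complex_of_real (\<Sum>j\<in>J. prb X (t j) v)"
  unfolding family_ip of_real_sum
  by (intro sum.cong refl) (metis complex_norm_square mult.commute)

text \<open>The Sherman--Morrison formula builds the inverse of \<open>1 + \<Sum>\<^sub>j |t\<^sub>j\<rangle>\<langle>t\<^sub>j|\<close> one rank-one
  term at a time.\<close>

lemma resolvent_exists:
  assumes X: "finite X" and J: "finite J"
  shows "\<exists>R. (\<forall>x\<in>X. \<forall>y\<in>X. R y x = cnj (R x y)) \<and>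
     (\<forall>\<phi>. \<forall>x\<in>X. \<phi> x = ap X R \<phi> x + (\<Sum>j\<in>J. t j x * ip X (t j) (ap X R \<phi>)))"
  using J
proof (induction J rule: finite_induct)
  case empty
  have "ap X (\<lambda>x y. if x = y then 1 else 0) \<phi> x = \<phi> x" if "x \<in> X" for \<phi> :: "'a \<Rightarrow> complex" and x
    using X that by (simp add: ap_def if_distrib[of "\<lambda>a. a * _"] sum.delta cong: if_cong)
  then show ?case
    by (intro exI[of _ "\<lambda>x y. if x = y then 1 else 0"]) auto
next
  case (insert k J)
  then obtain R where herm: "\<And>x y. x \<in> X \<Longrightarrow> y \<in> X \<Longrightarrow> R y x = cnj (R x y)"
    and inv: "\<And>\<phi> x. x \<in> X \<Longrightarrow> \<phi> x = ap X R \<phi> x + (\<Sum>j\<in>J. t j x * ip X (t j) (ap X R \<phi>))"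
    by blast
  define u where "u = ap X R (t k)"
  \<comment> \<open>This is the Sherman--Morrison term \<open>ip X (t k) u\<close>, the expectation
    of the old resolvent in \<open>t k\<close>, written so that it is visibly non-negative and
    \<open>1 + c\<close> cannot vanish.\<close>
  define c where "c = nsq X u + (\<Sum>j\<in>J. prb X (t j) u)"
  have c0: "c \<ge> 0" unfolding c_def by (intro add_nonneg_nonneg sum_nonneg) auto
  have "ip X u (t k) = ip X u (\<lambda>x. u x + (\<Sum>j\<in>J. t j x * ip X (t j) u))"
    using inv[of _ "t k"] by (intro ip_cong) (auto simp: u_def)
  also have "\<dots> = complex_of_real c"
    by (simp add: ip_add_right family_ip_self ip_self c_def)
  finally have utk: "ip X u (t k) = complex_of_real c" .
  then have tku: "ip X (t k) u = complex_of_real c"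
    by (metis cnj_ip complex_cnj_complex_of_real)
  define R' where "R' = (\<lambda>x y. R x y - u x * cnj (u y) / complex_of_real (1 + c))"
  have herm': "R' y x = cnj (R' x y)" if "x \<in> X" "y \<in> X" for x y
    using herm[OF that] by (simp add: R'_def mult.commute)
  have ap': "ap X R' \<phi> = (\<lambda>x. ap X R \<phi> x - (ip X (t k) (ap X R \<phi>) / complex_of_real (1 + c)) * u x)" for \<phi>
  proof
    fix x
    have "ap X R' \<phi> x = ap X R \<phi> x - (\<Sum>y\<in>X. (u x / complex_of_real (1 + c)) * (cnj (u y) * \<phi> y))"
      by (simp add: ap_def R'_def algebra_simps sum_subtractf)
    also have "\<dots> = ap X R \<phi> x - (u x / complex_of_real (1 + c)) * ip X u \<phi>"
      by (simp add: ip_def sum_distrib_left)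
    also have "ip X u \<phi> = ip X (t k) (ap X R \<phi>)"
      unfolding u_def by (rule ip_ap_swap[symmetric]) (rule herm)
    finally show "ap X R' \<phi> x = ap X R \<phi> x - (ip X (t k) (ap X R \<phi>) / complex_of_real (1 + c)) * u x"
      by simp
  qed
  have inv': "\<phi> x = ap X R' \<phi> x + (\<Sum>j\<in>insert k J. t j x * ip X (t j) (ap X R' \<phi>))"
    if x: "x \<in> X" for \<phi> x
  proof -
    define a where "a = ip X (t k) (ap X R \<phi>)"
    define b where "b = a / complex_of_real (1 + c)"
    have ne: "complex_of_real (1 + c) \<noteq> 0" using c0 by (metis of_real_eq_0_iff add_nonneg_eq_0_iff zero_le_one zero_neq_one)
    have ab: "a - b * complex_of_real c = b"
      using ne unfolding b_def by (simp add: field_simps)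
    have e1: "ap X R' \<phi> = (\<lambda>x. ap X R \<phi> x - b * u x)"
      unfolding ap' b_def a_def ..
    have ipj: "ip X (t j) (ap X R' \<phi>) = ip X (t j) (ap X R \<phi>) - b * ip X (t j) u" for j
      unfolding e1 by (simp add: ip_diff_right ip_scale_right)
    have e2: "(\<Sum>j\<in>J. t j x * ip X (t j) (ap X R' \<phi>)) =
       (\<Sum>j\<in>J. t j x * ip X (t j) (ap X R \<phi>)) - b * (\<Sum>j\<in>J. t j x * ip X (t j) u)"
      unfolding ipj by (simp add: algebra_simps sum_subtractf sum_distrib_left)
    have e3: "(\<Sum>j\<in>J. t j x * ip X (t j) (ap X R \<phi>)) = \<phi> x - ap X R \<phi> x"
      using inv[OF x, of \<phi>] by simp
    have e4: "(\<Sum>j\<in>J. t j x * ip X (t j) u) = t k x - u x"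
      using inv[OF x, of "t k"] by (simp add: u_def algebra_simps)
    have "ip X (t k) (ap X R' \<phi>) = b"
      unfolding ipj using ab by (simp add: a_def tku)
    then have "(\<Sum>j\<in>insert k J. t j x * ip X (t j) (ap X R' \<phi>))
        = t k x * b + (\<phi> x - ap X R \<phi> x - b * (t k x - u x))"
      using insert.hyps by (simp add: e2 e3 e4)
    then show ?thesis unfolding e1 by (simp add: algebra_simps)
  qed
  show ?case using herm' inv' by blast
qed

text \<open>The hypothesis says \<open>\<phi> = (1 + S) v\<close>. Pairing it with \<open>v\<close>
  and with \<open>\<phi>\<close> gives the two identities, from which the later scalar estimates are
  derived.\<close>

lemma resolvent_facts:
  assumes inv: "\<And>x. x \<in> X \<Longrightarrow> \<phi> x = v x + (\<Sum>j\<in>J. t j x * ip X (t j) v)"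
  shows "Re (ip X v \<phi>) = nsq X v + (\<Sum>j\<in>J. prb X (t j) v)"
    and "(\<Sum>j\<in>J. Re (cnj (ip X (t j) \<phi>) * ip X (t j) v)) = nsq X \<phi> - Re (ip X v \<phi>)"
proof -
  have "ip X v \<phi> = ip X v (\<lambda>x. v x + (\<Sum>j\<in>J. t j x * ip X (t j) v))"
    using inv by (intro ip_cong) auto
  then show "Re (ip X v \<phi>) = nsq X v + (\<Sum>j\<in>J. prb X (t j) v)"
    by (simp add: ip_add_right family_ip_self ip_self)
  have "ip X \<phi> \<phi> = ip X \<phi> (\<lambda>x. v x + (\<Sum>j\<in>J. t j x * ip X (t j) v))"
    using inv by (intro ip_cong) auto
  then have "Re (ip X \<phi> \<phi>) = Re (ip X \<phi> v) + (\<Sum>j\<in>J. Re (cnj (ip X (t j) \<phi>) * ip X (t j) v))"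
    by (simp only: ip_add_right family_ip plus_complex.sel(1) Re_sum)
  moreover have "Re (ip X \<phi> v) = Re (ip X v \<phi>)" by (metis cnj_ip cnj.simps(1))
  ultimately show "(\<Sum>j\<in>J. Re (cnj (ip X (t j) \<phi>) * ip X (t j) v)) = nsq X \<phi> - Re (ip X v \<phi>)"
    unfolding ip_self Re_complex_of_real by linarith
qed

text \<open>A substitute for the Hayashi--Nagaoka inequality: replacing \<open>S\<^sup>-\<^sup>1\<^sup>/\<^sup>2\<close> by \<open>2 (1 + S)\<^sup>-\<^sup>1\<close>
  keeps its constants 2 and 4 but needs neither square roots nor operator monotonicity.\<close>

lemma resolvent_measurement_bound:
  assumes J: "finite J" and sub: "J1 \<subseteq> J"
    and inv: "\<And>x. x \<in> X \<Longrightarrow> \<phi> x = v x + (\<Sum>j\<in>J. t j x * ip X (t j) v)"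
    and contr: "\<And>w. (\<Sum>j\<in>J1. prb X (t j) w) \<le> nsq X w"
  shows "nsq X \<phi> - 4 * (\<Sum>j\<in>J1. prb X (t j) v)
     \<le> 2 * (nsq X \<phi> - (\<Sum>j\<in>J1. prb X (t j) \<phi>))
       + 4 * (\<Sum>j\<in>J - J1. prb X (t j) \<phi>)"
proof -
  define a where "a j = ip X (t j) v" for j
  define c where "c j = ip X (t j) \<phi>" for j
  define p where "p = Re (ip X v \<phi>)"
  have rf: "p = nsq X v + (\<Sum>j\<in>J. (cmod (a j))\<^sup>2)"
    "(\<Sum>j\<in>J. Re (cnj (c j) * a j)) = nsq X \<phi> - p"
    unfolding a_def c_def p_def using resolvent_facts[of X \<phi> v t J] inv by blast+
  have split: "(\<Sum>j\<in>J. f j) = (\<Sum>j\<in>J1. f j) + (\<Sum>j\<in>J - J1. f j)" for f :: "_ \<Rightarrow> real"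
    using sum.subset_diff[OF sub J, of f] by simp
  \<comment> \<open>The contraction hypothesis is spent on \<open>\<phi> - v\<close>, the change
    caused by the resolvent: it compares the right test before and after.\<close>
  have "(\<Sum>j\<in>J1. (cmod (c j - a j))\<^sup>2) \<le> nsq X (\<lambda>x. \<phi> x - v x)"
    using contr[of "\<lambda>x. \<phi> x - v x"] by (simp add: ip_diff_right a_def c_def)
  also have "\<dots> = nsq X \<phi> - 2 * p + nsq X v"
    unfolding nsq_diff p_def by (metis cnj_ip cnj.simps(1))
  finally have i1: "(\<Sum>j\<in>J1. (cmod (c j - a j))\<^sup>2) \<le> nsq X \<phi> - 2 * p + nsq X v" .
  have "(\<Sum>j\<in>J1. (cmod (c j))\<^sup>2) \<le> (\<Sum>j\<in>J1. 2 * (cmod (a j))\<^sup>2 + 2 * (cmod (c j - a j))\<^sup>2)"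
    by (intro sum_mono cmod_sq_le)
  then have i2: "(\<Sum>j\<in>J1. (cmod (c j))\<^sup>2) \<le> 2 * (\<Sum>j\<in>J1. (cmod (a j))\<^sup>2) + 2 * (\<Sum>j\<in>J1. (cmod (c j - a j))\<^sup>2)"
    by (simp add: sum.distrib sum_distrib_left)
  have "(cmod (2 * a j))\<^sup>2 \<le> 2 * (cmod (c j))\<^sup>2 + 2 * (cmod (2 * a j - c j))\<^sup>2" for j
    by (rule cmod_sq_le)
  then have "(\<Sum>j\<in>J-J1. (cmod (2 * a j))\<^sup>2) \<le> (\<Sum>j\<in>J-J1. 2 * (cmod (c j))\<^sup>2 + 2 * (cmod (2 * a j - c j))\<^sup>2)"
    by (intro sum_mono)
  then have i3: "4 * (\<Sum>j\<in>J-J1. (cmod (a j))\<^sup>2) \<le> 2 * (\<Sum>j\<in>J-J1. (cmod (c j))\<^sup>2) + 2 * (\<Sum>j\<in>J-J1. (cmod (2 * a j - c j))\<^sup>2)"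
    by (simp add: sum.distrib sum_distrib_left norm_mult power_mult_distrib)
  have "(cmod (2 * a j - c j))\<^sup>2 = 4 * (cmod (a j))\<^sup>2 - 4 * Re (cnj (c j) * a j) + (cmod (c j))\<^sup>2" for j
    unfolding cmod_diff_sq by (simp add: norm_mult power_mult_distrib)
  then have i4: "(\<Sum>j\<in>J. (cmod (2 * a j - c j))\<^sup>2) = 4 * (\<Sum>j\<in>J. (cmod (a j))\<^sup>2) - 4 * (\<Sum>j\<in>J. Re (cnj (c j) * a j)) + (\<Sum>j\<in>J. (cmod (c j))\<^sup>2)"
    by (simp only: sum.distrib sum_subtractf sum_distrib_left)
  have i5: "0 \<le> (\<Sum>j\<in>J1. (cmod (2 * a j - c j))\<^sup>2)" by (intro sum_nonneg) auto
  have i6: "0 \<le> (\<Sum>j\<in>J-J1. (cmod (a j))\<^sup>2)" by (intro sum_nonneg) auto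
  have "0 \<le> nsq X (\<lambda>x. \<phi> x - 2 * v x)" by simp
  also have "\<dots> = nsq X \<phi> - 4 * p + 4 * nsq X v"
    unfolding nsq_diff by (simp add: nsq_scale ip_scale_right p_def) (metis cnj_ip cnj.simps(1))
  finally have i7: "0 \<le> nsq X \<phi> - 4 * p + 4 * nsq X v" .
  \<comment> \<open>What remains is linear in the sums named above. After
    \<open>C1 \<le> 2 * N - 2 * p\<close> has been used, the square \<open>i7\<close> of
    \<open>\<phi> - 2 v\<close> closes the gap.\<close>
  have arith: "N - 4 * A1 \<le> 2 * (N - C1) + 4 * C2"
    if "D \<le> N - 2 * p + n" "C1 \<le> 2 * A1 + 2 * D" "4 * A2 \<le> 2 * C2 + 2 * W2"
      "W = 4 * A - 4 * Q + C" "0 \<le> W1" "0 \<le> A2" "0 \<le> N - 4 * p + 4 * n" "p = n + A" "Q = N - p"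
      "A = A1 + A2" "C = C1 + C2" "W = W1 + W2" for A A1 A2 C C1 C2 D N W W1 W2 Q n p :: real
  proof -
    have "C1 \<le> 2 * N - 2 * p" using that(1,2,6,8,10) by simp
    moreover have "W2 \<le> 4 * (p - n) - 4 * (N - p) + (C1 + C2)" using that(4,5,8,9,11,12) by simp
    moreover have "A1 = p - n - A2" using that(8,10) by simp
    ultimately show ?thesis using that(3,7) by simp
  qed
  show ?thesis
    unfolding a_def[symmetric] c_def[symmetric]
    by (rule arith[OF i1 i2 i3 i4 i5 i6 i7 rf split split split])
qed

text \<open>With \<open>S\<close> the sum of all tests and \<open>R\<close> the inverse of
  \<open>1 + S\<close>, outcome \<open>k\<close> gets the operator of its test multiplied by
  \<open>2 R\<close> from both sides. Since \<open>R S R = R - R^2\<close>, what is missing to the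
  identity is \<open>(1 - 2 R)^2\<close>, which is positive; the family \<open>w\<close> stands for
  this inconclusive outcome.\<close>

lemma resolvent_measurement:
  fixes t :: "'k \<Rightarrow> 'j \<Rightarrow> 'x \<Rightarrow> complex"
  assumes X: "finite X" and I: "finite I" and J: "\<And>k. k \<in> I \<Longrightarrow> finite (J k)"
    and contr: "\<And>k w. k \<in> I \<Longrightarrow> (\<Sum>j\<in>J k. prb X (t k j) w) \<le> nsq X w"
  shows "\<exists>l :: 'k \<Rightarrow> 'j \<Rightarrow> 'x \<Rightarrow> complex. \<exists>w :: 'x \<Rightarrow> 'x \<Rightarrow> complex.
     (\<forall>x\<in>X. \<forall>y\<in>X. (\<Sum>k\<in>I. \<Sum>j\<in>J k. l k j x * cnj (l k j y)) + (\<Sum>z\<in>X. w z x * cnj (w z y))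
        = (if x = y then 1 else 0)) \<and>
     (\<forall>k\<in>I. \<forall>\<phi>. nsq X \<phi> - (\<Sum>j\<in>J k. prb X (l k j) \<phi>)
      \<le> 2 * (nsq X \<phi> - (\<Sum>j\<in>J k. prb X (t k j) \<phi>))
        + 4 * (\<Sum>k'\<in>I - {k}. \<Sum>j\<in>J k'. prb X (t k' j) \<phi>))"
proof -
  let ?S = "Sigma I J"
  define s where "s = (\<lambda>(k,j). t k j)"
  have S: "finite ?S" using I J by auto
  obtain R where herm: "\<And>x y. x \<in> X \<Longrightarrow> y \<in> X \<Longrightarrow> R y x = cnj (R x y)"
    and inv: "\<And>\<phi> x. x \<in> X \<Longrightarrow> \<phi> x = ap X R \<phi> x + (\<Sum>j\<in>?S. s j x * ip X (s j) (ap X R \<phi>))"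
    using resolvent_exists[OF X S, of s] by blast
  define l where "l = (\<lambda>k j x. 2 * ap X R (t k j) x)"
  define w where "w = (\<lambda>z x. (if x = z then 1 else 0) - 2 * R x z)"
  have RSR: "(\<Sum>j\<in>?S. ap X R (s j) x * cnj (ap X R (s j) y)) = R x y - (\<Sum>z\<in>X. R x z * R z y)"
    if x: "x \<in> X" and y: "y \<in> X" for x y
  proof -
    \<comment> \<open>The resolvent equation at the basis vector of \<open>y\<close> describes
      column \<open>y\<close> of \<open>R\<close>; applying \<open>R\<close> once more gives
      \<open>R = R^2 + R S R\<close> entrywise.\<close>
    define d where "d = (\<lambda>x. if x = y then 1 else (0::complex))"
    have Rd: "ap X R d z = R z y" for z
      using X y by (simp add: ap_def d_def if_distrib[of "\<lambda>a. _ * a"] sum.delta cong: if_cong)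
    have ipd: "ip X (s j) (ap X R d) = cnj (ap X R (s j) y)" for j
    proof -
      have "ip X (s j) (ap X R d) = ip X (ap X R (s j)) d"
        by (rule ip_ap_swap) (rule herm)
      also have "\<dots> = cnj (ap X R (s j) y)"
        using X y unfolding ip_def d_def by (simp add: if_distrib[of "\<lambda>a. _ * a"] cong: if_cong)
      finally show ?thesis .
    qed
    have dz: "d z = R z y + (\<Sum>j\<in>?S. s j z * cnj (ap X R (s j) y))" if "z \<in> X" for z
      using inv[OF that, of d] unfolding Rd ipd .
    have "R x y = ap X R d x" using Rd by simp
    also have "\<dots> = (\<Sum>z\<in>X. R x z * (R z y + (\<Sum>j\<in>?S. s j z * cnj (ap X R (s j) y))))"
      unfolding ap_def using dz by (intro sum.cong) (auto simp: ap_def)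
    also have "\<dots> = (\<Sum>z\<in>X. R x z * R z y) + (\<Sum>z\<in>X. \<Sum>j\<in>?S. (R x z * s j z) * cnj (ap X R (s j) y))"
      by (simp add: distrib_left sum.distrib sum_distrib_left mult.assoc)
    also have "(\<Sum>z\<in>X. \<Sum>j\<in>?S. (R x z * s j z) * cnj (ap X R (s j) y)) = (\<Sum>j\<in>?S. ap X R (s j) x * cnj (ap X R (s j) y))"
      by (subst sum.swap) (simp add: ap_def sum_distrib_right)
    finally show ?thesis by simp
  qed
  show ?thesis
  proof (intro exI[of _ l] exI[of _ w] conjI ballI allI)
    fix x y assume x: "x \<in> X" and y: "y \<in> X"
    have "(\<Sum>k\<in>I. \<Sum>j\<in>J k. l k j x * cnj (l k j y)) = (\<Sum>j\<in>?S. 4 * (ap X R (s j) x * cnj (ap X R (s j) y)))"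
      using I J by (subst sum.Sigma) (auto simp: l_def s_def intro!: sum.cong)
    also have "\<dots> = 4 * (R x y - (\<Sum>z\<in>X. R x z * R z y))"
      unfolding sum_distrib_left[symmetric] RSR[OF x y] ..
    finally have 1: "(\<Sum>k\<in>I. \<Sum>j\<in>J k. l k j x * cnj (l k j y)) = 4 * (R x y - (\<Sum>z\<in>X. R x z * R z y))" .
    have "(\<Sum>z\<in>X. w z x * cnj (w z y)) = (\<Sum>z\<in>X. ((if x = z then 1 else 0) - 2 * R x z) * ((if y = z then 1 else 0) - 2 * R z y))"
      by (intro sum.cong refl) (simp add: w_def herm[OF y])
    also have "\<dots> = (\<Sum>z\<in>X. (if x = z then (if y = z then 1 else 0) else 0) - (if x = z then 2 * R z y else 0)
         - (if y = z then 2 * R x z else 0) + 4 * (R x z * R z y))"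
      by (intro sum.cong refl) (auto simp: algebra_simps)
    also have "\<dots> = (if x = y then 1 else 0) - 4 * R x y + 4 * (\<Sum>z\<in>X. R x z * R z y)"
      using X x y by (simp add: sum.distrib sum_subtractf sum_distrib_left)
    finally show "(\<Sum>k\<in>I. \<Sum>j\<in>J k. l k j x * cnj (l k j y)) + (\<Sum>z\<in>X. w z x * cnj (w z y)) = (if x = y then 1 else 0)"
      using 1 by simp
  next
    fix k \<phi> assume k: "k \<in> I"
    have sum1: "(\<Sum>j\<in>{k} \<times> J k. f (s j)) = (\<Sum>j\<in>J k. f (t k j))" for f :: "_ \<Rightarrow> real"
      by (intro sum.reindex_bij_witness[of _ "Pair k" snd]) (auto simp: s_def)
    have eq: "?S - {k} \<times> J k = Sigma (I - {k}) J" by auto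
    have sum2: "(\<Sum>j\<in>Sigma (I - {k}) J. f (s j)) = (\<Sum>k'\<in>I - {k}. \<Sum>j\<in>J k'. f (t k' j))" for f :: "_ \<Rightarrow> real"
      using I J by (subst sum.Sigma) (auto simp: s_def split_def)
    have lk: "prb X (l k j) \<phi> = 4 * prb X (t k j) (ap X R \<phi>)" for j
    proof -
      have "ip X (l k j) \<phi> = 2 * ip X (ap X R (t k j)) \<phi>"
        by (simp add: ip_def l_def sum_distrib_left mult.assoc)
      also have "ip X (ap X R (t k j)) \<phi> = ip X (t k j) (ap X R \<phi>)"
        by (rule ip_ap_swap[symmetric]) (rule herm)
      finally show ?thesis by (simp add: norm_mult power_mult_distrib)
    qed
    have "nsq X \<phi> - 4 * (\<Sum>j\<in>{k} \<times> J k. prb X (s j) (ap X R \<phi>))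
     \<le> 2 * (nsq X \<phi> - (\<Sum>j\<in>{k} \<times> J k. prb X (s j) \<phi>))
       + 4 * (\<Sum>j\<in>?S - {k} \<times> J k. prb X (s j) \<phi>)"
    proof (rule resolvent_measurement_bound[OF S _ inv])
      fix w show "(\<Sum>j\<in>{k} \<times> J k. prb X (s j) w) \<le> nsq X w"
        using contr[OF k] sum1[of "\<lambda>v. prb X v w"] by simp
    qed (use k in auto)
    then show "nsq X \<phi> - (\<Sum>j\<in>J k. prb X (l k j) \<phi>)
      \<le> 2 * (nsq X \<phi> - (\<Sum>j\<in>J k. prb X (t k j) \<phi>))
        + 4 * (\<Sum>k'\<in>I - {k}. \<Sum>j\<in>J k'. prb X (t k' j) \<phi>)"
      unfolding eq sum1[of "\<lambda>v. prb X v \<phi>"] sum1[of "\<lambda>v. prb X v (ap X R \<phi>)"]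
        sum2[of "\<lambda>v. prb X v \<phi>"] lk sum_distrib_left .
  qed
qed

section \<open>Position-based coding\<close>

lemma sum_PiE_split:
  assumes "k \<in> I"
  shows "(\<Sum>e\<in>PiE I (\<lambda>_. A). f e) = (\<Sum>r\<in>PiE (I - {k}) (\<lambda>_. A). \<Sum>x\<in>A. f (r(k := x)))"
proof -
  have I: "I = insert k (I - {k})" using assms by auto
  have "(\<Sum>e\<in>PiE I (\<lambda>_. A). f e) = (\<Sum>e\<in>(\<lambda>(y, g). g(k := y)) ` (A \<times> PiE (I - {k}) (\<lambda>_. A)). f e)"
    using PiE_insert_eq[of k "I - {k}" "\<lambda>_. A"] I by simp
  also have "\<dots> = (\<Sum>(y,g)\<in>A \<times> PiE (I - {k}) (\<lambda>_. A). f (g(k := y)))"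
    using inj_combinator[of k "I - {k}" "\<lambda>_. A"] by (subst sum.reindex) (auto simp: split_def)
  also have "\<dots> = (\<Sum>y\<in>A. \<Sum>g\<in>PiE (I - {k}) (\<lambda>_. A). f (g(k := y)))"
    by (rule sum.cartesian_product[symmetric])
  also have "\<dots> = (\<Sum>r\<in>PiE (I - {k}) (\<lambda>_. A). \<Sum>x\<in>A. f (r(k := x)))"
    by (rule sum.swap)
  finally show ?thesis .
qed

lemma nsq_scale_right: "nsq X (\<lambda>i. v i * c) = nsq X v * (cmod c)\<^sup>2"
  by (simp add: nsq_def norm_mult power_mult_distrib sum_distrib_right)

text \<open>Trace preservation says that stacking the operators \<open>K l\<close> into one map,
  with values indexed by \<open>(l, y)\<close>, gives an isometry.\<close>

lemma isometry_ip:
  assumes A: "finite A"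
    and tp: "\<And>x x'. x \<in> A \<Longrightarrow> x' \<in> A \<Longrightarrow>
      (\<Sum>l\<in>L. \<Sum>y\<in>B. cnj (K l y x) * K l y x') = (if x = x' then 1 else 0)"
  shows "(\<Sum>l\<in>L. ip B (\<lambda>y. \<Sum>x\<in>A. K l y x * u x) (\<lambda>y. \<Sum>x\<in>A. K l y x * v x)) = ip A u v"
proof -
  let ?P = "L \<times> B" and ?K = "\<lambda>(l,y) x. K l y x"
  have "(\<Sum>l\<in>L. ip B (\<lambda>y. \<Sum>x\<in>A. K l y x * u x) (\<lambda>y. \<Sum>x\<in>A. K l y x * v x))
    = (\<Sum>p\<in>?P. (\<Sum>x\<in>A. cnj (?K p x * u x)) * (\<Sum>x'\<in>A. ?K p x' * v x'))"
    by (simp add: sum_Times ip_def)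
  also have "\<dots> = (\<Sum>p\<in>?P. \<Sum>x\<in>A. \<Sum>x'\<in>A. cnj (u x) * v x' * (cnj (?K p x) * ?K p x'))"
    unfolding sum_product by (intro sum.cong refl) (simp add: mult_ac)
  also have "\<dots> = (\<Sum>x\<in>A. \<Sum>p\<in>?P. \<Sum>x'\<in>A. cnj (u x) * v x' * (cnj (?K p x) * ?K p x'))"
    by (rule sum.swap)
  also have "\<dots> = (\<Sum>x\<in>A. \<Sum>x'\<in>A. \<Sum>p\<in>?P. cnj (u x) * v x' * (cnj (?K p x) * ?K p x'))"
    by (rule sum.cong[OF refl], rule sum.swap)
  also have "\<dots> = (\<Sum>x\<in>A. \<Sum>x'\<in>A. cnj (u x) * v x' * (if x = x' then 1 else 0))"
    by (intro sum.cong refl) (simp add: sum_Times sum_distrib_left[symmetric] tp)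
  also have "\<dots> = ip A u v"
    using A by (simp add: ip_def if_distrib[of "\<lambda>a. _ * a"] cong: if_cong)
  finally show ?thesis .
qed

lemma isometry_nsq:
  assumes A: "finite A"
    and tp: "\<And>x x'. x \<in> A \<Longrightarrow> x' \<in> A \<Longrightarrow>
      (\<Sum>l\<in>L. \<Sum>y\<in>B. cnj (K l y x) * K l y x') = (if x = x' then 1 else 0)"
  shows "(\<Sum>l\<in>L. nsq B (\<lambda>y. \<Sum>x\<in>A. K l y x * v x)) = nsq A v"
proof -
  have "complex_of_real (\<Sum>l\<in>L. nsq B (\<lambda>y. \<Sum>x\<in>A. K l y x * v x)) = complex_of_real (nsq A v)"
    unfolding of_real_sum ip_self[symmetric] by (rule isometry_ip[OF A tp])
  then show ?thesis unfolding of_real_eq_iff .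
qed

lemma nsq_pair: "nsq (P \<times> Q) f = (\<Sum>x\<in>Q. nsq P (\<lambda>y. f (y,x)))"
  unfolding nsq_def by (subst sum.swap) (simp add: sum_Times)

text \<open>The one-shot setting: \<open>k\<close> ranges over the shared copies, and
  \<open>K k\<close> is the channel used when copy \<open>k\<close> is sent. In
  \<open>\<psi> k x x'\<close> the index \<open>x\<close> is Alice's half and \<open>x'\<close>
  Bob's. The assumption \<open>collision\<close> sums over Alice's lost half and allows an arbitrary
  vector \<open>\<beta>\<close> on \<open>B\<close>, because the output met by test \<open>k\<close>
  may come from any of the channels.\<close>

locale position_code =
  fixes I :: "'k set" and A :: "'a set" and B :: "'b set" and L :: "'k \<Rightarrow> 'l set"
    and K :: "'k \<Rightarrow> 'l \<Rightarrow> 'b \<Rightarrow> 'a \<Rightarrow> complex" and \<psi> :: "'k \<Rightarrow> 'a \<Rightarrow> 'a \<Rightarrow> complex"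
    and J :: "'k \<Rightarrow> 'j set" and t :: "'k \<Rightarrow> 'j \<Rightarrow> 'b \<times> 'a \<Rightarrow> complex"
    and eps lam :: real
  assumes finI: "finite I" and finA: "finite A" and finB: "finite B"
    and finJ: "\<And>k. k \<in> I \<Longrightarrow> finite (J k)"
    and norm: "\<And>k. k \<in> I \<Longrightarrow> (\<Sum>x\<in>A. \<Sum>y\<in>A. (cmod (\<psi> k x y))\<^sup>2) = 1"
    and tp: "\<And>k x x'. k \<in> I \<Longrightarrow> x \<in> A \<Longrightarrow> x' \<in> A \<Longrightarrow>
      (\<Sum>l\<in>L k. \<Sum>y\<in>B. cnj (K k l y x) * K k l y x') = (if x = x' then 1 else 0)"
    and contr: "\<And>k \<phi>. k \<in> I \<Longrightarrow> (\<Sum>j\<in>J k. prb (B \<times> A) (t k j) \<phi>) \<le> nsq (B \<times> A) \<phi>"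
    and success: "\<And>k. k \<in> I \<Longrightarrow> 1 - eps \<le>
      (\<Sum>l\<in>L k. \<Sum>j\<in>J k. prb (B \<times> A) (t k j) (\<lambda>(y,x'). \<Sum>x\<in>A. K k l y x * \<psi> k x x'))"
    and collision: "\<And>k \<beta>. k \<in> I \<Longrightarrow>
      (\<Sum>x\<in>A. \<Sum>j\<in>J k. prb (B \<times> A) (t k j) (\<lambda>(y,x'). \<beta> y * \<psi> k x x')) \<le> lam * nsq B \<beta>"
    and lam0: "0 \<le> lam"
begin

abbreviation "E \<equiv> PiE I (\<lambda>_. A)"
abbreviation "Er k \<equiv> PiE (I - {k}) (\<lambda>_. A)"

definition out :: "'k \<Rightarrow> 'l \<Rightarrow> 'b \<times> 'a \<Rightarrow> complex" where
  "out k l = (\<lambda>(y,x'). \<Sum>x\<in>A. K k l y x * \<psi> k x x')"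

text \<open>The amplitude of the copies in \<open>S\<close> with Alice's halves at \<open>r\<close>
  and Bob's halves at \<open>e\<close>.\<close>

definition wt :: "'k set \<Rightarrow> ('k \<Rightarrow> 'a) \<Rightarrow> ('k \<Rightarrow> 'a) \<Rightarrow> complex" where
  "wt S r e = (\<Prod>m\<in>S. \<psi> m (r m) (e m))"

text \<open>The vector on Bob's side when copy \<open>k\<close> is sent, Kraus index
  \<open>l\<close> occurs and the discarded halves of the other copies are found at
  \<open>r\<close>. The projectors summed over \<open>l\<close> and \<open>r\<close> give the
  received mixed state.\<close>

definition st :: "'k \<Rightarrow> 'l \<Rightarrow> ('k \<Rightarrow> 'a) \<Rightarrow> 'b \<times> ('k \<Rightarrow> 'a) \<Rightarrow> complex" where
  "st k l r = (\<lambda>(y,e). out k l (y, e k) * wt (I - {k}) r e)"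

text \<open>Rank-one decomposition of the test on \<open>B\<close> and slot \<open>k\<close>,
  tensored with the identity on the other slots: \<open>r\<close> runs through a basis of the
  latter.\<close>

definition slot_test :: "'k \<Rightarrow> 'j \<times> ('k \<Rightarrow> 'a) \<Rightarrow> 'b \<times> ('k \<Rightarrow> 'a) \<Rightarrow> complex" where
  "slot_test k = (\<lambda>(j,r) (y,e). if \<forall>m\<in>I - {k}. e m = r m then t k j (y, e k) else 0)"

lemma finE: "finite E" using finI finA by (intro finite_PiE) auto
lemma finEr: "finite (Er k)" using finI finA by (intro finite_PiE) auto

text \<open>The double sum factors into one squared norm per copy. For \<open>S = I\<close> it
  normalises the shared state; for smaller \<open>S\<close> it removes the untouched copies from the
  later sums.\<close>

lemma wt_total:
  assumes "S \<subseteq> I"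
  shows "(\<Sum>r\<in>PiE S (\<lambda>_. A). \<Sum>e\<in>PiE S (\<lambda>_. A). (cmod (wt S r e))\<^sup>2) = 1"
proof -
  have S: "finite S" using assms finI finite_subset by blast
  have "(\<Sum>e\<in>PiE S (\<lambda>_. A). (cmod (wt S r e))\<^sup>2) = (\<Prod>m\<in>S. \<Sum>y\<in>A. (cmod (\<psi> m (r m) y))\<^sup>2)" for r
    using S finA by (subst prod_sum_PiE) (auto simp: wt_def prod_norm[symmetric] prod_power_distrib)
  then have "(\<Sum>r\<in>PiE S (\<lambda>_. A). \<Sum>e\<in>PiE S (\<lambda>_. A). (cmod (wt S r e))\<^sup>2)
     = (\<Prod>m\<in>S. \<Sum>x\<in>A. \<Sum>y\<in>A. (cmod (\<psi> m x y))\<^sup>2)"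
    using S finA by (subst prod_sum_PiE) auto
  also have "\<dots> = 1" using assms norm by (intro prod.neutral) auto
  finally show ?thesis .
qed

lemma ip_slot_test:
  assumes k: "k \<in> I" and r: "r \<in> Er k"
  shows "ip (B \<times> E) (slot_test k (j,r)) \<phi> = ip (B \<times> A) (t k j) (\<lambda>(y,x). \<phi> (y, r(k := x)))"
proof -
  have eq: "(\<forall>m\<in>I - {k}. q m = r m) = (q = r)" if "q \<in> Er k" for q
    using that r by (metis PiE_ext)
  have "ip (B \<times> E) (slot_test k (j,r)) \<phi> = (\<Sum>y\<in>B. \<Sum>e\<in>E. cnj (slot_test k (j,r) (y,e)) * \<phi> (y,e))"
    by (simp add: ip_def sum_Times)
  also have "\<dots> = (\<Sum>y\<in>B. \<Sum>q\<in>Er k. \<Sum>x\<in>A. cnj (slot_test k (j,r) (y,q(k:=x))) * \<phi> (y,q(k:=x)))"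
    using k by (simp add: sum_PiE_split)
  also have "\<dots> = (\<Sum>y\<in>B. \<Sum>q\<in>Er k. if q = r then (\<Sum>x\<in>A. cnj (t k j (y,x)) * \<phi> (y,q(k:=x))) else 0)"
    using eq by (intro sum.cong refl) (auto simp: slot_test_def)
  also have "\<dots> = (\<Sum>y\<in>B. \<Sum>x\<in>A. cnj (t k j (y,x)) * \<phi> (y,r(k:=x)))"
    using r finEr by simp
  also have "\<dots> = ip (B \<times> A) (t k j) (\<lambda>(y,x). \<phi> (y, r(k := x)))"
    by (simp add: ip_def sum_Times)
  finally show ?thesis .
qed

lemma nsq_slot:
  assumes k: "k \<in> I"
  shows "nsq (B \<times> E) \<phi> = (\<Sum>r\<in>Er k. nsq (B \<times> A) (\<lambda>(y,x). \<phi> (y, r(k := x))))"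
proof -
  have "nsq (B \<times> E) \<phi> = (\<Sum>y\<in>B. \<Sum>e\<in>E. (cmod (\<phi> (y,e)))\<^sup>2)"
    by (simp add: nsq_def sum_Times)
  also have "\<dots> = (\<Sum>y\<in>B. \<Sum>q\<in>Er k. \<Sum>x\<in>A. (cmod (\<phi> (y,q(k:=x))))\<^sup>2)"
    using k by (simp add: sum_PiE_split)
  also have "\<dots> = (\<Sum>q\<in>Er k. \<Sum>y\<in>B. \<Sum>x\<in>A. (cmod (\<phi> (y,q(k:=x))))\<^sup>2)"
    by (rule sum.swap)
  also have "\<dots> = (\<Sum>r\<in>Er k. nsq (B \<times> A) (\<lambda>(y,x). \<phi> (y, r(k := x))))"
    by (simp add: nsq_def sum_Times)
  finally show ?thesis .
qed

text \<open>Fixing the content \<open>r\<close> of the other slots splits the space into orthogonal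
  blocks, and on each block the contraction property of the single test applies.\<close>

lemma slot_test_contr:
  assumes k: "k \<in> I"
  shows "(\<Sum>jr\<in>J k \<times> Er k. prb (B \<times> E) (slot_test k jr) \<phi>) \<le> nsq (B \<times> E) \<phi>"
proof -
  have "(\<Sum>jr\<in>J k \<times> Er k. prb (B \<times> E) (slot_test k jr) \<phi>)
     = (\<Sum>j\<in>J k. \<Sum>r\<in>Er k. prb (B \<times> E) (slot_test k (j,r)) \<phi>)"
    by (simp add: sum_Times)
  also have "\<dots> = (\<Sum>r\<in>Er k. \<Sum>j\<in>J k. prb (B \<times> A) (t k j) (\<lambda>(y,x). \<phi> (y, r(k := x))))"
    using k by (subst sum.swap) (simp add: ip_slot_test)
  also have "\<dots> \<le> nsq (B \<times> E) \<phi>"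
    unfolding nsq_slot[OF k] by (intro sum_mono contr k)
  finally show ?thesis .
qed

lemma st_same_slot:
  assumes "k \<in> I"
  shows "st k l r (y, q(k := x)) = out k l (y,x) * wt (I - {k}) r q"
  by (simp add: st_def wt_def)

lemma nsq_out:
  assumes k: "k \<in> I"
  shows "(\<Sum>l\<in>L k. nsq (B \<times> A) (out k l)) = 1"
proof -
  have "(\<Sum>l\<in>L k. nsq (B \<times> A) (out k l)) = (\<Sum>z\<in>A. \<Sum>l\<in>L k. nsq B (\<lambda>y. \<Sum>x\<in>A. K k l y x * \<psi> k x z))"
    unfolding nsq_pair by (subst sum.swap) (simp add: out_def)
  also have "\<dots> = (\<Sum>z\<in>A. nsq A (\<lambda>x. \<psi> k x z))"
    using k by (intro sum.cong refl isometry_nsq finA tp)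
  also have "\<dots> = 1"
    unfolding nsq_def by (subst sum.swap) (rule norm[OF k])
  finally show ?thesis .
qed

lemma st_total:
  assumes k: "k \<in> I"
  shows "(\<Sum>l\<in>L k. \<Sum>r\<in>Er k. nsq (B \<times> E) (st k l r)) = 1"
proof -
  have "nsq (B \<times> E) (st k l r) = nsq (B \<times> A) (out k l) * (\<Sum>q\<in>Er k. (cmod (wt (I - {k}) r q))\<^sup>2)" for l r
  proof -
    have "nsq (B \<times> A) (\<lambda>(y,x). st k l r (y, q(k := x))) = nsq (B \<times> A) (out k l) * (cmod (wt (I - {k}) r q))\<^sup>2" for q
      unfolding nsq_scale_right[symmetric] using k by (intro nsq_cong) (auto simp: st_same_slot)
    then show ?thesis unfolding nsq_slot[OF k] by (simp add: sum_distrib_left)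
  qed
  then have "(\<Sum>l\<in>L k. \<Sum>r\<in>Er k. nsq (B \<times> E) (st k l r))
     = (\<Sum>l\<in>L k. nsq (B \<times> A) (out k l)) * (\<Sum>r\<in>Er k. \<Sum>q\<in>Er k. (cmod (wt (I - {k}) r q))\<^sup>2)"
    by (simp add: sum_product)
  then show ?thesis using nsq_out[OF k] wt_total[of "I - {k}"] by auto
qed

lemma st_success:
  assumes k: "k \<in> I"
  shows "1 - eps \<le> (\<Sum>l\<in>L k. \<Sum>r\<in>Er k. \<Sum>jr\<in>J k \<times> Er k. prb (B \<times> E) (slot_test k jr) (st k l r))"
proof -
  have "(\<Sum>jr\<in>J k \<times> Er k. prb (B \<times> E) (slot_test k jr) (st k l r))
     = (\<Sum>j\<in>J k. prb (B \<times> A) (t k j) (out k l)) * (\<Sum>q\<in>Er k. (cmod (wt (I - {k}) r q))\<^sup>2)" for l r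
  proof -
    have "ip (B \<times> A) (t k j) (\<lambda>(y,x). st k l r (y, q(k := x))) = ip (B \<times> A) (t k j) (out k l) * wt (I - {k}) r q" for j q
      unfolding ip_scale_right'[symmetric] using k by (intro ip_cong) (auto simp: st_same_slot)
    then have "(\<Sum>j\<in>J k. \<Sum>q\<in>Er k. prb (B \<times> E) (slot_test k (j,q)) (st k l r))
      = (\<Sum>j\<in>J k. \<Sum>q\<in>Er k. prb (B \<times> A) (t k j) (out k l) * (cmod (wt (I - {k}) r q))\<^sup>2)"
      using k by (intro sum.cong refl) (simp add: ip_slot_test norm_mult power_mult_distrib)
    then show ?thesis by (simp add: sum_Times sum_product)
  qed
  then have "(\<Sum>l\<in>L k. \<Sum>r\<in>Er k. \<Sum>jr\<in>J k \<times> Er k. prb (B \<times> E) (slot_test k jr) (st k l r))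
     = (\<Sum>l\<in>L k. \<Sum>j\<in>J k. prb (B \<times> A) (t k j) (out k l)) * (\<Sum>r\<in>Er k. \<Sum>q\<in>Er k. (cmod (wt (I - {k}) r q))\<^sup>2)"
    by (simp add: sum_product)
  then show ?thesis using success[OF k] wt_total[of "I - {k}"] by (auto simp: out_def)
qed

text \<open>Slot \<open>k'\<close> was not sent, so with Alice's half at \<open>z\<close> the state
  on \<open>B\<close> and this slot is a product of some \<open>\<beta>\<close> with
  \<open>\<psi> k' z\<close>, the form covered by \<open>collision\<close>. Bob's half
  \<open>z'\<close> of the sent copy merely labels \<open>\<beta>\<close>, and the remaining slots
  have total weight 1.\<close>

lemma st_collision:
  assumes k: "k \<in> I" and k': "k' \<in> I" and ne: "k' \<noteq> k"
  shows "(\<Sum>l\<in>L k. \<Sum>r\<in>Er k. \<Sum>jr\<in>J k' \<times> Er k'. prb (B \<times> E) (slot_test k' jr) (st k l r)) \<le> lam"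
proof -
  define S where "S = I - {k} - {k'}"
  have S': "I - {k'} - {k} = S" by (auto simp: S_def)
  have finS: "finite S" using finI by (auto simp: S_def)
  define \<beta> where "\<beta> l z = (\<lambda>y. out k l (y,z))" for l z
  have st_other: "st k l (q(k' := z)) (y, (q'(k := z'))(k' := x)) = \<beta> l z' y * \<psi> k' z x * wt S q q'" for l q z y q' z' x
  proof -
    have I: "I - {k} = insert k' S" using k' ne by (auto simp: S_def)
    have "(\<Prod>m\<in>S. \<psi> m ((q(k' := z)) m) (((q'(k := z'))(k' := x)) m)) = (\<Prod>m\<in>S. \<psi> m (q m) (q' m))"
      by (intro prod.cong refl) (auto simp: S_def)
    moreover have nS: "k' \<notin> S" by (simp add: S_def)
    ultimately show ?thesis
      using ne by (simp only: st_def wt_def I prod.insert[OF finS nS] split_conv fun_upd_same \<beta>_def) (simp add: mult.assoc)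
  qed
  have "(\<Sum>r\<in>Er k. \<Sum>jr\<in>J k' \<times> Er k'. prb (B \<times> E) (slot_test k' jr) (st k l r))
     \<le> lam * (\<Sum>z'\<in>A. nsq B (\<beta> l z'))" for l
  proof -
    have "(\<Sum>r\<in>Er k. \<Sum>jr\<in>J k' \<times> Er k'. prb (B \<times> E) (slot_test k' jr) (st k l r))
     = (\<Sum>r\<in>Er k. \<Sum>j\<in>J k'. \<Sum>r'\<in>Er k'. prb (B \<times> A) (t k' j) (\<lambda>(y,x). st k l r (y, r'(k' := x))))"
      using k' by (simp add: sum_Times ip_slot_test)
    also have "\<dots> = (\<Sum>q\<in>PiE S (\<lambda>_. A). \<Sum>z\<in>A. \<Sum>j\<in>J k'. \<Sum>q'\<in>PiE S (\<lambda>_. A). \<Sum>z'\<in>A.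
         prb (B \<times> A) (t k' j) (\<lambda>(y,x). st k l (q(k':=z)) (y, (q'(k:=z'))(k' := x))))"
    proof -
      have "k' \<in> I - {k}" "k \<in> I - {k'}" using k k' ne by auto
      then show ?thesis
        by (simp only: sum_PiE_split[of k' "I - {k}"] sum_PiE_split[of k "I - {k'}"] S' S_def[symmetric])
    qed
    also have "\<dots> = (\<Sum>q\<in>PiE S (\<lambda>_. A). \<Sum>z\<in>A. \<Sum>j\<in>J k'. \<Sum>q'\<in>PiE S (\<lambda>_. A). \<Sum>z'\<in>A.
         prb (B \<times> A) (t k' j) (\<lambda>(y,x). \<beta> l z' y * \<psi> k' z x) * (cmod (wt S q q'))\<^sup>2)"
    proof -
      have "ip (B \<times> A) (t k' j) (\<lambda>(y,x). st k l (q(k':=z)) (y, (q'(k:=z'))(k' := x)))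
         = ip (B \<times> A) (t k' j) (\<lambda>(y,x). \<beta> l z' y * \<psi> k' z x) * wt S q q'" for j q z q' z'
        unfolding ip_scale_right'[symmetric] st_other by (simp add: split_def)
      then show ?thesis by (simp add: norm_mult power_mult_distrib)
    qed
    also have "\<dots> = (\<Sum>q\<in>PiE S (\<lambda>_. A). \<Sum>q'\<in>PiE S (\<lambda>_. A). \<Sum>z'\<in>A. (cmod (wt S q q'))\<^sup>2 *
         (\<Sum>z\<in>A. \<Sum>j\<in>J k'. prb (B \<times> A) (t k' j) (\<lambda>(y,x). \<beta> l z' y * \<psi> k' z x)))"
      (is "_ = ?R")
    proof -
      let ?f = "\<lambda>z j z'. prb (B \<times> A) (t k' j) (\<lambda>(y,x). \<beta> l z' y * \<psi> k' z x)"
      have "(\<Sum>z\<in>A. \<Sum>j\<in>J k'. \<Sum>q'\<in>Q. \<Sum>z'\<in>A. ?f z j z' * c q') = (\<Sum>q'\<in>Q. \<Sum>z'\<in>A. c q' * (\<Sum>z\<in>A. \<Sum>j\<in>J k'. ?f z j z'))"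
        for c :: "('k \<Rightarrow> 'a) \<Rightarrow> real" and Q
      proof -
        have "(\<Sum>z\<in>A. \<Sum>j\<in>J k'. \<Sum>q'\<in>Q. \<Sum>z'\<in>A. ?f z j z' * c q') = (\<Sum>zj\<in>A \<times> J k'. \<Sum>qz\<in>Q \<times> A. ?f (fst zj) (snd zj) (snd qz) * c (fst qz))"
          by (simp add: sum_Times)
        also have "\<dots> = (\<Sum>qz\<in>Q \<times> A. \<Sum>zj\<in>A \<times> J k'. ?f (fst zj) (snd zj) (snd qz) * c (fst qz))"
          by (rule sum.swap)
        also have "\<dots> = (\<Sum>q'\<in>Q. \<Sum>z'\<in>A. c q' * (\<Sum>z\<in>A. \<Sum>j\<in>J k'. ?f z j z'))"
          by (simp add: sum_Times sum_distrib_left mult.commute split_def)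
        finally show ?thesis .
      qed
      then show ?thesis by simp
    qed
    also have "\<dots> \<le> (\<Sum>q\<in>PiE S (\<lambda>_. A). \<Sum>q'\<in>PiE S (\<lambda>_. A). \<Sum>z'\<in>A. (cmod (wt S q q'))\<^sup>2 * (lam * nsq B (\<beta> l z')))"
      using k' by (intro sum_mono mult_left_mono collision) auto
    also have "\<dots> = (\<Sum>q\<in>PiE S (\<lambda>_. A). \<Sum>q'\<in>PiE S (\<lambda>_. A). (cmod (wt S q q'))\<^sup>2) * (lam * (\<Sum>z'\<in>A. nsq B (\<beta> l z')))"
      by (simp only: sum_distrib_left[symmetric] sum_distrib_right[symmetric])
    also have "\<dots> = lam * (\<Sum>z'\<in>A. nsq B (\<beta> l z'))"
      using wt_total[of S] by (auto simp: S_def)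
    finally show ?thesis .
  qed
  then have "(\<Sum>l\<in>L k. \<Sum>r\<in>Er k. \<Sum>jr\<in>J k' \<times> Er k'. prb (B \<times> E) (slot_test k' jr) (st k l r))
    \<le> (\<Sum>l\<in>L k. lam * (\<Sum>z'\<in>A. nsq B (\<beta> l z')))"
    by (intro sum_mono)
  also have "\<dots> = lam * (\<Sum>l\<in>L k. nsq (B \<times> A) (out k l))"
    by (simp add: nsq_pair \<beta>_def sum_distrib_left)
  also have "\<dots> = lam" using nsq_out[OF k] by simp
  finally show ?thesis .
qed

text \<open>The inequality of \<open>resolvent_measurement\<close> is applied to every vector
  \<open>st k l r\<close> and summed. The test of the sent copy contributes at most
  \<open>2 * eps\<close>, that of every other copy at most \<open>4 * lam\<close>.\<close>

lemma povm_exists: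
  "\<exists>(v :: 'k \<Rightarrow> 'j \<times> ('k \<Rightarrow> 'a) \<Rightarrow> 'b \<times> ('k \<Rightarrow> 'a) \<Rightarrow> complex) w.
    (\<forall>x\<in>B \<times> E. \<forall>y\<in>B \<times> E.
      (\<Sum>k\<in>I. \<Sum>j\<in>J k \<times> Er k. v k j x * cnj (v k j y)) + (\<Sum>z\<in>B \<times> E. w z x * cnj (w z y)) = (if x = y then 1 else 0)) \<and>
    (\<forall>k\<in>I. 1 - (\<Sum>l\<in>L k. \<Sum>r\<in>Er k. \<Sum>j\<in>J k \<times> Er k. prb (B \<times> E) (v k j) (st k l r))
      \<le> 2 * eps + 4 * real (card I) * lam)"
proof -
  have finZ: "finite (B \<times> E)" using finB finE by auto
  have finJ': "finite (J k \<times> Er k)" if "k \<in> I" for k using finJ[OF that] finEr by auto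
  have "\<exists>(v :: 'k \<Rightarrow> 'j \<times> ('k \<Rightarrow> 'a) \<Rightarrow> 'b \<times> ('k \<Rightarrow> 'a) \<Rightarrow> complex) w.
    (\<forall>x\<in>B \<times> E. \<forall>y\<in>B \<times> E.
      (\<Sum>k\<in>I. \<Sum>j\<in>J k \<times> Er k. v k j x * cnj (v k j y)) + (\<Sum>z\<in>B \<times> E. w z x * cnj (w z y)) = (if x = y then 1 else 0)) \<and>
    (\<forall>k\<in>I. \<forall>\<phi>. nsq (B \<times> E) \<phi> - (\<Sum>j\<in>J k \<times> Er k. prb (B \<times> E) (v k j) \<phi>)
      \<le> 2 * (nsq (B \<times> E) \<phi> - (\<Sum>j\<in>J k \<times> Er k. prb (B \<times> E) (slot_test k j) \<phi>))
        + 4 * (\<Sum>k'\<in>I - {k}. \<Sum>j\<in>J k' \<times> Er k'. prb (B \<times> E) (slot_test k' j) \<phi>))"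
    (is "\<exists>v w. ?compl v w \<and> ?bound v")
    by (rule resolvent_measurement[OF finZ finI finJ' slot_test_contr])
  then obtain v :: "'k \<Rightarrow> 'j \<times> ('k \<Rightarrow> 'a) \<Rightarrow> 'b \<times> ('k \<Rightarrow> 'a) \<Rightarrow> complex" and w
    where compl: "?compl v w" and "?bound v" by (elim exE conjE)
  then have bound: "nsq (B \<times> E) \<phi> - (\<Sum>j\<in>J k \<times> Er k. prb (B \<times> E) (v k j) \<phi>)
      \<le> 2 * (nsq (B \<times> E) \<phi> - (\<Sum>j\<in>J k \<times> Er k. prb (B \<times> E) (slot_test k j) \<phi>))
        + 4 * (\<Sum>k'\<in>I - {k}. \<Sum>j\<in>J k' \<times> Er k'. prb (B \<times> E) (slot_test k' j) \<phi>)"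
    if "k \<in> I" for k \<phi> using that by blast
  have "1 - (\<Sum>l\<in>L k. \<Sum>r\<in>Er k. \<Sum>j\<in>J k \<times> Er k. prb (B \<times> E) (v k j) (st k l r))
      \<le> 2 * eps + 4 * real (card I) * lam" if k: "k \<in> I" for k
  proof -
    let ?T = "\<lambda>k' \<phi>. \<Sum>j\<in>J k' \<times> Er k'. prb (B \<times> E) (slot_test k' j) \<phi>"
    have "1 - (\<Sum>l\<in>L k. \<Sum>r\<in>Er k. \<Sum>j\<in>J k \<times> Er k. prb (B \<times> E) (v k j) (st k l r))
      = (\<Sum>l\<in>L k. \<Sum>r\<in>Er k. nsq (B \<times> E) (st k l r) - (\<Sum>j\<in>J k \<times> Er k. prb (B \<times> E) (v k j) (st k l r)))"
      by (simp add: sum_subtractf st_total[OF k])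
    also have "\<dots> \<le> (\<Sum>l\<in>L k. \<Sum>r\<in>Er k. 2 * (nsq (B \<times> E) (st k l r) - ?T k (st k l r)) + 4 * (\<Sum>k'\<in>I - {k}. ?T k' (st k l r)))"
      by (intro sum_mono bound k)
    also have "\<dots> = 2 * ((\<Sum>l\<in>L k. \<Sum>r\<in>Er k. nsq (B \<times> E) (st k l r)) - (\<Sum>l\<in>L k. \<Sum>r\<in>Er k. ?T k (st k l r)))
       + 4 * (\<Sum>l\<in>L k. \<Sum>r\<in>Er k. \<Sum>k'\<in>I - {k}. ?T k' (st k l r))"
      by (simp only: sum.distrib sum_subtractf sum_distrib_left[symmetric])
    finally have main: "1 - (\<Sum>l\<in>L k. \<Sum>r\<in>Er k. \<Sum>j\<in>J k \<times> Er k. prb (B \<times> E) (v k j) (st k l r))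
      \<le> \<dots>" .
    have "(\<Sum>l\<in>L k. \<Sum>r\<in>Er k. \<Sum>k'\<in>I - {k}. ?T k' (st k l r)) = (\<Sum>k'\<in>I - {k}. \<Sum>l\<in>L k. \<Sum>r\<in>Er k. ?T k' (st k l r))"
    proof -
      have "(\<Sum>l\<in>L k. \<Sum>r\<in>Er k. \<Sum>k'\<in>I - {k}. ?T k' (st k l r)) = (\<Sum>l\<in>L k. \<Sum>k'\<in>I - {k}. \<Sum>r\<in>Er k. ?T k' (st k l r))"
        by (rule sum.cong[OF refl], rule sum.swap)
      also have "\<dots> = (\<Sum>k'\<in>I - {k}. \<Sum>l\<in>L k. \<Sum>r\<in>Er k. ?T k' (st k l r))"
        by (rule sum.swap)
      finally show ?thesis .
    qed
    also have "\<dots> \<le> (\<Sum>k'\<in>I - {k}. lam)"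
      using k by (intro sum_mono st_collision) auto
    also have "\<dots> \<le> real (card I) * lam"
      using lam0 finI by (simp add: card_Diff1_le mult_right_mono)
    finally have "(\<Sum>l\<in>L k. \<Sum>r\<in>Er k. \<Sum>k'\<in>I - {k}. ?T k' (st k l r)) \<le> real (card I) * lam" .
    moreover have "a \<le> 2 * eps + 4 * (C * lam)" if "a \<le> 2 * (n - s) + 4 * c" "1 - eps \<le> s" "n = 1" "c \<le> C * lam"
      for a n s c C :: real using that by simp
    ultimately show ?thesis
      using main st_success[OF k] st_total[OF k] unfolding mult.assoc by blast
  qed
  then show ?thesis using compl by (intro exI[of _ v] exI[of _ w]) auto
qed

end

section \<open>A universal test\<close>

definition orthonormal_on :: "'i set \<Rightarrow> 'x set \<Rightarrow> ('x \<Rightarrow> 'i \<Rightarrow> complex) \<Rightarrow> bool" where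
  "orthonormal_on Z X e \<longleftrightarrow> (\<forall>x\<in>X. \<forall>x'\<in>X. ip Z (e x) (e x') = (if x = x' then 1 else 0))"

definition proj_on :: "'i set \<Rightarrow> 'x set \<Rightarrow> ('x \<Rightarrow> 'i \<Rightarrow> complex) \<Rightarrow> ('i \<Rightarrow> complex) \<Rightarrow> 'i \<Rightarrow> complex" where
  "proj_on Z X e \<phi> = (\<lambda>z. \<Sum>x\<in>X. e x z * ip Z (e x) \<phi>)"

lemma ip_proj_on: "ip Z u (proj_on Z X e \<phi>) = (\<Sum>x\<in>X. cnj (ip Z (e x) u) * ip Z (e x) \<phi>)"
  unfolding proj_on_def by (rule family_ip)

lemma ip_basis_proj_on:
  assumes "finite X" "orthonormal_on Z X e" "x \<in> X"
  shows "ip Z (e x) (proj_on Z X e \<phi>) = ip Z (e x) \<phi>"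
proof -
  have "ip Z (e x) (proj_on Z X e \<phi>) = (\<Sum>x'\<in>X. (if x' = x then 1 else 0) * ip Z (e x') \<phi>)"
    unfolding ip_proj_on using assms by (intro sum.cong refl) (auto simp: orthonormal_on_def)
  also have "\<dots> = ip Z (e x) \<phi>" using assms by (simp add: if_distrib[of "\<lambda>a. a * _"] cong: if_cong)
  finally show ?thesis .
qed

lemma nsq_proj_on:
  assumes "finite X" "orthonormal_on Z X e"
  shows "nsq Z (proj_on Z X e \<phi>) = (\<Sum>x\<in>X. prb Z (e x) \<phi>)"
proof -
  have "complex_of_real (nsq Z (proj_on Z X e \<phi>)) = (\<Sum>x\<in>X. cnj (ip Z (e x) \<phi>) * ip Z (e x) \<phi>)"
    unfolding ip_self[symmetric] ip_proj_on[of Z "proj_on Z X e \<phi>"]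
    using assms by (intro sum.cong refl) (simp add: ip_basis_proj_on)
  also have "\<dots> = complex_of_real (\<Sum>x\<in>X. prb Z (e x) \<phi>)"
    unfolding of_real_sum by (intro sum.cong refl) (metis complex_norm_square mult.commute)
  finally show ?thesis unfolding of_real_eq_iff .
qed

lemma nsq_minus_proj_on:
  assumes "finite X" "orthonormal_on Z X e"
  shows "nsq Z (\<lambda>z. \<phi> z - proj_on Z X e \<phi> z) = nsq Z \<phi> - (\<Sum>x\<in>X. prb Z (e x) \<phi>)"
proof -
  have "ip Z \<phi> (proj_on Z X e \<phi>) = complex_of_real (\<Sum>x\<in>X. prb Z (e x) \<phi>)"
    unfolding proj_on_def by (rule family_ip_self)
  then show ?thesis unfolding nsq_diff nsq_proj_on[OF assms] by simp
qed

lemma bessel: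
  assumes "finite X" "orthonormal_on Z X e"
  shows "(\<Sum>x\<in>X. prb Z (e x) \<phi>) \<le> nsq Z \<phi>"
  using nsq_minus_proj_on[OF assms, of \<phi>] nsq_nonneg[of Z "\<lambda>z. \<phi> z - proj_on Z X e \<phi> z"] by linarith

text \<open>A weighted triangle inequality: a small \<open>c\<close> keeps the factor of the main
  term near 1, as success probabilities close to 1 demand. The constants of
  \<open>cmod_sq_le\<close> would lose half.\<close>

lemma cmod_sq_split:
  assumes "c > 0"
  shows "(cmod a)\<^sup>2 \<le> (1 + c) * (cmod b)\<^sup>2 + (1 + 1/c) * (cmod (a - b))\<^sup>2"
proof -
  have "cmod a \<le> cmod b + cmod (a - b)" by (metis add.commute diff_add_cancel norm_triangle_ineq)
  then have "(cmod a)\<^sup>2 \<le> (cmod b + cmod (a - b))\<^sup>2" by (intro power_mono) auto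
  also have "\<dots> \<le> (1 + c) * (cmod b)\<^sup>2 + (1 + 1/c) * (cmod (a - b))\<^sup>2"
  proof -
    have "0 \<le> (c * cmod b - cmod (a - b))\<^sup>2 / c" using assms by simp
    also have "\<dots> = c * (cmod b)\<^sup>2 - 2 * cmod b * cmod (a - b) + (cmod (a - b))\<^sup>2 / c"
      using assms by (simp add: power2_eq_square field_simps)
    finally show ?thesis by (simp add: power2_eq_square field_simps)
  qed
  finally show ?thesis .
qed

lemma cmod_add_sq_le: "(cmod (a + b))\<^sup>2 \<le> 2 * (cmod a)\<^sup>2 + 2 * (cmod b)\<^sup>2"
  using cmod_sq_le[of "a + b" a] by simp

text \<open>With \<open>R\<close> the inverse of \<open>1 + S\<close> these are
  \<open>R^2 \<le> 1\<close>, \<open>R S R \<le> 1\<close> and \<open>(1 - R)^2 \<le> S\<close> as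
  quadratic forms. In the universal test they give, in this order, the contraction property, the
  collision bound and the Markov-type bound on the damage.\<close>

lemma resolvent_shrink:
  assumes inv: "\<And>x. x \<in> X \<Longrightarrow> \<phi> x = v x + (\<Sum>j\<in>J. t j x * ip X (t j) v)"
  shows "nsq X v \<le> nsq X \<phi>"
    and "(\<Sum>j\<in>J. prb X (t j) v) \<le> nsq X \<phi>"
    and "nsq X (\<lambda>x. \<phi> x - v x) \<le> (\<Sum>j\<in>J. prb X (t j) \<phi>)"
proof -
  define p where "p = Re (ip X v \<phi>)"
  define a where "a = (\<Sum>j\<in>J. prb X (t j) v)"
  define c where "c = (\<Sum>j\<in>J. prb X (t j) \<phi>)"
  have p: "p = nsq X v + a"
    unfolding p_def a_def by (rule resolvent_facts(1)) (rule inv)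
  have q: "(\<Sum>j\<in>J. Re (cnj (ip X (t j) \<phi>) * ip X (t j) v)) = nsq X \<phi> - p"
    unfolding p_def by (rule resolvent_facts(2)) (rule inv)
  have a0: "a \<ge> 0" unfolding a_def by (intro sum_nonneg) auto
  have d: "nsq X (\<lambda>x. \<phi> x - v x) = nsq X \<phi> - 2 * p + nsq X v"
    unfolding nsq_diff p_def by (metis cnj_ip cnj.simps(1))
  have d0: "0 \<le> nsq X \<phi> - 2 * p + nsq X v" unfolding d[symmetric] by simp
  have n0: "nsq X v \<ge> 0" by simp
  show "nsq X v \<le> nsq X \<phi>" using p a0 d0 by simp
  show "(\<Sum>j\<in>J. prb X (t j) v) \<le> nsq X \<phi>"
    unfolding a_def[symmetric] using p a0 d0 n0 by linarith
  have "0 \<le> (\<Sum>j\<in>J. (cmod (ip X (t j) \<phi> - ip X (t j) v))\<^sup>2)" by (intro sum_nonneg) auto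
  also have "\<dots> = c - 2 * (nsq X \<phi> - p) + a"
    unfolding cmod_diff_sq sum.distrib sum_subtractf sum_distrib_left[symmetric] q a_def c_def ..
  finally show "nsq X (\<lambda>x. \<phi> x - v x) \<le> (\<Sum>j\<in>J. prb X (t j) \<phi>)"
    unfolding d c_def[symmetric] using p a0 d0 by simp
qed

text \<open>The test first projects onto \<open>span f\<^sub>Y\<close> and then onto \<open>span e\<^sub>X\<close>, which makes it reject
  the product state. Preceding it by \<open>(1 + \<tau>/\<lambda>)\<^sup>-\<^sup>1\<close>, where \<open>\<tau>\<close> is the acceptance operator on the
  first factor, costs little on the correct state by Markov's inequality, but afterwards the
  test rejects \<open>\<beta> \<otimes> \<psi>\<close> for every \<open>\<beta>\<close> and hence for the output of every other channel.\<close>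

lemma universal_test:
  fixes \<phi> :: "'l \<Rightarrow> 'b \<times> 'a \<Rightarrow> complex" and \<psi> :: "'c \<Rightarrow> 'a \<Rightarrow> complex"
    and e :: "'x \<Rightarrow> 'b \<times> 'a \<Rightarrow> complex" and f :: "'y \<Rightarrow> 'b \<times> 'a \<Rightarrow> complex"
  assumes fin: "finite A" "finite B" "finite C" "finite X" "finite Y"
    and unit: "(\<Sum>l\<in>L. nsq (B \<times> A) (\<phi> l)) = 1"
    and e: "orthonormal_on (B \<times> A) X e" and f: "orthonormal_on (B \<times> A) Y f"
    and X: "1 - \<epsilon> \<le> (\<Sum>x\<in>X. \<Sum>l\<in>L. prb (B \<times> A) (e x) (\<phi> l))"
    and Y: "1 - \<epsilon> \<le> (\<Sum>y\<in>Y. \<Sum>l\<in>L. prb (B \<times> A) (f y) (\<phi> l))"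
    and diag: "\<And>y y'. y \<in> Y \<Longrightarrow> y' \<in> Y \<Longrightarrow>
      (\<Sum>l\<in>L. \<Sum>a\<in>A. \<Sum>c\<in>C. ip (B \<times> A) (f y) (\<lambda>(b,a'). \<phi> l (b,a) * \<psi> c a') *
         cnj (ip (B \<times> A) (f y') (\<lambda>(b,a'). \<phi> l (b,a) * \<psi> c a'))) = (if y = y' then complex_of_real (q y) else 0)"
    and q: "\<And>y. y \<in> Y \<Longrightarrow> q y \<le> Q" and Q: "real (card X) * Q \<le> \<kappa>" "0 \<le> Q" and lam: "0 < lam" and c: "0 < (c::real)"
  shows "\<exists>t. (\<forall>v. (\<Sum>x\<in>X. prb (B \<times> A) (t x) v) \<le> nsq (B \<times> A) v) \<and>
     (\<forall>\<beta>. (\<Sum>c\<in>C. \<Sum>x\<in>X. prb (B \<times> A) (t x) (\<lambda>(b,a). \<beta> b * \<psi> c a)) \<le> lam * nsq B \<beta>) \<and>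
     1 - \<epsilon> \<le> (1 + c) * (\<Sum>l\<in>L. \<Sum>x\<in>X. prb (B \<times> A) (t x) (\<phi> l)) + (1 + 1/c) * (2 * \<epsilon> + 2 * (\<kappa> / lam))"
proof -
  let ?Z = "B \<times> A"
  define P where "P = proj_on ?Z Y f"
  \<comment> \<open>Testing \<open>v\<close> with \<open>g x\<close> means projecting
    \<open>v\<close> by the self-adjoint \<open>P\<close> and then testing with
    \<open>e x\<close>.\<close>
  define g where "g x = (\<lambda>z. P (e x) z)" for x
  have ipg: "ip ?Z (g x) v = ip ?Z (e x) (P v)" for x v
  proof -
    have "ip ?Z (g x) v = cnj (ip ?Z v (P (e x)))" unfolding g_def by (simp add: cnj_ip)
    also have "\<dots> = ip ?Z (e x) (P v)"
      unfolding P_def ip_proj_on by (simp add: mult.commute)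
    finally show ?thesis .
  qed
  have gcontr: "(\<Sum>x\<in>X. prb ?Z (g x) v) \<le> nsq ?Z v" for v
  proof -
    have "(\<Sum>x\<in>X. prb ?Z (g x) v) \<le> nsq ?Z (P v)"
      unfolding ipg by (rule bessel[OF fin(4) e])
    also have "\<dots> \<le> nsq ?Z v" unfolding P_def nsq_proj_on[OF fin(5) f] by (rule bessel[OF fin(5) f])
    finally show ?thesis .
  qed
  \<comment> \<open>Contracting \<open>g x\<close> on \<open>A\<close> with \<open>\<psi> c\<close>
    leaves a vector on \<open>B\<close>; over \<open>C \<times> X\<close> these form the family of
    \<open>\<tau>/\<lambda>\<close>. The root appears because the family enters
    quadratically.\<close>
  define s where "s = (\<lambda>(c,x) b. (\<Sum>a\<in>A. g x (b,a) * cnj (\<psi> c a)) / complex_of_real (sqrt lam))"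
  have ips: "ip B (s (c,x)) \<beta> = ip ?Z (g x) (\<lambda>(b,a). \<beta> b * \<psi> c a) / complex_of_real (sqrt lam)" for c x \<beta>
    unfolding ip_def s_def sum_Times
    by (simp add: sum_distrib_left sum_distrib_right sum_divide_distrib mult_ac)
  have ips_sq: "prb B (s (c,x)) \<beta> = prb ?Z (g x) (\<lambda>(b,a). \<beta> b * \<psi> c a) / lam" for c x \<beta>
    unfolding ips using lam by (simp add: norm_divide power_divide)
  obtain R where herm: "\<And>x y. x \<in> B \<Longrightarrow> y \<in> B \<Longrightarrow> R y x = cnj (R x y)"
    and inv: "\<And>\<beta> b. b \<in> B \<Longrightarrow> \<beta> b = ap B R \<beta> b + (\<Sum>j\<in>C \<times> X. s j b * ip B (s j) (ap B R \<beta>))"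
    using resolvent_exists[OF fin(2), of "C \<times> X" s] fin by blast
  \<comment> \<open>The damping acts on \<open>B\<close> alone, so it maps
    \<open>\<beta> \<otimes> \<psi>\<close> to a product with the same factor on
    \<open>A\<close>.\<close>
  define F where "F v = (\<lambda>(b,a). ap B R (\<lambda>b'. v (b',a)) b)" for v :: "'b \<times> 'a \<Rightarrow> complex"
  define t where "t x = F (g x)" for x
  have ipt: "ip ?Z (t x) v = ip ?Z (g x) (F v)" for x v
  proof -
    have pair: "ip ?Z u v = (\<Sum>a\<in>A. ip B (\<lambda>b. u (b,a)) (\<lambda>b. v (b,a)))" for u v
      unfolding ip_def sum_Times by (rule sum.swap)
    have "ip B (ap B R (\<lambda>b. g x (b,a))) (\<lambda>b. v (b,a)) = ip B (\<lambda>b. g x (b,a)) (ap B R (\<lambda>b. v (b,a)))" for a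
      by (rule ip_ap_swap[symmetric]) (rule herm)
    then show ?thesis unfolding pair t_def F_def by simp
  qed
  have nsqF: "nsq ?Z (F v) \<le> nsq ?Z v" for v
    unfolding nsq_pair F_def split_conv
    by (intro sum_mono resolvent_shrink(1)[of B _ _ s "C \<times> X"]) (rule inv)
  have tcontr: "(\<Sum>x\<in>X. prb ?Z (t x) v) \<le> nsq ?Z v" for v
    unfolding ipt using gcontr[of "F v"] nsqF[of v] by linarith
  have tcoll: "(\<Sum>c\<in>C. \<Sum>x\<in>X. prb ?Z (t x) (\<lambda>(b,a). \<beta> b * \<psi> c a)) \<le> lam * nsq B \<beta>" for \<beta>
  proof -
    have "F (\<lambda>(b,a). \<beta> b * \<psi> c a) = (\<lambda>(b,a). ap B R \<beta> b * \<psi> c a)" for c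
      unfolding F_def ap_def by (auto simp: sum_distrib_right mult.assoc)
    then have "(\<Sum>c\<in>C. \<Sum>x\<in>X. prb ?Z (t x) (\<lambda>(b,a). \<beta> b * \<psi> c a))
       = (\<Sum>c\<in>C. \<Sum>x\<in>X. lam * prb B (s (c,x)) (ap B R \<beta>))"
      unfolding ipt ips_sq using lam by simp
    also have "\<dots> = lam * (\<Sum>j\<in>C \<times> X. prb B (s j) (ap B R \<beta>))"
      by (simp add: sum_Times sum_distrib_left)
    also have "\<dots> \<le> lam * nsq B \<beta>"
      using lam by (intro mult_left_mono resolvent_shrink(2)[of B _ _ s "C \<times> X"] inv) auto
    finally show ?thesis .
  qed
  \<comment> \<open>The bound \<open>(1 - R)^2 \<le> S\<close>, used for every index in
    \<open>A\<close>, turns the damage into the acceptance weight of a product state divided by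
    \<open>lam\<close>.\<close>
  have Fclose: "nsq ?Z (\<lambda>z. v z - F v z) \<le> (\<Sum>a\<in>A. \<Sum>c\<in>C. \<Sum>x\<in>X. prb ?Z (g x) (\<lambda>(b,a'). v (b,a) * \<psi> c a')) / lam" for v
  proof -
    have "nsq ?Z (\<lambda>z. v z - F v z) = (\<Sum>a\<in>A. nsq B (\<lambda>b. v (b,a) - ap B R (\<lambda>b. v (b,a)) b))"
      unfolding nsq_pair F_def by simp
    also have "\<dots> \<le> (\<Sum>a\<in>A. \<Sum>j\<in>C \<times> X. prb B (s j) (\<lambda>b. v (b,a)))"
      by (intro sum_mono resolvent_shrink(3)[of B _ _ s "C \<times> X"] inv)
    also have "\<dots> = (\<Sum>a\<in>A. \<Sum>c\<in>C. \<Sum>x\<in>X. prb ?Z (g x) (\<lambda>(b,a'). v (b,a) * \<psi> c a')) / lam"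
      unfolding sum_Times ips_sq sum_divide_distrib ..
    finally show ?thesis .
  qed
  have Ftotal: "(\<Sum>l\<in>L. nsq ?Z (\<lambda>z. \<phi> l z - F (\<phi> l) z)) \<le> \<kappa> / lam"
  proof -
    let ?\<chi> = "\<lambda>(l,a,c) (b,a'). \<phi> l (b,a) * \<psi> c a'"
    let ?S = "L \<times> A \<times> C"
    have diag': "(\<Sum>j\<in>?S. ip ?Z (f y) (?\<chi> j) * cnj (ip ?Z (f y') (?\<chi> j))) = (if y = y' then complex_of_real (q y) else 0)"
      if "y \<in> Y" "y' \<in> Y" for y y'
      using diag[OF that] by (simp add: sum_Times)
    \<comment> \<open>The family \<open>?\<chi>\<close> stands for the product state, which is
      diagonal in \<open>f\<close> by \<open>diag\<close>. As \<open>g x\<close> is a combination of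
      the \<open>f y\<close>, its expectation is a weighted sum of the \<open>q y\<close>, hence at
      most \<open>Q\<close> times the weight.\<close>
    have gq: "(\<Sum>j\<in>?S. prb ?Z (g x) (?\<chi> j)) \<le> Q * (\<Sum>y\<in>Y. prb ?Z (f y) (e x))" for x
    proof -
      have ge: "ip ?Z (g x) v = (\<Sum>y\<in>Y. cnj (ip ?Z (f y) (e x)) * ip ?Z (f y) v)" for v
        unfolding ipg P_def ip_proj_on ..
      have "complex_of_real (\<Sum>j\<in>?S. prb ?Z (g x) (?\<chi> j)) = (\<Sum>j\<in>?S. ip ?Z (g x) (?\<chi> j) * cnj (ip ?Z (g x) (?\<chi> j)))"
        unfolding of_real_sum by (intro sum.cong refl) (rule complex_norm_square)
      also have "\<dots> = (\<Sum>j\<in>?S. \<Sum>y\<in>Y. \<Sum>y'\<in>Y. (cnj (ip ?Z (f y) (e x)) * ip ?Z (f y') (e x)) *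
           (ip ?Z (f y) (?\<chi> j) * cnj (ip ?Z (f y') (?\<chi> j))))"
        unfolding ge cnj_sum sum_product by (intro sum.cong refl) (simp add: mult_ac)
      also have "\<dots> = (\<Sum>y\<in>Y. \<Sum>j\<in>?S. \<Sum>y'\<in>Y. (cnj (ip ?Z (f y) (e x)) * ip ?Z (f y') (e x)) *
           (ip ?Z (f y) (?\<chi> j) * cnj (ip ?Z (f y') (?\<chi> j))))"
        by (rule sum.swap)
      also have "\<dots> = (\<Sum>y\<in>Y. \<Sum>y'\<in>Y. \<Sum>j\<in>?S. (cnj (ip ?Z (f y) (e x)) * ip ?Z (f y') (e x)) *
           (ip ?Z (f y) (?\<chi> j) * cnj (ip ?Z (f y') (?\<chi> j))))"
        by (rule sum.cong[OF refl], rule sum.swap)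
      also have "\<dots> = (\<Sum>y\<in>Y. \<Sum>y'\<in>Y. (cnj (ip ?Z (f y) (e x)) * ip ?Z (f y') (e x)) *
           (if y = y' then complex_of_real (q y) else 0))"
        unfolding sum_distrib_left[symmetric] by (intro sum.cong refl) (simp only: diag')
      also have "\<dots> = (\<Sum>y\<in>Y. complex_of_real (prb ?Z (f y) (e x) * q y))"
      proof (rule sum.cong[OF refl])
        fix y assume y: "y \<in> Y"
        have "(\<Sum>y'\<in>Y. (cnj (ip ?Z (f y) (e x)) * ip ?Z (f y') (e x)) * (if y = y' then complex_of_real (q y) else 0))
           = (cnj (ip ?Z (f y) (e x)) * ip ?Z (f y) (e x)) * complex_of_real (q y)"
          using fin(5) y by (simp add: if_distrib[of "\<lambda>a. _ * a"] cong: if_cong)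
        also have "\<dots> = complex_of_real (prb ?Z (f y) (e x) * q y)"
          by (simp only: of_real_mult complex_norm_square mult.commute)
        finally show "(\<Sum>y'\<in>Y. (cnj (ip ?Z (f y) (e x)) * ip ?Z (f y') (e x)) * (if y = y' then complex_of_real (q y) else 0))
           = complex_of_real (prb ?Z (f y) (e x) * q y)" .
      qed
      finally have "(\<Sum>j\<in>?S. prb ?Z (g x) (?\<chi> j)) = (\<Sum>y\<in>Y. prb ?Z (f y) (e x) * q y)"
        unfolding of_real_sum[symmetric] of_real_eq_iff .
      also have "\<dots> \<le> (\<Sum>y\<in>Y. prb ?Z (f y) (e x) * Q)"
        by (intro sum_mono mult_left_mono q) auto
      finally show ?thesis by (simp add: sum_distrib_left mult.commute)
    qed
    have "(\<Sum>l\<in>L. nsq ?Z (\<lambda>z. \<phi> l z - F (\<phi> l) z)) \<le>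
        (\<Sum>l\<in>L. (\<Sum>a\<in>A. \<Sum>c\<in>C. \<Sum>x\<in>X. prb ?Z (g x) (\<lambda>(b,a'). \<phi> l (b,a) * \<psi> c a')) / lam)"
      by (intro sum_mono Fclose)
    also have "\<dots> = (\<Sum>j\<in>?S. \<Sum>x\<in>X. prb ?Z (g x) (?\<chi> j)) / lam"
      by (simp add: sum_Times sum_divide_distrib)
    also have "(\<Sum>j\<in>?S. \<Sum>x\<in>X. prb ?Z (g x) (?\<chi> j)) = (\<Sum>x\<in>X. \<Sum>j\<in>?S. prb ?Z (g x) (?\<chi> j))"
      by (rule sum.swap)
    also have "\<dots> / lam \<le> (\<Sum>x\<in>X. Q) / lam"
    proof (intro divide_right_mono sum_mono)
      fix x assume x: "x \<in> X"
      have "(\<Sum>y\<in>Y. prb ?Z (f y) (e x)) \<le> nsq ?Z (e x)" by (rule bessel[OF fin(5) f])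
      also have "\<dots> = 1"
      proof -
        have "complex_of_real (nsq ?Z (e x)) = 1" using e x by (simp add: ip_self[symmetric] orthonormal_on_def)
        then show ?thesis by simp
      qed
      finally have "Q * (\<Sum>y\<in>Y. prb ?Z (f y) (e x)) \<le> Q * 1" using Q by (intro mult_left_mono) auto
      then show "(\<Sum>j\<in>?S. prb ?Z (g x) (?\<chi> j)) \<le> Q" using gq[of x] by linarith
    qed (use lam in auto)
    also have "\<dots> \<le> \<kappa> / lam" using Q lam by (intro divide_right_mono) auto
    finally show ?thesis .
  qed
  have Ptotal: "(\<Sum>l\<in>L. nsq ?Z (\<lambda>z. \<phi> l z - P (\<phi> l) z)) \<le> \<epsilon>"
  proof -
    have "(\<Sum>l\<in>L. nsq ?Z (\<lambda>z. \<phi> l z - P (\<phi> l) z)) = 1 - (\<Sum>l\<in>L. \<Sum>y\<in>Y. prb ?Z (f y) (\<phi> l))"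
      unfolding P_def nsq_minus_proj_on[OF fin(5) f] sum_subtractf unit ..
    also have "(\<Sum>l\<in>L. \<Sum>y\<in>Y. prb ?Z (f y) (\<phi> l)) = (\<Sum>y\<in>Y. \<Sum>l\<in>L. prb ?Z (f y) (\<phi> l))"
      by (rule sum.swap)
    finally show ?thesis using Y by linarith
  qed
  have one: "(\<Sum>x\<in>X. prb ?Z (e x) v) \<le> (1 + c) * (\<Sum>x\<in>X. prb ?Z (t x) v)
      + (1 + 1/c) * (2 * nsq ?Z (\<lambda>z. v z - P v z) + 2 * nsq ?Z (\<lambda>z. v z - F v z))" for v
  proof -
    have "(\<Sum>x\<in>X. (cmod (ip ?Z (e x) v - ip ?Z (t x) v))\<^sup>2) \<le> 2 * nsq ?Z (\<lambda>z. v z - P v z) + 2 * nsq ?Z (\<lambda>z. v z - F v z)"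
    proof -
      \<comment> \<open>The first summand is the error of projecting by \<open>P\<close>, the second
        that of damping; \<open>Ptotal\<close> and \<open>Ftotal\<close> control them on
        average.\<close>
      have spl: "ip ?Z (e x) v - ip ?Z (t x) v = ip ?Z (e x) (\<lambda>z. v z - P v z) + ip ?Z (g x) (\<lambda>z. v z - F v z)" for x
        unfolding ip_diff_right ipt ipg[of x v] by simp
      have "(\<Sum>x\<in>X. (cmod (ip ?Z (e x) v - ip ?Z (t x) v))\<^sup>2) \<le>
         (\<Sum>x\<in>X. 2 * prb ?Z (e x) (\<lambda>z. v z - P v z) + 2 * prb ?Z (g x) (\<lambda>z. v z - F v z))"
        unfolding spl by (intro sum_mono cmod_add_sq_le)
      also have "\<dots> = 2 * (\<Sum>x\<in>X. prb ?Z (e x) (\<lambda>z. v z - P v z)) + 2 * (\<Sum>x\<in>X. prb ?Z (g x) (\<lambda>z. v z - F v z))"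
        by (simp only: sum.distrib sum_distrib_left)
      also have "\<dots> \<le> 2 * nsq ?Z (\<lambda>z. v z - P v z) + 2 * nsq ?Z (\<lambda>z. v z - F v z)"
        using gcontr[of "\<lambda>z. v z - F v z"] bessel[OF fin(4) e, of "\<lambda>z. v z - P v z"] by linarith
      finally show ?thesis .
    qed
    then have "(1 + 1/c) * (\<Sum>x\<in>X. (cmod (ip ?Z (e x) v - ip ?Z (t x) v))\<^sup>2)
       \<le> (1 + 1/c) * (2 * nsq ?Z (\<lambda>z. v z - P v z) + 2 * nsq ?Z (\<lambda>z. v z - F v z))"
      using c by (intro mult_left_mono) auto
    moreover have "(\<Sum>x\<in>X. prb ?Z (e x) v) \<le> (\<Sum>x\<in>X. (1 + c) * prb ?Z (t x) v + (1 + 1/c) * (cmod (ip ?Z (e x) v - ip ?Z (t x) v))\<^sup>2)"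
      by (intro sum_mono cmod_sq_split c)
    moreover have "\<dots> = (1 + c) * (\<Sum>x\<in>X. prb ?Z (t x) v) + (1 + 1/c) * (\<Sum>x\<in>X. (cmod (ip ?Z (e x) v - ip ?Z (t x) v))\<^sup>2)"
      by (simp only: sum.distrib sum_distrib_left)
    ultimately show ?thesis by linarith
  qed
  have "1 - \<epsilon> \<le> (\<Sum>l\<in>L. \<Sum>x\<in>X. prb ?Z (e x) (\<phi> l))"
    using X by (subst sum.swap)
  also have "\<dots> \<le> (\<Sum>l\<in>L. (1 + c) * (\<Sum>x\<in>X. prb ?Z (t x) (\<phi> l))
      + (1 + 1/c) * (2 * nsq ?Z (\<lambda>z. \<phi> l z - P (\<phi> l) z) + 2 * nsq ?Z (\<lambda>z. \<phi> l z - F (\<phi> l) z)))"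
    by (intro sum_mono one)
  also have "\<dots> = (1 + c) * (\<Sum>l\<in>L. \<Sum>x\<in>X. prb ?Z (t x) (\<phi> l))
      + (1 + 1/c) * (2 * (\<Sum>l\<in>L. nsq ?Z (\<lambda>z. \<phi> l z - P (\<phi> l) z)) + 2 * (\<Sum>l\<in>L. nsq ?Z (\<lambda>z. \<phi> l z - F (\<phi> l) z)))"
    by (simp only: sum.distrib sum_distrib_left[symmetric])
  also have "\<dots> \<le> (1 + c) * (\<Sum>l\<in>L. \<Sum>x\<in>X. prb ?Z (t x) (\<phi> l)) + (1 + 1/c) * (2 * \<epsilon> + 2 * (\<kappa> / lam))"
    using Ptotal Ftotal c by (intro add_left_mono mult_left_mono) auto
  finally show ?thesis using tcontr tcoll by (intro exI[of _ t]) auto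
qed

section \<open>Product channels and typical sequences\<close>

lemma mult_add_less:
  fixes x y m k :: nat
  assumes "x < m" "y < k"
  shows "x * k + y < m * k"
proof -
  have "x * k + y < Suc x * k" using assms by simp
  also have "\<dots> \<le> m * k" using assms by (intro mult_le_mono1) auto
  finally show ?thesis .
qed

lemma sum_lessThan_mult:
  fixes f :: "nat \<Rightarrow> 'a :: comm_monoid_add"
  shows "(\<Sum>i<m * k. f i) = (\<Sum>x<m. \<Sum>y<k. f (x * k + y))"
proof (cases "k = 0")
  case False
  have "(\<Sum>p\<in>{..<m} \<times> {..<k}. f (fst p * k + snd p)) = (\<Sum>i<m * k. f i)"
  proof (rule sum.reindex_bij_witness[of _ "\<lambda>i. (i div k, i mod k)" "\<lambda>p. fst p * k + snd p"])
    fix p assume p: "p \<in> {..<m} \<times> {..<k}"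
    then show "fst p * k + snd p \<in> {..<m * k}" by (auto simp: mult_add_less)
    show "((fst p * k + snd p) div k, (fst p * k + snd p) mod k) = p"
      using p by (cases p) auto
  qed (use False in \<open>auto simp: less_mult_imp_div_less\<close>)
  then show ?thesis by (simp add: sum_Times)
qed simp

lemma sum_list_lessThan: "(\<Sum>x\<leftarrow>xs. f x) = (\<Sum>l<length xs. f (xs ! l))"
  by (simp add: sum_list_sum_nth atLeast0LessThan)

text \<open>Digit \<open>t\<close> counts from the least significant place. Since
  \<open>kron\<close> makes its first factor the more significant one, the factor added by
  \<open>channel_pow (Suc n)\<close> owns digit \<open>n\<close>.\<close>

definition dig :: "nat \<Rightarrow> nat \<Rightarrow> nat \<Rightarrow> nat" where
  "dig d c t = c div d ^ t mod d"

lemma dig_top: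
  assumes "c < d" "y < d ^ n"
  shows "dig d (c * d ^ n + y) n = c"
proof -
  have "(c * d ^ n + y) div d ^ n = c" using assms by simp
  then show ?thesis using assms by (simp add: dig_def)
qed

lemma dig_low:
  assumes "t < n" "d > 0"
  shows "dig d (c * d ^ n + y) t = dig d y t"
proof -
  obtain k where n: "n = t + Suc k" using assms(1) less_imp_Suc_add by (metis add_Suc_right)
  have e: "c * d ^ n + y = y + (c * d ^ k * d) * d ^ t" unfolding n by (simp add: power_add mult_ac)
  have "(c * d ^ n + y) div d ^ t = (c * d ^ k) * d + y div d ^ t"
    unfolding e by (rule div_mult_self1) (use assms(2) in simp)
  then show ?thesis by (simp add: dig_def)
qed

lemma div_pow_less:
  fixes c d :: nat
  assumes "c < d ^ Suc n"
  shows "c div d ^ n < d" "c mod d ^ n < d ^ n" "c = (c div d ^ n) * d ^ n + c mod d ^ n"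
proof -
  have "d > 0" using assms by (cases d) auto
  then show "c mod d ^ n < d ^ n" by simp
  show "c div d ^ n < d" using assms by (simp add: less_mult_imp_div_less)
qed (simp add: mult.commute)

lemma dig_Suc_split:
  assumes "c < d ^ Suc n"
  shows "dig d c n = c div d ^ n" "t < n \<Longrightarrow> dig d (c mod d ^ n) t = dig d c t"
proof -
  have d: "d > 0" using assms by (cases d) auto
  show "dig d c n = c div d ^ n"
    using dig_top[OF div_pow_less(1,2)[OF assms]] div_pow_less(3)[OF assms] by simp
  show "dig d (c mod d ^ n) t = dig d c t" if "t < n"
    using dig_low[OF that d, of "c div d ^ n" "c mod d ^ n"] div_pow_less(3)[OF assms] by simp
qed

text \<open>The distributive law, the numbers below \<open>d ^ n\<close> being the
  \<open>n\<close>-tuples of digits. Sums over tensor powers factorise through it.\<close>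

lemma sum_prod_dig:
  fixes G :: "nat \<Rightarrow> nat \<Rightarrow> 'a :: comm_semiring_1"
  assumes "d > 0"
  shows "(\<Sum>c<d ^ n. \<Prod>t<n. G t (dig d c t)) = (\<Prod>t<n. \<Sum>c<d. G t c)"
proof (induction n)
  case (Suc n)
  have "(\<Sum>c<d ^ Suc n. \<Prod>t<Suc n. G t (dig d c t))
     = (\<Sum>c<d. \<Sum>y<d ^ n. \<Prod>t<Suc n. G t (dig d (c * d ^ n + y) t))"
    unfolding power_Suc by (rule sum_lessThan_mult)
  also have "\<dots> = (\<Sum>c<d. \<Sum>y<d ^ n. (\<Prod>t<n. G t (dig d y t)) * G n c)"
    using assms by (intro sum.cong refl) (simp add: dig_top dig_low)
  also have "\<dots> = (\<Prod>t<n. \<Sum>c<d. G t c) * (\<Sum>c<d. G n c)"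
    unfolding Suc.IH[symmetric] sum_product by (rule sum.swap)
  finally show ?case by simp
qed simp

text \<open>A product vector on \<open>n\<close> copies of the pair of systems, regrouped so that
  all \<open>B\<close> digits form one index and all \<open>A\<close> digits the other. This is the
  layout in which a power of the channel acts on a power of the input.\<close>

definition pw :: "nat \<Rightarrow> nat \<Rightarrow> nat \<Rightarrow> (nat \<Rightarrow> nat \<times> nat \<Rightarrow> complex) \<Rightarrow> nat \<times> nat \<Rightarrow> complex" where
  "pw dB dA n g z = (\<Prod>t<n. g t (dig dB (fst z) t, dig dA (snd z) t))"

lemma ip_pw:
  assumes "dA > 0" "dB > 0"
  shows "ip ({..<dB ^ n} \<times> {..<dA ^ n}) (pw dB dA n g) (pw dB dA n h)
     = (\<Prod>t<n. ip ({..<dB} \<times> {..<dA}) (g t) (h t))"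
proof -
  have "ip ({..<dB ^ n} \<times> {..<dA ^ n}) (pw dB dA n g) (pw dB dA n h)
     = (\<Sum>b<dB ^ n. \<Sum>a<dA ^ n. \<Prod>t<n. cnj (g t (dig dB b t, dig dA a t)) * h t (dig dB b t, dig dA a t))"
    by (simp add: ip_def sum_Times pw_def prod.distrib)
  also have "\<dots> = (\<Sum>b<dB ^ n. \<Prod>t<n. \<Sum>a<dA. cnj (g t (dig dB b t, a)) * h t (dig dB b t, a))"
    by (intro sum.cong refl sum_prod_dig assms(1))
  also have "\<dots> = (\<Prod>t<n. \<Sum>b<dB. \<Sum>a<dA. cnj (g t (b, a)) * h t (b, a))"
    by (rule sum_prod_dig[OF assms(2)])
  finally show ?thesis by (simp add: ip_def sum_Times)
qed

section \<open>Kraus lists entry by entry, and their tensor powers\<close>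

lemma foldr_mat_carrier:
  assumes "\<And>K. K \<in> set Ks \<Longrightarrow> f K \<in> carrier_mat a b"
  shows "foldr (\<lambda>K acc. f K + acc) Ks (0\<^sub>m a b) \<in> carrier_mat a b"
  using assms by (induction Ks) auto

lemma foldr_mat_entry:
  assumes "\<And>K. K \<in> set Ks \<Longrightarrow> f K \<in> carrier_mat a b" "i < a" "j < b"
  shows "foldr (\<lambda>K acc. f K + acc) Ks (0\<^sub>m a b) $$ (i,j) = (\<Sum>K\<leftarrow>Ks. f K $$ (i,j))"
  using assms(1)
proof (induction Ks)
  case (Cons K Ks)
  have "foldr (\<lambda>K acc. f K + acc) Ks (0\<^sub>m a b) \<in> carrier_mat a b"
    using Cons.prems by (intro foldr_mat_carrier) auto
  then show ?case using Cons assms(2,3) by auto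
qed (use assms in auto)

definition tp_entries :: "nat \<Rightarrow> nat \<Rightarrow> cmat list \<Rightarrow> bool" where
  "tp_entries a b Ks \<longleftrightarrow> (\<forall>x<a. \<forall>x'<a. (\<Sum>K\<leftarrow>Ks. \<Sum>y<b. cnj (K $$ (y,x)) * K $$ (y,x')) = (if x = x' then 1 else 0))"

lemma dag_mult_self_entry:
  assumes "K \<in> carrier_mat b a" "x < a" "x' < a"
  shows "(dag K * K) $$ (x,x') = (\<Sum>y<b. cnj (K $$ (y,x)) * K $$ (y,x'))"
  using assms by (auto simp: scalar_prod_def dag_def atLeast0LessThan intro!: sum.cong)

lemma is_channel_iff:
  "is_channel a b Ks \<longleftrightarrow> (\<forall>K\<in>set Ks. K \<in> carrier_mat b a) \<and> tp_entries a b Ks"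
proof (cases "\<forall>K\<in>set Ks. K \<in> carrier_mat b a")
  case True
  have c: "dag K * K \<in> carrier_mat a a" if "K \<in> set Ks" for K
    using True that by (intro mult_carrier_mat[of _ a b]) (auto simp: dag_def)
  let ?S = "foldr (\<lambda>K acc. dag K * K + acc) Ks (0\<^sub>m a a)"
  have S: "?S $$ (x,x') = (\<Sum>K\<leftarrow>Ks. \<Sum>y<b. cnj (K $$ (y,x)) * K $$ (y,x'))" if "x < a" "x' < a" for x x'
  proof -
    have "?S $$ (x,x') = (\<Sum>K\<leftarrow>Ks. (dag K * K) $$ (x,x'))"
      using that c by (intro foldr_mat_entry) auto
    also have "\<dots> = (\<Sum>K\<leftarrow>Ks. \<Sum>y<b. cnj (K $$ (y,x)) * K $$ (y,x'))"
      using True that by (intro arg_cong[of _ _ sum_list] map_cong refl dag_mult_self_entry) auto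
    finally show ?thesis .
  qed
  have Sc: "?S \<in> carrier_mat a a" by (rule foldr_mat_carrier) (rule c)
  have "?S = 1\<^sub>m a \<longleftrightarrow> (\<forall>x<a. \<forall>x'<a. ?S $$ (x,x') = (if x = x' then 1 else 0))"
  proof
    assume "\<forall>x<a. \<forall>x'<a. ?S $$ (x,x') = (if x = x' then 1 else 0)"
    then show "?S = 1\<^sub>m a" using Sc by (intro eq_matI) auto
  qed auto
  then show ?thesis using True S unfolding is_channel_def tp_entries_def by auto
qed (auto simp: is_channel_def)

lemma kron_carrier: "A \<in> carrier_mat a b \<Longrightarrow> B \<in> carrier_mat c d \<Longrightarrow> kron A B \<in> carrier_mat (a * c) (b * d)"
  by (auto simp: kron_def)

lemma kron_entry:
  assumes "A \<in> carrier_mat a b" "B \<in> carrier_mat c d" "i < a" "k < c" "j < b" "l < d"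
  shows "kron A B $$ (i * c + k, j * d + l) = A $$ (i,j) * B $$ (k,l)"
proof -
  have "i * c + k < a * c" "j * d + l < b * d"
    using assms by (simp_all add: mult_add_less)
  then show ?thesis using assms by (simp add: kron_def)
qed

lemma channel_pow_carrier:
  assumes "\<forall>K\<in>set Ks. K \<in> carrier_mat dB dA"
  shows "\<forall>L\<in>set (channel_pow n Ks). L \<in> carrier_mat (dB ^ n) (dA ^ n)"
  using assms by (induction n) (auto intro!: kron_carrier)

lemma sum_list_map_concat:
  fixes f :: "'b \<Rightarrow> 'a :: comm_monoid_add"
  shows "(\<Sum>x\<leftarrow>concat xss. f x) = (\<Sum>xs\<leftarrow>xss. \<Sum>x\<leftarrow>xs. f x)"
  by (induction xss) auto

lemma sum_list_channel_pow_Suc: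
  fixes f :: "cmat \<Rightarrow> 'a :: comm_monoid_add"
  shows "(\<Sum>M\<leftarrow>channel_pow (Suc n) Ks. f M) = (\<Sum>K\<leftarrow>Ks. \<Sum>L\<leftarrow>channel_pow n Ks. f (kron K L))"
  by (simp add: sum_list_map_concat o_def)

lemma sum_list_product:
  fixes f g :: "_ \<Rightarrow> complex"
  shows "(\<Sum>x\<leftarrow>xs. \<Sum>y\<leftarrow>ys. f x * g y) = (\<Sum>x\<leftarrow>xs. f x) * (\<Sum>y\<leftarrow>ys. g y)"
  by (simp add: sum_list_const_mult sum_list_mult_const)

lemma tp_entries_channel_pow:
  assumes K: "\<forall>K\<in>set Ks. K \<in> carrier_mat dB dA" and tp: "tp_entries dA dB Ks"
  shows "tp_entries (dA ^ n) (dB ^ n) (channel_pow n Ks)"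
proof (induction n)
  case 0
  show ?case by (simp add: tp_entries_def)
next
  case (Suc n)
  show ?case unfolding tp_entries_def
  proof (intro allI impI)
    fix x x' assume x: "x < dA ^ Suc n" and x': "x' < dA ^ Suc n"
    note dx = div_pow_less[OF x] and dx' = div_pow_less[OF x']
    let ?h = "x div dA ^ n" and ?l = "x mod dA ^ n" and ?h' = "x' div dA ^ n" and ?l' = "x' mod dA ^ n"
    have "(\<Sum>y<dB ^ Suc n. cnj (kron K L $$ (y,x)) * kron K L $$ (y,x'))
       = (\<Sum>y<dB. cnj (K $$ (y,?h)) * K $$ (y,?h')) * (\<Sum>y<dB ^ n. cnj (L $$ (y,?l)) * L $$ (y,?l'))"
      if "K \<in> set Ks" "L \<in> set (channel_pow n Ks)" for K L
    proof -
      have Kc: "K \<in> carrier_mat dB dA" and Lc: "L \<in> carrier_mat (dB ^ n) (dA ^ n)"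
        using that K channel_pow_carrier[OF K] by auto
      have "(\<Sum>y<dB ^ Suc n. cnj (kron K L $$ (y,x)) * kron K L $$ (y,x'))
        = (\<Sum>y<dB. \<Sum>z<dB ^ n. cnj (kron K L $$ (y * dB ^ n + z, ?h * dA ^ n + ?l)) * kron K L $$ (y * dB ^ n + z, ?h' * dA ^ n + ?l'))"
        unfolding power_Suc sum_lessThan_mult dx(3)[symmetric] dx'(3)[symmetric] ..
      also have "\<dots> = (\<Sum>y<dB. \<Sum>z<dB ^ n. (cnj (K $$ (y,?h)) * K $$ (y,?h')) * (cnj (L $$ (z,?l)) * L $$ (z,?l')))"
      proof (intro sum.cong refl)
        fix y z assume "y \<in> {..<dB}" "z \<in> {..<dB ^ n}"
        then have yz: "y < dB" "z < dB ^ n" by auto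
        show "cnj (kron K L $$ (y * dB ^ n + z, ?h * dA ^ n + ?l)) * kron K L $$ (y * dB ^ n + z, ?h' * dA ^ n + ?l')
          = (cnj (K $$ (y,?h)) * K $$ (y,?h')) * (cnj (L $$ (z,?l)) * L $$ (z,?l'))"
          unfolding kron_entry[OF Kc Lc yz dx(1,2)] kron_entry[OF Kc Lc yz dx'(1,2)] by (simp add: mult_ac)
      qed
      finally show ?thesis by (simp add: sum_product)
    qed
    then have "(\<Sum>M\<leftarrow>channel_pow (Suc n) Ks. \<Sum>y<dB ^ Suc n. cnj (M $$ (y,x)) * M $$ (y,x'))
       = (\<Sum>K\<leftarrow>Ks. \<Sum>L\<leftarrow>channel_pow n Ks. (\<Sum>y<dB. cnj (K $$ (y,?h)) * K $$ (y,?h')) * (\<Sum>y<dB ^ n. cnj (L $$ (y,?l)) * L $$ (y,?l')))"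
      unfolding sum_list_channel_pow_Suc by (intro arg_cong[of _ _ sum_list] map_cong refl) auto
    also have "\<dots> = (if ?h = ?h' then 1 else 0) * (if ?l = ?l' then 1 else 0)"
      unfolding sum_list_product using tp Suc.IH dx(1,2) dx'(1,2) by (simp add: tp_entries_def)
    also have "\<dots> = (if x = x' then 1 else 0)"
    proof -
      have "x = x' \<longleftrightarrow> ?h = ?h' \<and> ?l = ?l'" by (metis div_mult_mod_eq)
      then show ?thesis by simp
    qed
    finally show "(\<Sum>M\<leftarrow>channel_pow (Suc n) Ks. \<Sum>y<dB ^ Suc n. cnj (M $$ (y,x)) * M $$ (y,x')) = (if x = x' then 1 else 0)" .
  qed
qed

text \<open>The bipartite vector \<open>\<psi>\<close> after \<open>K\<close> has acted on its first
  half; the projectors summed over the Kraus list give the output state.\<close>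

definition chan_out :: "nat \<Rightarrow> (nat \<Rightarrow> nat \<Rightarrow> complex) \<Rightarrow> cmat \<Rightarrow> nat \<times> nat \<Rightarrow> complex" where
  "chan_out a \<psi> K = (\<lambda>(y,x'). \<Sum>x<a. K $$ (y,x) * \<psi> x x')"

definition psi_pow :: "nat \<Rightarrow> nat \<Rightarrow> (nat \<Rightarrow> nat \<Rightarrow> complex) \<Rightarrow> nat \<Rightarrow> nat \<Rightarrow> complex" where
  "psi_pow d n \<psi> x y = (\<Prod>t<n. \<psi> (dig d x t) (dig d y t))"

lemma psi_pow_Suc:
  assumes "h < d" "l < d ^ n" "y < d ^ Suc n"
  shows "psi_pow d (Suc n) \<psi> (h * d ^ n + l) y = \<psi> h (y div d ^ n) * psi_pow d n \<psi> l (y mod d ^ n)"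
  using assms by (simp add: psi_pow_def dig_top dig_low dig_Suc_split mult.commute del: power_Suc)

lemma psi_pow_unit:
  assumes "d > 0" "(\<Sum>x<d. \<Sum>y<d. (cmod (\<psi> x y))\<^sup>2) = 1"
  shows "(\<Sum>x<d ^ n. \<Sum>y<d ^ n. (cmod (psi_pow d n \<psi> x y))\<^sup>2) = 1"
proof -
  have "(\<Sum>x<d ^ n. \<Sum>y<d ^ n. (cmod (psi_pow d n \<psi> x y))\<^sup>2) = (\<Sum>x<d ^ n. \<Prod>t<n. \<Sum>y<d. (cmod (\<psi> (dig d x t) y))\<^sup>2)"
    unfolding psi_pow_def prod_norm[symmetric] prod_power_distrib
    by (intro sum.cong refl sum_prod_dig assms(1))
  also have "\<dots> = (\<Prod>t<n. \<Sum>x<d. \<Sum>y<d. (cmod (\<psi> x y))\<^sup>2)"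
    by (rule sum_prod_dig[OF assms(1)])
  finally show ?thesis using assms by simp
qed

lemma chan_out_kron:
  assumes K: "K \<in> carrier_mat dB dA" and L: "L \<in> carrier_mat (dB ^ n) (dA ^ n)"
    and b: "b < dB ^ Suc n" and a: "a < dA ^ Suc n"
  shows "chan_out (dA ^ Suc n) (psi_pow dA (Suc n) \<psi>) (kron K L) (b,a)
     = chan_out dA \<psi> K (b div dB ^ n, a div dA ^ n) * chan_out (dA ^ n) (psi_pow dA n \<psi>) L (b mod dB ^ n, a mod dA ^ n)"
proof -
  note db = div_pow_less[OF b]
  have "chan_out (dA ^ Suc n) (psi_pow dA (Suc n) \<psi>) (kron K L) (b,a)
     = (\<Sum>h<dA. \<Sum>l<dA ^ n. kron K L $$ ((b div dB ^ n) * dB ^ n + b mod dB ^ n, h * dA ^ n + l) * psi_pow dA (Suc n) \<psi> (h * dA ^ n + l) a)"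
    unfolding chan_out_def split_conv power_Suc sum_lessThan_mult db(3)[symmetric] ..
  also have "\<dots> = (\<Sum>h<dA. \<Sum>l<dA ^ n. (K $$ (b div dB ^ n, h) * \<psi> h (a div dA ^ n)) * (L $$ (b mod dB ^ n, l) * psi_pow dA n \<psi> l (a mod dA ^ n)))"
  proof (intro sum.cong refl)
    fix h l assume "h \<in> {..<dA}" "l \<in> {..<dA ^ n}"
    then have hl: "h < dA" "l < dA ^ n" by auto
    show "kron K L $$ ((b div dB ^ n) * dB ^ n + b mod dB ^ n, h * dA ^ n + l) * psi_pow dA (Suc n) \<psi> (h * dA ^ n + l) a
      = (K $$ (b div dB ^ n, h) * \<psi> h (a div dA ^ n)) * (L $$ (b mod dB ^ n, l) * psi_pow dA n \<psi> l (a mod dA ^ n))"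
      unfolding kron_entry[OF K L db(1,2) hl] psi_pow_Suc[OF hl a] by (simp add: mult_ac)
  qed
  finally show ?thesis by (simp add: chan_out_def sum_product)
qed

text \<open>These sums are the entries of the \<open>n\<close>-copy output state. They factorise
  over the digits by induction along the nested definition of \<open>channel_pow\<close>.\<close>

lemma chan_out_pow_gram:
  assumes K: "\<forall>K\<in>set Ks. K \<in> carrier_mat dB dA"
    and "b < dB ^ n" "a < dA ^ n" "b' < dB ^ n" "a' < dA ^ n"
  shows "(\<Sum>L\<leftarrow>channel_pow n Ks. chan_out (dA ^ n) (psi_pow dA n \<psi>) L (b,a) * cnj (chan_out (dA ^ n) (psi_pow dA n \<psi>) L (b',a')))
     = (\<Prod>t<n. \<Sum>K\<leftarrow>Ks. chan_out dA \<psi> K (dig dB b t, dig dA a t) * cnj (chan_out dA \<psi> K (dig dB b' t, dig dA a' t)))"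
  using assms(2-)
proof (induction n arbitrary: b a b' a')
  case 0
  then show ?case by (simp add: chan_out_def psi_pow_def)
next
  case (Suc n)
  let ?g = "\<lambda>K z z'. chan_out dA \<psi> K z * cnj (chan_out dA \<psi> K z')"
  let ?G = "\<lambda>n L z z'. chan_out (dA ^ n) (psi_pow dA n \<psi>) L z * cnj (chan_out (dA ^ n) (psi_pow dA n \<psi>) L z')"
  note d = div_pow_less[OF Suc.prems(1)] div_pow_less[OF Suc.prems(2)] div_pow_less[OF Suc.prems(3)] div_pow_less[OF Suc.prems(4)]
  note s = dig_Suc_split[OF Suc.prems(1)] dig_Suc_split[OF Suc.prems(2)] dig_Suc_split[OF Suc.prems(3)] dig_Suc_split[OF Suc.prems(4)]
  have "?G (Suc n) (kron K L) (b,a) (b',a')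
      = ?g K (b div dB ^ n, a div dA ^ n) (b' div dB ^ n, a' div dA ^ n) *
        ?G n L (b mod dB ^ n, a mod dA ^ n) (b' mod dB ^ n, a' mod dA ^ n)"
    if "K \<in> set Ks" "L \<in> set (channel_pow n Ks)" for K L
  proof -
    have Kc: "K \<in> carrier_mat dB dA" and Lc: "L \<in> carrier_mat (dB ^ n) (dA ^ n)"
      using that K channel_pow_carrier[OF K] by auto
    show ?thesis
      unfolding chan_out_kron[OF Kc Lc Suc.prems(1,2)] chan_out_kron[OF Kc Lc Suc.prems(3,4)] by (simp add: mult_ac)
  qed
  then have "(\<Sum>M\<leftarrow>channel_pow (Suc n) Ks. ?G (Suc n) M (b,a) (b',a'))
     = (\<Sum>K\<leftarrow>Ks. \<Sum>L\<leftarrow>channel_pow n Ks. ?g K (b div dB ^ n, a div dA ^ n) (b' div dB ^ n, a' div dA ^ n) *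
        ?G n L (b mod dB ^ n, a mod dA ^ n) (b' mod dB ^ n, a' mod dA ^ n))"
    unfolding sum_list_channel_pow_Suc by (intro arg_cong[of _ _ sum_list] map_cong refl) auto
  also have "\<dots> = (\<Sum>K\<leftarrow>Ks. ?g K (b div dB ^ n, a div dA ^ n) (b' div dB ^ n, a' div dA ^ n)) *
      (\<Prod>t<n. \<Sum>K\<leftarrow>Ks. ?g K (dig dB (b mod dB ^ n) t, dig dA (a mod dA ^ n) t) (dig dB (b' mod dB ^ n) t, dig dA (a' mod dA ^ n) t))"
    unfolding sum_list_product Suc.IH[OF d(2) d(5) d(8) d(11)] ..
  also have "\<dots> = (\<Prod>t<Suc n. \<Sum>K\<leftarrow>Ks. ?g K (dig dB b t, dig dA a t) (dig dB b' t, dig dA a' t))"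
    using s by (simp add: mult.commute)
  finally show ?case .
qed

section \<open>Weak law of large numbers for product distributions\<close>

lemma second_moment_iid:
  fixes p g :: "nat \<Rightarrow> real"
  assumes p: "(\<Sum>x<D. p x) = 1" and g: "(\<Sum>x<D. p x * g x) = 0"
  shows "(\<Sum>x\<in>PiE {..<n} (\<lambda>_. {..<D}). \<Prod>t<n. p (x t)) = 1"
    and "(\<Sum>x\<in>PiE {..<n} (\<lambda>_. {..<D}). (\<Prod>t<n. p (x t)) * (\<Sum>t<n. g (x t))) = 0"
    and "(\<Sum>x\<in>PiE {..<n} (\<lambda>_. {..<D}). (\<Prod>t<n. p (x t)) * (\<Sum>t<n. g (x t))\<^sup>2) = real n * (\<Sum>x<D. p x * (g x)\<^sup>2)"
proof -
  let ?P = "\<lambda>n. PiE {..<n} (\<lambda>_. {..<D})"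
  \<comment> \<open>Peeling off the last coordinate; \<open>F\<close> is left abstract so that one
    split serves all three claims. They are proved jointly because the step for the second moment
    also uses total mass 1.\<close>
  have PSuc: "(\<Sum>x\<in>?P (Suc k). F (\<Prod>t<Suc k. p (x t)) (\<Sum>t<Suc k. g (x t)))
     = (\<Sum>r\<in>?P k. \<Sum>c<D. F ((\<Prod>t<k. p (r t)) * p c) ((\<Sum>t<k. g (r t)) + g c))" for k and F :: "real \<Rightarrow> real \<Rightarrow> real"
  proof -
    have I: "{..<Suc k} - {k} = {..<k}" by auto
    show ?thesis
      unfolding sum_PiE_split[of k "{..<Suc k}", OF lessThan_iff[THEN iffD2, OF lessI]] I by simp
  qed
  have *: "(\<Sum>x\<in>?P n. \<Prod>t<n. p (x t)) = 1 \<and>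
     (\<Sum>x\<in>?P n. (\<Prod>t<n. p (x t)) * (\<Sum>t<n. g (x t))) = 0 \<and>
     (\<Sum>x\<in>?P n. (\<Prod>t<n. p (x t)) * (\<Sum>t<n. g (x t))\<^sup>2) = real n * (\<Sum>x<D. p x * (g x)\<^sup>2)"
  proof (induction n)
    case 0
    then show ?case by simp
  next
    case (Suc n)
    have a: "(\<Sum>c<D. A * p c) = A" for A using p by (simp add: sum_distrib_left[symmetric])
    have b: "(\<Sum>c<D. (A * p c) * (S + g c)) = A * S" for A S
    proof -
      have "(\<Sum>c<D. (A * p c) * (S + g c)) = A * S * (\<Sum>c<D. p c) + A * (\<Sum>c<D. p c * g c)"
        by (simp add: sum_distrib_left sum.distrib algebra_simps)
      then show ?thesis using p g by simp
    qed
    have c: "(\<Sum>c<D. (A * p c) * (S + g c)\<^sup>2) = A * S\<^sup>2 + A * (\<Sum>x<D. p x * (g x)\<^sup>2)" for A S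
    proof -
      have "(\<Sum>c<D. (A * p c) * (S + g c)\<^sup>2) = A * S\<^sup>2 * (\<Sum>c<D. p c) + 2 * A * S * (\<Sum>c<D. p c * g c) + A * (\<Sum>x<D. p x * (g x)\<^sup>2)"
      proof -
        have "(A * p c) * (S + g c)\<^sup>2 = A * S\<^sup>2 * p c + 2 * A * S * (p c * g c) + A * (p c * (g c)\<^sup>2)" for c
          by (simp add: power2_eq_square algebra_simps)
        then show ?thesis by (simp only: sum.distrib sum_distrib_left)
      qed
      then show ?thesis using p g by simp
    qed
    show ?case
      using Suc.IH PSuc[of "\<lambda>a b. a" n] PSuc[of "\<lambda>a b. a * b" n] PSuc[of "\<lambda>a b. a * b\<^sup>2" n]
      by (simp only: a b c sum.distrib sum_distrib_right[symmetric]) (simp add: algebra_simps)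
  qed
  then show "(\<Sum>x\<in>?P n. \<Prod>t<n. p (x t)) = 1"
    "(\<Sum>x\<in>?P n. (\<Prod>t<n. p (x t)) * (\<Sum>t<n. g (x t))) = 0"
    "(\<Sum>x\<in>?P n. (\<Prod>t<n. p (x t)) * (\<Sum>t<n. g (x t))\<^sup>2) = real n * (\<Sum>x<D. p x * (g x)\<^sup>2)" by auto
qed

text \<open>The escape clause for probability zero lets \<open>T\<close> be defined by a lower bound
  on probabilities: for sequences with a vanishing factor the convention \<open>log 2 0 = 0\<close>
  says nothing about the product.\<close>

lemma chebyshev_iid:
  fixes p f :: "nat \<Rightarrow> real"
  assumes p0: "\<And>x. x < D \<Longrightarrow> 0 \<le> p x" and p: "(\<Sum>x<D. p x) = 1"
    and m: "m = (\<Sum>x<D. p x * f x)" and \<delta>: "\<delta> > 0" and n: "n > 0"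
    and T: "T \<subseteq> PiE {..<n} (\<lambda>_. {..<D})"
    and typical: "\<And>x. x \<in> PiE {..<n} (\<lambda>_. {..<D}) \<Longrightarrow> \<bar>(\<Sum>t<n. f (x t)) - real n * m\<bar> < real n * \<delta> \<Longrightarrow>
      x \<in> T \<or> (\<Prod>t<n. p (x t)) = 0"
  shows "1 - (\<Sum>x<D. p x * (f x - m)\<^sup>2) / (real n * \<delta>\<^sup>2) \<le> (\<Sum>x\<in>T. \<Prod>t<n. p (x t))"
proof -
  let ?P = "PiE {..<n} (\<lambda>_. {..<D})"
  define g where "g x = f x - m" for x
  have fin: "finite ?P" by (intro finite_PiE) auto
  have "(\<Sum>x<D. p x * g x) = (\<Sum>x<D. p x * f x) - (\<Sum>x<D. p x) * m"
    unfolding g_def sum_distrib_right sum_subtractf[symmetric] by (simp add: algebra_simps)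
  then have g: "(\<Sum>x<D. p x * g x) = 0" using p m by simp
  note sm = second_moment_iid[OF p g, of n]
  have pos: "0 \<le> (\<Prod>t<n. p (x t))" if "x \<in> ?P" for x
    using that by (intro prod_nonneg) (auto intro!: p0 simp: PiE_def Pi_def)
  have sumg: "(\<Sum>t<n. g (x t)) = (\<Sum>t<n. f (x t)) - real n * m" for x
    by (simp add: g_def sum_subtractf)
  have "(real n * \<delta>)\<^sup>2 * (\<Sum>x\<in>?P - T. \<Prod>t<n. p (x t)) \<le> (\<Sum>x\<in>?P - T. (\<Prod>t<n. p (x t)) * (\<Sum>t<n. g (x t))\<^sup>2)"
    unfolding sum_distrib_left
  proof (intro sum_mono)
    fix x assume x: "x \<in> ?P - T"
    show "(real n * \<delta>)\<^sup>2 * (\<Prod>t<n. p (x t)) \<le> (\<Prod>t<n. p (x t)) * (\<Sum>t<n. g (x t))\<^sup>2"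
    proof (cases "(\<Prod>t<n. p (x t)) = 0")
      case False
      then have "real n * \<delta> \<le> \<bar>\<Sum>t<n. g (x t)\<bar>" unfolding sumg using typical[of x] x by force
      then have "(real n * \<delta>)\<^sup>2 \<le> (\<Sum>t<n. g (x t))\<^sup>2" using \<delta> by (intro abs_le_square_iff[THEN iffD1]) auto
      then show ?thesis using pos[of x] x by (simp add: mult.commute mult_left_mono)
    next
      case True
      show ?thesis unfolding True by simp
    qed
  qed
  also have "\<dots> \<le> (\<Sum>x\<in>?P. (\<Prod>t<n. p (x t)) * (\<Sum>t<n. g (x t))\<^sup>2)"
    using fin pos by (intro sum_mono2) auto
  also have "\<dots> = real n * (\<Sum>x<D. p x * (g x)\<^sup>2)" by (rule sm(3))
  finally have "(\<Sum>x\<in>?P - T. \<Prod>t<n. p (x t)) \<le> (real n * (\<Sum>x<D. p x * (g x)\<^sup>2)) / (real n * \<delta>)\<^sup>2"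
    using n \<delta> by (simp add: pos_le_divide_eq mult.commute)
  also have "\<dots> = (\<Sum>x<D. p x * (f x - m)\<^sup>2) / (real n * \<delta>\<^sup>2)"
    using n by (simp add: g_def power2_eq_square)
  finally have "(\<Sum>x\<in>?P - T. \<Prod>t<n. p (x t)) \<le> (\<Sum>x<D. p x * (f x - m)\<^sup>2) / (real n * \<delta>\<^sup>2)" .
  moreover have "(\<Sum>x\<in>?P. \<Prod>t<n. p (x t)) = (\<Sum>x\<in>?P - T. \<Prod>t<n. p (x t)) + (\<Sum>x\<in>T. \<Prod>t<n. p (x t))"
    by (rule sum.subset_diff[OF T fin])
  ultimately show ?thesis using sm(1) by linarith
qed

section \<open>Asymptotic tests\<close>

text \<open>The left side depends on the family only through its kernel, i.e. the entries of the
  operator it stands for. This is how the Kraus list of a power is exchanged for a product over the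
  copies.\<close>

lemma gram_kernel:
  "(\<Sum>j\<in>S. ip Z g (\<xi> j) * cnj (ip Z g' (\<xi> j)))
     = (\<Sum>z\<in>Z. \<Sum>z'\<in>Z. cnj (g z) * g' z' * (\<Sum>j\<in>S. \<xi> j z * cnj (\<xi> j z')))"
proof -
  have "(\<Sum>j\<in>S. ip Z g (\<xi> j) * cnj (ip Z g' (\<xi> j)))
     = (\<Sum>j\<in>S. \<Sum>z\<in>Z. \<Sum>z'\<in>Z. cnj (g z) * g' z' * (\<xi> j z * cnj (\<xi> j z')))"
    unfolding ip_def cnj_sum sum_product by (intro sum.cong refl) (simp add: mult_ac)
  also have "\<dots> = (\<Sum>z\<in>Z. \<Sum>j\<in>S. \<Sum>z'\<in>Z. cnj (g z) * g' z' * (\<xi> j z * cnj (\<xi> j z')))"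
    by (rule sum.swap)
  also have "\<dots> = (\<Sum>z\<in>Z. \<Sum>z'\<in>Z. \<Sum>j\<in>S. cnj (g z) * g' z' * (\<xi> j z * cnj (\<xi> j z')))"
    by (rule sum.cong[OF refl], rule sum.swap)
  finally show ?thesis unfolding sum_distrib_left .
qed

lemma sum_pw:
  assumes "dA > 0" "dB > 0"
  shows "(\<Sum>z\<in>{..<dB ^ n} \<times> {..<dA ^ n}. pw dB dA n G z) = (\<Prod>t<n. \<Sum>z\<in>{..<dB} \<times> {..<dA}. G t z)"
proof -
  have "(\<Sum>z\<in>{..<dB ^ n} \<times> {..<dA ^ n}. pw dB dA n G z)
     = (\<Sum>b<dB ^ n. \<Sum>a<dA ^ n. \<Prod>t<n. G t (dig dB b t, dig dA a t))"
    by (simp add: sum_Times pw_def)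
  also have "\<dots> = (\<Sum>b<dB ^ n. \<Prod>t<n. \<Sum>a<dA. G t (dig dB b t, a))"
    by (intro sum.cong refl sum_prod_dig assms(1))
  also have "\<dots> = (\<Prod>t<n. \<Sum>b<dB. \<Sum>a<dA. G t (b, a))"
    by (rule sum_prod_dig[OF assms(2)])
  finally show ?thesis by (simp add: sum_Times)
qed

lemma kernel_form_pw:
  fixes k :: "nat \<times> nat \<Rightarrow> nat \<times> nat \<Rightarrow> complex"
  assumes d: "dA > 0" "dB > 0"
  shows "(\<Sum>z\<in>{..<dB ^ n} \<times> {..<dA ^ n}. \<Sum>z'\<in>{..<dB ^ n} \<times> {..<dA ^ n}. cnj (pw dB dA n u z) * pw dB dA n u' z' *
        (\<Prod>t<n. k (dig dB (fst z) t, dig dA (snd z) t) (dig dB (fst z') t, dig dA (snd z') t)))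
     = (\<Prod>t<n. \<Sum>z\<in>{..<dB} \<times> {..<dA}. \<Sum>z'\<in>{..<dB} \<times> {..<dA}. cnj (u t z) * u' t z' * k z z')"
proof -
  let ?Z = "{..<dB} \<times> {..<dA}" and ?Zn = "{..<dB ^ n} \<times> {..<dA ^ n}"
  let ?d = "\<lambda>z t. (dig dB (fst z) t, dig dA (snd z) t)"
  have "(\<Sum>z\<in>?Zn. \<Sum>z'\<in>?Zn. cnj (pw dB dA n u z) * pw dB dA n u' z' * (\<Prod>t<n. k (?d z t) (?d z' t)))
     = (\<Sum>z\<in>?Zn. \<Sum>z'\<in>?Zn. pw dB dA n (\<lambda>t w. cnj (u t (?d z t)) * u' t w * k (?d z t) w) z')"
    by (simp add: pw_def prod.distrib)
  also have "\<dots> = (\<Sum>z\<in>?Zn. pw dB dA n (\<lambda>t w. \<Sum>z'\<in>?Z. cnj (u t w) * u' t z' * k w z') z)"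
  proof (rule sum.cong[OF refl])
    fix z
    show "(\<Sum>z'\<in>?Zn. pw dB dA n (\<lambda>t w. cnj (u t (?d z t)) * u' t w * k (?d z t) w) z')
      = pw dB dA n (\<lambda>t w. \<Sum>z'\<in>?Z. cnj (u t w) * u' t z' * k w z') z"
      unfolding sum_pw[OF d] by (simp add: pw_def)
  qed
  also have "\<dots> = (\<Prod>t<n. \<Sum>z\<in>?Z. \<Sum>z'\<in>?Z. cnj (u t z) * u' t z' * k z z')"
    by (rule sum_pw[OF d])
  finally show ?thesis .
qed

lemma chan_out_unit:
  assumes tp: "tp_entries a b Ks" and unit: "(\<Sum>x<a. \<Sum>y<a. (cmod (\<psi> x y))\<^sup>2) = 1"
  shows "(\<Sum>K\<leftarrow>Ks. nsq ({..<b} \<times> {..<a}) (chan_out a \<psi> K)) = 1"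
proof -
  have tp': "(\<Sum>l<length Ks. \<Sum>y\<in>{..<b}. cnj ((Ks ! l) $$ (y,x)) * (Ks ! l) $$ (y,x')) = (if x = x' then 1 else 0)"
    if "x \<in> {..<a}" "x' \<in> {..<a}" for x x'
    using tp that unfolding tp_entries_def sum_list_lessThan by auto
  have "(\<Sum>K\<leftarrow>Ks. nsq ({..<b} \<times> {..<a}) (chan_out a \<psi> K))
      = (\<Sum>z<a. \<Sum>l<length Ks. nsq {..<b} (\<lambda>y. \<Sum>x<a. (Ks ! l) $$ (y,x) * \<psi> x z))"
    unfolding nsq_pair sum_list_lessThan by (subst sum.swap) (simp add: chan_out_def)
  also have "\<dots> = (\<Sum>z<a. nsq {..<a} (\<lambda>x. \<psi> x z))"
    by (intro sum.cong refl isometry_nsq tp') auto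
  also have "\<dots> = 1" unfolding nsq_def by (subst sum.swap) (rule unit)
  finally show ?thesis .
qed

lemma orthonormal_on_pw:
  assumes d: "dA > 0" "dB > 0" and e: "orthonormal_on ({..<dB} \<times> {..<dA}) {..<D} e"
    and X: "X \<subseteq> PiE {..<n} (\<lambda>_. {..<D})"
  shows "orthonormal_on ({..<dB ^ n} \<times> {..<dA ^ n}) X (\<lambda>x. pw dB dA n (\<lambda>t. e (x t)))"
  unfolding orthonormal_on_def
proof (intro ballI)
  fix x x' assume x: "x \<in> X" and x': "x' \<in> X"
  then have xP: "x \<in> PiE {..<n} (\<lambda>_. {..<D})" "x' \<in> PiE {..<n} (\<lambda>_. {..<D})" using X by auto
  then have "\<And>t. t < n \<Longrightarrow> x t < D" "\<And>t. t < n \<Longrightarrow> x' t < D" by (auto simp: PiE_def Pi_def)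
  then have "(\<Prod>t<n. ip ({..<dB} \<times> {..<dA}) (e (x t)) (e (x' t))) = (\<Prod>t<n. if x t = x' t then 1 else 0)"
    using e by (intro prod.cong refl) (simp add: orthonormal_on_def)
  also have "\<dots> = (if x = x' then 1 else 0)"
  proof (cases "x = x'")
    case False
    then obtain t where "t < n" "x t \<noteq> x' t" using xP by (meson PiE_ext lessThan_iff)
    then show ?thesis using False by (auto intro!: prod_zero)
  qed simp
  finally show "ip ({..<dB ^ n} \<times> {..<dA ^ n}) (pw dB dA n (\<lambda>t. e (x t))) (pw dB dA n (\<lambda>t. e (x' t))) = (if x = x' then 1 else 0)"
    unfolding ip_pw[OF d] .
qed

text \<open>By \<open>diag\<close>, \<open>f\<close> and \<open>q\<close> are eigenvectors and
  eigenvalues of the product of the marginals of the output: summing over \<open>a\<close> leaves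
  the marginal on \<open>B\<close>, and summing over Alice's index \<open>c\<close> leaves Bob's
  half of \<open>\<psi>\<close>. The basis \<open>e\<close> will be an eigenbasis of the output
  itself.\<close>

locale single_letter =
  fixes dA dB D :: nat and Ks :: "cmat list" and \<psi> :: "nat \<Rightarrow> nat \<Rightarrow> complex"
    and e f :: "nat \<Rightarrow> nat \<times> nat \<Rightarrow> complex" and q :: "nat \<Rightarrow> real"
  assumes dA: "dA > 0" and dB: "dB > 0"
    and Ks: "\<forall>K\<in>set Ks. K \<in> carrier_mat dB dA" and tp: "tp_entries dA dB Ks"
    and unit: "(\<Sum>x<dA. \<Sum>y<dA. (cmod (\<psi> x y))\<^sup>2) = 1"
    and e: "orthonormal_on ({..<dB} \<times> {..<dA}) {..<D} e" and f: "orthonormal_on ({..<dB} \<times> {..<dA}) {..<D} f"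
    and e_parseval: "\<And>v. (\<Sum>x<D. prb ({..<dB} \<times> {..<dA}) (e x) v) = nsq ({..<dB} \<times> {..<dA}) v"
    and f_parseval: "\<And>v. (\<Sum>x<D. prb ({..<dB} \<times> {..<dA}) (f x) v) = nsq ({..<dB} \<times> {..<dA}) v"
    and q0: "\<And>y. y < D \<Longrightarrow> 0 \<le> q y"
    and diag: "\<And>y y'. y < D \<Longrightarrow> y' < D \<Longrightarrow>
      (\<Sum>K\<leftarrow>Ks. \<Sum>a<dA. \<Sum>c<dA. ip ({..<dB} \<times> {..<dA}) (f y) (\<lambda>(b,a'). chan_out dA \<psi> K (b,a) * \<psi> c a') *
         cnj (ip ({..<dB} \<times> {..<dA}) (f y') (\<lambda>(b,a'). chan_out dA \<psi> K (b,a) * \<psi> c a')))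
      = (if y = y' then complex_of_real (q y) else 0)"
begin

abbreviation "Z \<equiv> {..<dB} \<times> {..<dA}"
abbreviation "Zn n \<equiv> {..<dB ^ n} \<times> {..<dA ^ n}"
abbreviation "\<phi> n \<equiv> chan_out (dA ^ n) (psi_pow dA n \<psi>)"

definition prob :: "(nat \<Rightarrow> nat \<times> nat \<Rightarrow> complex) \<Rightarrow> nat \<Rightarrow> real" where
  "prob g x = (\<Sum>K\<leftarrow>Ks. prb Z (g x) (chan_out dA \<psi> K))"

text \<open>Relative entropy between the output and the product of its marginals, each logarithm
  evaluated in its own eigenbasis; zero eigenvalues contribute \<open>log 2 0 = 0\<close>.\<close>

definition info :: real where
  "info = (\<Sum>x<D. prob e x * log 2 (prob e x)) - (\<Sum>y<D. prob f y * log 2 (q y))"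

lemma prob_nonneg: "0 \<le> prob g x"
  unfolding prob_def by (intro sum_list_nonneg) auto

lemma prob_sum:
  assumes "\<And>v. (\<Sum>x<D. prb Z (g x) v) = nsq Z v"
  shows "(\<Sum>x<D. prob g x) = 1"
proof -
  have "(\<Sum>x<D. prob g x) = (\<Sum>l<length Ks. \<Sum>x<D. prb Z (g x) (chan_out dA \<psi> (Ks ! l)))"
    unfolding prob_def sum_list_lessThan by (rule sum.swap)
  also have "\<dots> = (\<Sum>K\<leftarrow>Ks. nsq Z (chan_out dA \<psi> K))"
    unfolding assms sum_list_lessThan ..
  also have "\<dots> = 1" by (rule chan_out_unit[OF tp unit])
  finally show ?thesis .
qed

text \<open>Both sides are quadratic forms of the output kernel, which factorises. Hence measuring
  in a product basis produces independent, identically distributed outcomes.\<close>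

lemma prob_pw:
  assumes "x \<in> PiE {..<n} (\<lambda>_. {..<D})"
  shows "(\<Sum>l<length (channel_pow n Ks). prb (Zn n) (pw dB dA n (\<lambda>t. g (x t))) (\<phi> n (channel_pow n Ks ! l)))
    = (\<Prod>t<n. prob g (x t))"
proof -
  let ?L = "{..<length (channel_pow n Ks)}" and ?P = "\<lambda>l. channel_pow n Ks ! l"
  let ?k = "\<lambda>z z'. \<Sum>K\<leftarrow>Ks. chan_out dA \<psi> K z * cnj (chan_out dA \<psi> K z')"
  let ?d = "\<lambda>z t. (dig dB (fst z) t, dig dA (snd z) t)"
  have "complex_of_real (\<Sum>l\<in>?L. prb (Zn n) (pw dB dA n (\<lambda>t. g (x t))) (\<phi> n (?P l)))
     = (\<Sum>l\<in>?L. ip (Zn n) (pw dB dA n (\<lambda>t. g (x t))) (\<phi> n (?P l)) * cnj (ip (Zn n) (pw dB dA n (\<lambda>t. g (x t))) (\<phi> n (?P l))))"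
    unfolding of_real_sum by (intro sum.cong refl) (rule complex_norm_square)
  also have "\<dots> = (\<Sum>z\<in>Zn n. \<Sum>z'\<in>Zn n. cnj (pw dB dA n (\<lambda>t. g (x t)) z) * pw dB dA n (\<lambda>t. g (x t)) z' *
      (\<Sum>l\<in>?L. \<phi> n (?P l) z * cnj (\<phi> n (?P l) z')))"
    by (rule gram_kernel)
  also have "\<dots> = (\<Sum>z\<in>Zn n. \<Sum>z'\<in>Zn n. cnj (pw dB dA n (\<lambda>t. g (x t)) z) * pw dB dA n (\<lambda>t. g (x t)) z' *
      (\<Prod>t<n. ?k (?d z t) (?d z' t)))"
  proof (intro sum.cong refl arg_cong2[where f = "(*)"])
    fix z z' assume "z \<in> Zn n" "z' \<in> Zn n"
    then show "(\<Sum>l\<in>?L. \<phi> n (?P l) z * cnj (\<phi> n (?P l) z')) = (\<Prod>t<n. ?k (?d z t) (?d z' t))"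
      using chan_out_pow_gram[OF Ks, of "fst z" n "snd z" "fst z'" "snd z'" \<psi>] unfolding sum_list_lessThan by auto
  qed
  also have "\<dots> = (\<Prod>t<n. \<Sum>z\<in>Z. \<Sum>z'\<in>Z. cnj (g (x t) z) * g (x t) z' * ?k z z')"
    by (rule kernel_form_pw[OF dA dB])
  also have "\<dots> = (\<Prod>t<n. complex_of_real (prob g (x t)))"
  proof (intro prod.cong refl)
    fix t
    have "(\<Sum>z\<in>Z. \<Sum>z'\<in>Z. cnj (g (x t) z) * g (x t) z' * ?k z z')
      = (\<Sum>l<length Ks. ip Z (g (x t)) (chan_out dA \<psi> (Ks ! l)) * cnj (ip Z (g (x t)) (chan_out dA \<psi> (Ks ! l))))"
      unfolding sum_list_lessThan by (rule gram_kernel[symmetric])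
    also have "\<dots> = complex_of_real (prob g (x t))"
      unfolding prob_def sum_list_lessThan of_real_sum by (intro sum.cong refl) (rule complex_norm_square[symmetric])
    finally show "(\<Sum>z\<in>Z. \<Sum>z'\<in>Z. cnj (g (x t) z) * g (x t) z' * ?k z z') = complex_of_real (prob g (x t))" .
  qed
  finally show ?thesis unfolding of_real_prod[symmetric] of_real_eq_iff .
qed

text \<open>The kernel argument for the product of the marginals: \<open>?\<xi>\<close> splits into
  a factor with \<open>(l, a)\<close> on \<open>B\<close> and a factor with \<open>c\<close> on
  Bob's half, and the kernels of both factorise over the digits.\<close>

lemma diag_pw:
  assumes y: "y \<in> PiE {..<n} (\<lambda>_. {..<D})" and y': "y' \<in> PiE {..<n} (\<lambda>_. {..<D})"
  defines "P \<equiv> channel_pow n Ks" and "F \<equiv> \<lambda>y. pw dB dA n (\<lambda>t. f (y t))"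
  shows "(\<Sum>l<length P. \<Sum>a<dA ^ n. \<Sum>c<dA ^ n.
      ip (Zn n) (F y) (\<lambda>(b,a'). \<phi> n (P ! l) (b,a) * psi_pow dA n \<psi> c a') *
      cnj (ip (Zn n) (F y') (\<lambda>(b,a'). \<phi> n (P ! l) (b,a) * psi_pow dA n \<psi> c a')))
    = (if y = y' then complex_of_real (\<Prod>t<n. q (y t)) else 0)"
proof -
  let ?d = "\<lambda>z t. (dig dB (fst z) t, dig dA (snd z) t)"
  let ?S = "{..<length P} \<times> {..<dA ^ n} \<times> {..<dA ^ n}"
  let ?\<xi> = "\<lambda>(l,a,c) (b,a'). \<phi> n (P ! l) (b,a) * psi_pow dA n \<psi> c a'"
  let ?S1 = "{..<length Ks} \<times> {..<dA} \<times> {..<dA}"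
  let ?\<xi>1 = "\<lambda>(l,a,c) (b,a'). chan_out dA \<psi> (Ks ! l) (b,a) * \<psi> c a'"
  let ?k = "\<lambda>z z'. (\<Sum>j\<in>?S1. ?\<xi>1 j z * cnj (?\<xi>1 j z'))"
  have fac: "(\<Sum>l\<in>S. \<Sum>a\<in>T. \<Sum>c\<in>U. F l a * G c) = (\<Sum>a\<in>T. \<Sum>l\<in>S. F l a) * (\<Sum>c\<in>U. G c)"
    for F :: "nat \<Rightarrow> nat \<Rightarrow> complex" and G :: "nat \<Rightarrow> complex" and S T U
  proof -
    have "(\<Sum>l\<in>S. \<Sum>a\<in>T. \<Sum>c\<in>U. F l a * G c) = (\<Sum>a\<in>T. \<Sum>l\<in>S. \<Sum>c\<in>U. F l a * G c)" by (rule sum.swap)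
    then show ?thesis by (simp only: sum_distrib_right[symmetric] sum_distrib_left[symmetric])
  qed
  have k: "?k (b,a1) (b',a1') = (\<Sum>a<dA. \<Sum>K\<leftarrow>Ks. chan_out dA \<psi> K (b,a) * cnj (chan_out dA \<psi> K (b',a))) * (\<Sum>c<dA. \<psi> c a1 * cnj (\<psi> c a1'))"
    for b a1 b' a1'
    unfolding sum_list_lessThan fac[symmetric] by (simp add: sum_Times mult_ac)
  have ker: "(\<Sum>j\<in>?S. ?\<xi> j z * cnj (?\<xi> j z')) = (\<Prod>t<n. ?k (?d z t) (?d z' t))" if z: "z \<in> Zn n" "z' \<in> Zn n" for z z'
  proof -
    obtain b a1 b' a1' where zz: "z = (b,a1)" "z' = (b',a1')" by (metis surj_pair)
    then have bd: "b < dB ^ n" "a1 < dA ^ n" "b' < dB ^ n" "a1' < dA ^ n" using z by auto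
    have "(\<Sum>j\<in>?S. ?\<xi> j z * cnj (?\<xi> j z'))
      = (\<Sum>a<dA ^ n. \<Sum>l<length P. \<phi> n (P ! l) (b,a) * cnj (\<phi> n (P ! l) (b',a))) * (\<Sum>c<dA ^ n. psi_pow dA n \<psi> c a1 * cnj (psi_pow dA n \<psi> c a1'))"
      unfolding fac[symmetric] zz by (simp add: sum_Times mult_ac)
    also have "(\<Sum>a<dA ^ n. \<Sum>l<length P. \<phi> n (P ! l) (b,a) * cnj (\<phi> n (P ! l) (b',a)))
      = (\<Sum>a<dA ^ n. \<Prod>t<n. \<Sum>K\<leftarrow>Ks. chan_out dA \<psi> K (dig dB b t, dig dA a t) * cnj (chan_out dA \<psi> K (dig dB b' t, dig dA a t)))"
      using bd chan_out_pow_gram[OF Ks, of b n _ b' _ \<psi>] unfolding P_def sum_list_lessThan by (intro sum.cong refl) auto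
    also have "\<dots> = (\<Prod>t<n. \<Sum>a<dA. \<Sum>K\<leftarrow>Ks. chan_out dA \<psi> K (dig dB b t, a) * cnj (chan_out dA \<psi> K (dig dB b' t, a)))"
      by (rule sum_prod_dig[OF dA])
    also have "(\<Sum>c<dA ^ n. psi_pow dA n \<psi> c a1 * cnj (psi_pow dA n \<psi> c a1'))
      = (\<Sum>c<dA ^ n. \<Prod>t<n. \<psi> (dig dA c t) (dig dA a1 t) * cnj (\<psi> (dig dA c t) (dig dA a1' t)))"
      by (simp add: psi_pow_def prod.distrib)
    also have "\<dots> = (\<Prod>t<n. \<Sum>c<dA. \<psi> c (dig dA a1 t) * cnj (\<psi> c (dig dA a1' t)))"
      by (rule sum_prod_dig[OF dA])
    finally show ?thesis unfolding zz fst_conv snd_conv k prod.distrib .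
  qed
  have "(\<Sum>l<length P. \<Sum>a<dA ^ n. \<Sum>c<dA ^ n.
      ip (Zn n) (F y) (\<lambda>(b,a'). \<phi> n (P ! l) (b,a) * psi_pow dA n \<psi> c a') *
      cnj (ip (Zn n) (F y') (\<lambda>(b,a'). \<phi> n (P ! l) (b,a) * psi_pow dA n \<psi> c a')))
    = (\<Sum>j\<in>?S. ip (Zn n) (F y) (?\<xi> j) * cnj (ip (Zn n) (F y') (?\<xi> j)))"
    by (simp add: sum_Times)
  also have "\<dots> = (\<Sum>z\<in>Zn n. \<Sum>z'\<in>Zn n. cnj (F y z) * F y' z' * (\<Sum>j\<in>?S. ?\<xi> j z * cnj (?\<xi> j z')))"
    by (rule gram_kernel)
  also have "\<dots> = (\<Sum>z\<in>Zn n. \<Sum>z'\<in>Zn n. cnj (F y z) * F y' z' * (\<Prod>t<n. ?k (?d z t) (?d z' t)))"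
    by (intro sum.cong refl arg_cong2[where f = "(*)"] ker)
  also have "\<dots> = (\<Prod>t<n. \<Sum>z\<in>Z. \<Sum>z'\<in>Z. cnj (f (y t) z) * f (y' t) z' * ?k z z')"
    unfolding F_def by (rule kernel_form_pw[OF dA dB])
  also have "\<dots> = (\<Prod>t<n. if y t = y' t then complex_of_real (q (y t)) else 0)"
  proof (intro prod.cong refl)
    fix t assume "t \<in> {..<n}"
    then have t: "y t < D" "y' t < D" using y y' by (auto simp: PiE_def Pi_def)
    have "(\<Sum>z\<in>Z. \<Sum>z'\<in>Z. cnj (f (y t) z) * f (y' t) z' * ?k z z') = (\<Sum>j\<in>?S1. ip Z (f (y t)) (?\<xi>1 j) * cnj (ip Z (f (y' t)) (?\<xi>1 j)))"
      by (rule gram_kernel[symmetric])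
    also have "\<dots> = (if y t = y' t then complex_of_real (q (y t)) else 0)"
      using diag[OF t] unfolding sum_list_lessThan by (simp add: sum_Times)
    finally show "(\<Sum>z\<in>Z. \<Sum>z'\<in>Z. cnj (f (y t) z) * f (y' t) z' * ?k z z') = (if y t = y' t then complex_of_real (q (y t)) else 0)" .
  qed
  also have "\<dots> = (if y = y' then complex_of_real (\<Prod>t<n. q (y t)) else 0)"
  proof (cases "y = y'")
    case False
    then obtain t where "t < n" "y t \<noteq> y' t" using y y' by (meson PiE_ext lessThan_iff)
    then show ?thesis using False by (auto intro!: prod_zero)
  qed simp
  finally show ?thesis .
qed

text \<open>Only an inequality survives a vanishing factor, because \<open>log 2 0 = 0\<close>; its
  direction is the one needed to bound eigenvalues from above.\<close>

lemma prod_log: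
  fixes g :: "nat \<Rightarrow> real"
  assumes "\<And>t. t < n \<Longrightarrow> 0 \<le> g t"
  shows "(\<Prod>t<n. g t) \<le> 2 powr (\<Sum>t<n. log 2 (g t))"
    and "(\<And>t. t < n \<Longrightarrow> 0 < g t) \<Longrightarrow> (\<Prod>t<n. g t) = 2 powr (\<Sum>t<n. log 2 (g t))"
proof -
  show eq: "(\<Prod>t<n. g t) = 2 powr (\<Sum>t<n. log 2 (g t))" if "\<And>t. t < n \<Longrightarrow> 0 < g t"
    using that by (simp add: powr_sum)
  show "(\<Prod>t<n. g t) \<le> 2 powr (\<Sum>t<n. log 2 (g t))"
  proof (cases "\<forall>t<n. 0 < g t")
    case True
    then show ?thesis using eq by simp
  next
    case False
    then obtain t where "t < n" "g t = 0" using assms by force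
    then have z: "(\<Prod>t<n. g t) = 0" by (meson finite_lessThan lessThan_iff prod_zero)
    show ?thesis unfolding z by simp
  qed
qed

definition "vp = (\<Sum>x<D. prob e x * (log 2 (prob e x) - (\<Sum>x<D. prob e x * log 2 (prob e x)))\<^sup>2)"
definition "vr = (\<Sum>y<D. prob f y * (log 2 (q y) - (\<Sum>y<D. prob f y * log 2 (q y)))\<^sup>2)"

text \<open>Typicality is used on one side each: on \<open>X\<close> the probabilities are bounded
  below, so \<open>card X\<close> is bounded above, and on \<open>Y\<close> the eigenvalues are at
  most \<open>Q\<close>. Then \<open>card X * Q\<close> bounds the acceptance of the product state,
  with exponent \<open>info - 2 * \<delta>\<close>.\<close>

lemma finite_n_test:
  assumes n: "n > 0" and \<delta>: "\<delta> > 0" and lam: "0 < lam" and c: "0 < (c::real)"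
  defines "P \<equiv> channel_pow n Ks" and "\<epsilon> \<equiv> (vp + vr) / (real n * \<delta>\<^sup>2)"
  shows "\<exists>(X :: (nat \<Rightarrow> nat) set) t. finite X \<and>
     (\<forall>v. (\<Sum>x\<in>X. prb (Zn n) (t x) v) \<le> nsq (Zn n) v) \<and>
     (\<forall>\<beta>. (\<Sum>c<dA ^ n. \<Sum>x\<in>X. prb (Zn n) (t x) (\<lambda>(b,a). \<beta> b * psi_pow dA n \<psi> c a)) \<le> lam * nsq {..<dB ^ n} \<beta>) \<and>
     1 - \<epsilon> \<le> (1 + c) * (\<Sum>l<length P. \<Sum>x\<in>X. prb (Zn n) (t x) (\<phi> n (P ! l)))
       + (1 + 1/c) * (2 * \<epsilon> + 2 * (2 powr (- real n * (info - 2 * \<delta>)) / lam))"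
proof -
  let ?P = "PiE {..<n} (\<lambda>_. {..<D})"
  define mp where "mp = (\<Sum>x<D. prob e x * log 2 (prob e x))"
  define mq where "mq = (\<Sum>y<D. prob f y * log 2 (q y))"
  have finP: "finite ?P" by (intro finite_PiE) auto
  \<comment> \<open>Every factor must be positive, so that the product of the probabilities equals
    \<open>2 powr\<close> the sum of the logarithms.\<close>
  define X where "X = {x \<in> ?P. (\<forall>t<n. 0 < prob e (x t)) \<and> real n * (mp - \<delta>) \<le> (\<Sum>t<n. log 2 (prob e (x t)))}"
  define Y where "Y = {y \<in> ?P. (\<Sum>t<n. log 2 (q (y t))) \<le> real n * (mq + \<delta>)}"
  have XP: "X \<subseteq> ?P" and YP: "Y \<subseteq> ?P" by (auto simp: X_def Y_def)
  have finX: "finite X" and finY: "finite Y" using XP YP finP finite_subset by blast+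
  note sp = prob_sum[of e, OF e_parseval] and sr = prob_sum[of f, OF f_parseval]
  have v0: "0 \<le> vp" "0 \<le> vr" unfolding vp_def vr_def by (intro sum_nonneg mult_nonneg_nonneg prob_nonneg zero_le_power2)+
  have nd: "real n * \<delta>\<^sup>2 > 0" using n \<delta> by simp
  have Xprob: "1 - \<epsilon> \<le> (\<Sum>x\<in>X. \<Prod>t<n. prob e (x t))"
  proof -
    have "1 - (\<Sum>x<D. prob e x * (log 2 (prob e x) - mp)\<^sup>2) / (real n * \<delta>\<^sup>2) \<le> (\<Sum>x\<in>X. \<Prod>t<n. prob e (x t))"
    proof (rule chebyshev_iid[OF prob_nonneg sp mp_def \<delta> n XP])
      fix x assume x: "x \<in> ?P" and dev: "\<bar>(\<Sum>t<n. log 2 (prob e (x t))) - real n * mp\<bar> < real n * \<delta>"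
      show "x \<in> X \<or> (\<Prod>t<n. prob e (x t)) = 0"
      proof (cases "\<forall>t<n. 0 < prob e (x t)")
        case True
        have "real n * (mp - \<delta>) \<le> (\<Sum>t<n. log 2 (prob e (x t)))" using dev by (simp add: right_diff_distrib)
        then show ?thesis using True x by (auto simp: X_def)
      next
        case False
        then obtain t where t: "t < n" "\<not> 0 < prob e (x t)" by blast
        then have "prob e (x t) = 0" using prob_nonneg[of e "x t"] by linarith
        with t(1) show ?thesis by (auto intro!: prod_zero)
      qed
    qed
    moreover have "(\<Sum>x<D. prob e x * (log 2 (prob e x) - mp)\<^sup>2) / (real n * \<delta>\<^sup>2) \<le> \<epsilon>"
      unfolding \<epsilon>_def using nd v0 by (intro divide_right_mono) (auto simp: vp_def mp_def)
    ultimately show ?thesis by linarith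
  qed
  have Yprob: "1 - \<epsilon> \<le> (\<Sum>y\<in>Y. \<Prod>t<n. prob f (y t))"
  proof -
    have "1 - (\<Sum>y<D. prob f y * (log 2 (q y) - mq)\<^sup>2) / (real n * \<delta>\<^sup>2) \<le> (\<Sum>y\<in>Y. \<Prod>t<n. prob f (y t))"
    proof (rule chebyshev_iid[OF prob_nonneg sr mq_def \<delta> n YP])
      fix y assume y: "y \<in> ?P" and dev: "\<bar>(\<Sum>t<n. log 2 (q (y t))) - real n * mq\<bar> < real n * \<delta>"
      have "(\<Sum>t<n. log 2 (q (y t))) \<le> real n * (mq + \<delta>)" using dev unfolding distrib_left by linarith
      then show "y \<in> Y \<or> (\<Prod>t<n. prob f (y t)) = 0" using y by (simp add: Y_def)
    qed
    moreover have "(\<Sum>y<D. prob f y * (log 2 (q y) - mq)\<^sup>2) / (real n * \<delta>\<^sup>2) \<le> \<epsilon>"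
      unfolding \<epsilon>_def using nd v0 by (intro divide_right_mono) (auto simp: vr_def mq_def)
    ultimately show ?thesis by linarith
  qed
  define Q where "Q = 2 powr (real n * (mq + \<delta>))"
  have qQ: "(\<Prod>t<n. q (y t)) \<le> Q" if "y \<in> Y" for y
  proof -
    have "y t < D" if "t < n" for t using \<open>y \<in> Y\<close> YP that by (auto simp: PiE_def Pi_def)
    then have "(\<Prod>t<n. q (y t)) \<le> 2 powr (\<Sum>t<n. log 2 (q (y t)))" by (intro prod_log(1)) (auto intro: q0)
    also have "\<dots> \<le> Q" unfolding Q_def using that by (intro powr_mono) (auto simp: Y_def)
    finally show ?thesis .
  qed
  have "real (card X) * 2 powr (real n * (mp - \<delta>)) = (\<Sum>x\<in>X. 2 powr (real n * (mp - \<delta>)))" by simp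
  also have "\<dots> \<le> (\<Sum>x\<in>X. \<Prod>t<n. prob e (x t))"
  proof (intro sum_mono)
    fix x assume x: "x \<in> X"
    have "2 powr (real n * (mp - \<delta>)) \<le> 2 powr (\<Sum>t<n. log 2 (prob e (x t)))"
      using x by (intro powr_mono) (auto simp: X_def)
    also have "\<dots> = (\<Prod>t<n. prob e (x t))"
      using x by (intro prod_log(2)[symmetric] prob_nonneg) (auto simp: X_def)
    finally show "2 powr (real n * (mp - \<delta>)) \<le> (\<Prod>t<n. prob e (x t))" .
  qed
  also have "\<dots> \<le> (\<Sum>x\<in>?P. \<Prod>t<n. prob e (x t))"
    using XP finP by (intro sum_mono2 prod_nonneg) (auto intro: prob_nonneg)
  also have "\<dots> = 1" using second_moment_iid(1)[OF sp, of "\<lambda>_. 0"] by simp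
  finally have "real (card X) * 2 powr (real n * (mp - \<delta>)) \<le> 1" .
  then have "real (card X) * 2 powr (real n * (mp - \<delta>)) * 2 powr (- real n * (info - 2 * \<delta>)) \<le> 1 * 2 powr (- real n * (info - 2 * \<delta>))"
    by (intro mult_right_mono) auto
  moreover have Qeq: "2 powr (real n * (mp - \<delta>)) * 2 powr (- real n * (info - 2 * \<delta>)) = Q"
    unfolding Q_def powr_add[symmetric] info_def mp_def[symmetric] mq_def[symmetric] by (simp add: algebra_simps)
  ultimately have cardQ: "real (card X) * Q \<le> 2 powr (- real n * (info - 2 * \<delta>))"
    unfolding mult.assoc Qeq by simp
  define en where "en = (\<lambda>x. pw dB dA n (\<lambda>t. e (x t)))"
  define fn where "fn = (\<lambda>y. pw dB dA n (\<lambda>t. f (y t)))"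
  have "\<exists>t. (\<forall>v. (\<Sum>x\<in>X. prb (Zn n) (t x) v) \<le> nsq (Zn n) v) \<and>
     (\<forall>\<beta>. (\<Sum>c<dA ^ n. \<Sum>x\<in>X. prb (Zn n) (t x) (\<lambda>(b,a). \<beta> b * psi_pow dA n \<psi> c a)) \<le> lam * nsq {..<dB ^ n} \<beta>) \<and>
     1 - \<epsilon> \<le> (1 + c) * (\<Sum>l<length P. \<Sum>x\<in>X. prb (Zn n) (t x) (\<phi> n (P ! l)))
       + (1 + 1/c) * (2 * \<epsilon> + 2 * (2 powr (- real n * (info - 2 * \<delta>)) / lam))"
  proof (rule universal_test[where e = en and f = fn and Y = Y and q = "\<lambda>y. \<Prod>t<n. q (y t)" and Q = Q and lam = lam and c = c])
    show "(\<Sum>l<length P. nsq (Zn n) (\<phi> n (P ! l))) = 1"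
      using chan_out_unit[OF tp_entries_channel_pow[OF Ks tp] psi_pow_unit[OF dA unit]]
      unfolding sum_list_lessThan P_def .
    show "orthonormal_on (Zn n) X en" unfolding en_def by (rule orthonormal_on_pw[OF dA dB e XP])
    show "orthonormal_on (Zn n) Y fn" unfolding fn_def by (rule orthonormal_on_pw[OF dA dB f YP])
    have "(\<Sum>x\<in>X. \<Sum>l<length P. prb (Zn n) (en x) (\<phi> n (P ! l))) = (\<Sum>x\<in>X. \<Prod>t<n. prob e (x t))"
      using XP unfolding en_def P_def by (intro sum.cong refl prob_pw) auto
    then show "1 - \<epsilon> \<le> (\<Sum>x\<in>X. \<Sum>l<length P. prb (Zn n) (en x) (\<phi> n (P ! l)))" using Xprob by simp
    have "(\<Sum>y\<in>Y. \<Sum>l<length P. prb (Zn n) (fn y) (\<phi> n (P ! l))) = (\<Sum>y\<in>Y. \<Prod>t<n. prob f (y t))"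
      using YP unfolding fn_def P_def by (intro sum.cong refl prob_pw) auto
    then show "1 - \<epsilon> \<le> (\<Sum>y\<in>Y. \<Sum>l<length P. prb (Zn n) (fn y) (\<phi> n (P ! l)))" using Yprob by simp
    fix y y' assume "y \<in> Y" "y' \<in> Y"
    then show "(\<Sum>l<length P. \<Sum>a<dA ^ n. \<Sum>c<dA ^ n.
      ip (Zn n) (fn y) (\<lambda>(b,a'). \<phi> n (P ! l) (b,a) * psi_pow dA n \<psi> c a') *
      cnj (ip (Zn n) (fn y') (\<lambda>(b,a'). \<phi> n (P ! l) (b,a) * psi_pow dA n \<psi> c a')))
      = (if y = y' then complex_of_real (\<Prod>t<n. q (y t)) else 0)"
      using YP unfolding fn_def P_def by (intro diag_pw) auto
  qed (use finX finY qQ cardQ lam c in \<open>auto simp: Q_def\<close>)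
  then show ?thesis using finX by blast
qed

lemma asymptotic_test:
  assumes R: "R < info" and \<epsilon>: "0 < \<epsilon>"
  shows "\<forall>\<^sub>F n in sequentially. \<exists>(X :: (nat \<Rightarrow> nat) set) t. finite X \<and>
     (\<forall>v. (\<Sum>x\<in>X. prb (Zn n) (t x) v) \<le> nsq (Zn n) v) \<and>
     (\<forall>\<beta>. (\<Sum>c<dA ^ n. \<Sum>x\<in>X. prb (Zn n) (t x) (\<lambda>(b,a). \<beta> b * psi_pow dA n \<psi> c a)) \<le> 2 powr (- real n * R) * nsq {..<dB ^ n} \<beta>) \<and>
     1 - \<epsilon> \<le> (\<Sum>l<length (channel_pow n Ks). \<Sum>x\<in>X. prb (Zn n) (t x) (\<phi> n (channel_pow n Ks ! l)))"
proof -
  \<comment> \<open>A quarter of the gap: typicality costs \<open>2 * \<delta>\<close> of the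
    exponent, and \<open>2 * \<delta>\<close> remain for the decay of the acceptance bound relative
    to \<open>2 powr (- real n * R)\<close>.\<close>
  define \<delta> where "\<delta> = (info - R) / 4"
  have \<delta>: "\<delta> > 0" using R by (simp add: \<delta>_def)
  \<comment> \<open>Total errors below \<open>c\<close> give \<open>1 - c \<le> (1 + c) * s\<close>,
    hence \<open>s \<ge> 1 - 2 * c\<close>, which is at least \<open>1 - \<epsilon>\<close>.\<close>
  define c where "c = min \<epsilon> 1 / 2"
  have c: "0 < c" "c \<le> \<epsilon> / 2" "c \<le> 1/2" using \<epsilon> by (auto simp: c_def)
  define \<epsilon>1 where "\<epsilon>1 = (\<lambda>n. (vp + vr) / (real n * \<delta>\<^sup>2))"
  define \<eta> where "\<eta> = (\<lambda>n. \<epsilon>1 n + (1 + 1/c) * (2 * \<epsilon>1 n + 2 * (2 powr (- real n * (2 * \<delta>)))))"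
  have e1: "\<epsilon>1 \<longlonglongrightarrow> 0" 
  proof -
    have "(\<lambda>n. ((vp + vr) / \<delta>\<^sup>2) * (1 / real n)) \<longlonglongrightarrow> 0"
      by (rule tendsto_mult_right_zero[OF lim_1_over_n])
    then show ?thesis unfolding \<epsilon>1_def by (simp add: mult.commute)
  qed
  have e2: "(\<lambda>n. 2 powr (- real n * (2 * \<delta>))) \<longlonglongrightarrow> 0" using \<delta> by real_asymp
  have "\<eta> \<longlonglongrightarrow> 0 + (1 + 1/c) * (2 * 0 + 2 * 0)"
    unfolding \<eta>_def by (intro tendsto_intros e1 e2)
  then have "\<forall>\<^sub>F n in sequentially. \<eta> n < c"
    using c by (intro order_tendstoD(2)) auto
  then show ?thesis
    using eventually_gt_at_top[of 0]
  proof eventually_elim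
    case (elim n)
    have ratio: "2 powr (- real n * (info - 2 * \<delta>)) / 2 powr (- real n * R) = 2 powr (- real n * (2 * \<delta>))"
      unfolding powr_diff[symmetric] \<delta>_def by (simp add: field_simps)
    have pos: "0 < 2 powr (- real n * R)" by simp
    obtain X :: "(nat \<Rightarrow> nat) set" and t where fin: "finite X"
      and t1: "\<forall>v. (\<Sum>x\<in>X. prb (Zn n) (t x) v) \<le> nsq (Zn n) v"
      and t2: "\<forall>\<beta>. (\<Sum>c<dA ^ n. \<Sum>x\<in>X. prb (Zn n) (t x) (\<lambda>(b,a). \<beta> b * psi_pow dA n \<psi> c a)) \<le> 2 powr (- real n * R) * nsq {..<dB ^ n} \<beta>"
      and t3: "1 - \<epsilon>1 n \<le> (1 + c) * (\<Sum>l<length (channel_pow n Ks). \<Sum>x\<in>X. prb (Zn n) (t x) (\<phi> n (channel_pow n Ks ! l)))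
       + (1 + 1/c) * (2 * \<epsilon>1 n + 2 * (2 powr (- real n * (info - 2 * \<delta>)) / 2 powr (- real n * R)))"
      using finite_n_test[OF elim(2) \<delta> pos c(1)] unfolding \<epsilon>1_def by (elim exE conjE) simp
    define s where "s = (\<Sum>l<length (channel_pow n Ks). \<Sum>x\<in>X. prb (Zn n) (t x) (\<phi> n (channel_pow n Ks ! l)))"
    have "1 - c \<le> (1 + c) * s"
      using t3 elim(1) unfolding ratio s_def[symmetric] \<eta>_def by linarith
    moreover have "(1 + c) * (1 - 2 * c) \<le> 1 - c" using c by (simp add: algebra_simps)
    ultimately have "(1 + c) * (1 - 2 * c) \<le> (1 + c) * s" by linarith
    then have "1 - 2 * c \<le> s" using c by simp
    then have "1 - \<epsilon> \<le> s" using c by linarith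
    then show ?case using fin t1 t2 unfolding s_def by blast
  qed
qed

end

section \<open>Spectral theorem\<close>

lemma mat_mult_entry:
  assumes "A \<in> carrier_mat a b" "B \<in> carrier_mat b c" "i < a" "j < c"
  shows "(A * B) $$ (i,j) = (\<Sum>k<b. A $$ (i,k) * B $$ (k,j))"
  using assms by (auto simp: scalar_prod_def atLeast0LessThan intro!: sum.cong)

lemma dag_carrier [simp]: "A \<in> carrier_mat a b \<Longrightarrow> dag A \<in> carrier_mat b a"
  by (auto simp: dag_def)

lemma dag_entry: "A \<in> carrier_mat a b \<Longrightarrow> i < b \<Longrightarrow> j < a \<Longrightarrow> dag A $$ (i,j) = cnj (A $$ (j,i))"
  by (auto simp: dag_def)

lemma dag_dag: "dag (dag A) = A"
  by (auto simp: dag_def intro!: eq_matI)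

lemma dag_mult:
  assumes "A \<in> carrier_mat a b" "B \<in> carrier_mat b c"
  shows "dag (A * B) = dag B * dag A"
proof (rule eq_matI)
  fix i j assume "i < dim_row (dag B * dag A)" "j < dim_col (dag B * dag A)"
  then have ij: "i < c" "j < a" using assms by (auto simp: dag_def)
  have "dag (A * B) $$ (i,j) = cnj (\<Sum>k<b. A $$ (j,k) * B $$ (k,i))"
    using assms ij by (simp add: dag_entry[of "A * B" a c] mat_mult_entry[of A a b B c] del: index_mult_mat)
  also have "\<dots> = (\<Sum>k<b. dag B $$ (i,k) * dag A $$ (k,j))"
    using assms ij by (simp add: dag_entry[of A a b] dag_entry[of B b c] mult.commute)
  also have "\<dots> = (dag B * dag A) $$ (i,j)"
    using assms ij by (subst mat_mult_entry[of _ c b _ a]) auto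
  finally show "dag (A * B) $$ (i,j) = (dag B * dag A) $$ (i,j)" .
qed (use assms in \<open>auto simp: dag_def\<close>)

lemma unitary_mult_dag:
  assumes "unitary n U"
  shows "U * dag U = 1\<^sub>m n"
  using assms mat_mult_left_right_inverse[of "dag U" n U] unfolding unitary_def by auto

text \<open>Complete \<open>v\<close> to a basis and apply Gram--Schmidt, which leaves its first
  vector alone; normalising the lengths accounts for the factor \<open>c\<close>.\<close>

lemma orthonormal_basis_from_vec:
  fixes v :: "complex vec"
  assumes v: "v \<in> carrier_vec n" and v0: "v \<noteq> 0\<^sub>v n" and n: "n \<noteq> 0"
  shows "\<exists>W c. unitary n W \<and> (\<forall>k<n. W $$ (k,0) = c * v $ k)"
proof -
  interpret cof_vec_space n "TYPE(complex)" .
  define b where "b = basis_completion v"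
  define ws where "ws = gram_schmidt n b"
  from basis_completion[OF v v0, folded b_def]
  have dist_b: "distinct b" and indep: "\<not> lin_dep (set b)" and b: "set b \<subseteq> carrier_vec n"
    and hdb: "hd b = v" and len_b: "length b = n" by auto
  from hdb len_b n obtain vs where bv: "b = v # vs" by (cases b) auto
  from gram_schmidt_result[OF b dist_b indep refl, folded ws_def]
  have ws: "set ws \<subseteq> carrier_vec n" "corthogonal ws" "length ws = n" by (auto simp: len_b)
  have "hd ws = v" using gram_schmidt_hd[OF v, of vs, folded bv] unfolding ws_def .
  then have ws0: "ws ! 0 = v" using ws(3) n by (cases ws) auto
  have wsc: "ws ! j \<in> carrier_vec n" if "j < n" for j using ws that by auto
  define N where "N j = sqrt (\<Sum>k<n. (cmod (ws ! j $ k))\<^sup>2)" for j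
  have inner: "ws ! i \<bullet>c ws ! j = (\<Sum>k<n. ws ! i $ k * cnj (ws ! j $ k))" if "i < n" "j < n" for i j
    using wsc[OF that(1)] wsc[OF that(2)] by (auto simp: scalar_prod_def atLeast0LessThan intro!: sum.cong)
  have orth: "(\<Sum>k<n. ws ! i $ k * cnj (ws ! j $ k)) = 0 \<longleftrightarrow> i \<noteq> j" if "i < n" "j < n" for i j
    using corthogonalD[OF ws(2), of i j] that ws(3) by (simp add: inner)
  have self: "(\<Sum>k<n. ws ! j $ k * cnj (ws ! j $ k)) = complex_of_real (N j) * complex_of_real (N j)" for j
  proof -
    have "(\<Sum>k<n. ws ! j $ k * cnj (ws ! j $ k)) = complex_of_real (\<Sum>k<n. (cmod (ws ! j $ k))\<^sup>2)"
      unfolding of_real_sum by (intro sum.cong refl) (rule complex_norm_square[symmetric])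
    also have "(\<Sum>k<n. (cmod (ws ! j $ k))\<^sup>2) = N j * N j"
      unfolding N_def by (simp add: sum_nonneg)
    finally show ?thesis by simp
  qed
  have N0: "complex_of_real (N j) \<noteq> 0" if "j < n" for j
    using orth[OF that that] self[of j] by auto
  define W where "W = mat n n (\<lambda>(k,j). ws ! j $ k / complex_of_real (N j))"
  have W: "W \<in> carrier_mat n n" by (simp add: W_def)
  have "dag W * W = 1\<^sub>m n"
  proof (rule eq_matI)
    fix i j assume "i < dim_row (1\<^sub>m n)" "j < dim_col (1\<^sub>m n)"
    then have ij: "i < n" "j < n" by auto
    have "(dag W * W) $$ (i,j) = (\<Sum>k<n. ws ! j $ k * cnj (ws ! i $ k) / (complex_of_real (N i) * complex_of_real (N j)))"
    proof -
      have "(dag W * W) $$ (i,j) = (\<Sum>k<n. dag W $$ (i,k) * W $$ (k,j))"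
        using ij W by (intro mat_mult_entry) auto
      also have "\<dots> = (\<Sum>k<n. cnj (ws ! i $ k / complex_of_real (N i)) * (ws ! j $ k / complex_of_real (N j)))"
      proof (intro sum.cong refl arg_cong2[where f = "(*)"])
        fix k assume k: "k \<in> {..<n}"
        show "dag W $$ (i,k) = cnj (ws ! i $ k / complex_of_real (N i))"
          using k ij dag_entry[OF W, of i k] by (simp add: W_def)
        show "W $$ (k,j) = ws ! j $ k / complex_of_real (N j)"
          using k ij by (simp add: W_def)
      qed
      finally show ?thesis by (simp add: mult.commute)
    qed
    also have "\<dots> = (if i = j then 1 else 0)"
      unfolding sum_divide_distrib[symmetric] using orth[OF ij(2,1)] self[of j] N0[OF ij(2)] by auto
    finally show "(dag W * W) $$ (i,j) = 1\<^sub>m n $$ (i,j)" using ij by simp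
  qed (use W in \<open>auto simp: dag_def\<close>)
  then have "unitary n W" using W by (simp add: unitary_def)
  moreover have "\<forall>k<n. W $$ (k,0) = (1 / complex_of_real (N 0)) * v $ k"
    using n ws0 by (auto simp: W_def)
  ultimately show ?thesis by blast
qed

text \<open>Deflation: in an orthonormal basis starting with an eigenvector the first column of the
  matrix is \<open>e\<close> times the first unit vector. Hermiticity clears the first row as well
  and makes \<open>e\<close> real; the induction hypothesis treats the remaining block.\<close>

lemma hermitian_spectral:
  assumes "A \<in> carrier_mat n n" and "dag A = A"
  shows "\<exists>U lam. unitary n U \<and> A = U * mat_diag n (\<lambda>i. complex_of_real (lam i)) * dag U"
  using assms
proof (induction n arbitrary: A)
  case 0
  then show ?case
    by (intro exI[of _ "1\<^sub>m 0"] exI[of _ "\<lambda>_. 0"]) (auto simp: unitary_def dag_def intro!: eq_matI)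
next
  case (Suc m)
  let ?n = "Suc m"
  note A = Suc.prems(1)
  have "spectrum A \<noteq> {}" using spectrum_non_empty[OF A] by simp
  then obtain e where "eigenvalue A e" by (auto simp: spectrum_def)
  then obtain v where v: "v \<in> carrier_vec ?n" "v \<noteq> 0\<^sub>v ?n" and ev: "A *\<^sub>v v = e \<cdot>\<^sub>v v"
    using A unfolding eigenvalue_def eigenvector_def by auto
  obtain W c where U: "unitary ?n W" and col0: "\<And>k. k < ?n \<Longrightarrow> W $$ (k,0) = c * v $ k"
    using orthonormal_basis_from_vec[OF v] by auto
  have W: "W \<in> carrier_mat ?n ?n" and WW: "dag W * W = 1\<^sub>m ?n" using U by (auto simp: unitary_def)
  note WW' = unitary_mult_dag[OF U]
  note dW = dag_carrier[OF W]
  define A' where "A' = dag W * (A * W)"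
  have A': "A' \<in> carrier_mat ?n ?n" using A W dW unfolding A'_def by (intro mult_carrier_mat)
  have hermA': "dag A' = A'"
  proof -
    have "dag A' = dag (A * W) * dag (dag W)" unfolding A'_def using A W dW by (intro dag_mult[of _ ?n ?n _ ?n]) auto
    also have "\<dots> = dag W * A * W" using A W Suc.prems(2) by (simp add: dag_mult[of A ?n ?n W ?n] dag_dag)
    also have "\<dots> = A'" unfolding A'_def by (rule assoc_mult_mat[OF dW A W])
    finally show ?thesis .
  qed
  have AW0: "(A * W) $$ (k,0) = e * W $$ (k,0)" if k: "k < ?n" for k
  proof -
    have "(A *\<^sub>v v) $ k = (\<Sum>l<?n. A $$ (k,l) * v $ l)"
      using A v k by (auto simp: scalar_prod_def atLeast0LessThan intro!: sum.cong)
    then have s: "(\<Sum>l<?n. A $$ (k,l) * v $ l) = e * v $ k" using ev k v by simp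
    have "(A * W) $$ (k,0) = (\<Sum>l<?n. A $$ (k,l) * W $$ (l,0))"
      using A W k by (intro mat_mult_entry) auto
    also have "\<dots> = c * (\<Sum>l<?n. A $$ (k,l) * v $ l)"
      unfolding sum_distrib_left by (intro sum.cong refl) (simp add: col0)
    also have "\<dots> = e * W $$ (k,0)" unfolding s using col0[OF k] by simp
    finally show ?thesis .
  qed
  have A'0: "A' $$ (i,0) = (if i = 0 then e else 0)" if i: "i < ?n" for i
  proof -
    have "A' $$ (i,0) = (\<Sum>k<?n. dag W $$ (i,k) * (A * W) $$ (k,0))"
      unfolding A'_def using A W dW i by (intro mat_mult_entry) auto
    also have "\<dots> = e * (\<Sum>k<?n. dag W $$ (i,k) * W $$ (k,0))"
      unfolding sum_distrib_left by (intro sum.cong refl) (simp add: AW0 del: index_mult_mat)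
    also have "(\<Sum>k<?n. dag W $$ (i,k) * W $$ (k,0)) = (dag W * W) $$ (i,0)"
      using W dW i by (intro mat_mult_entry[symmetric]) auto
    also have "\<dots> = (if i = 0 then 1 else 0)" unfolding WW using i by simp
    finally show ?thesis by simp
  qed
  have sym: "A' $$ (i,j) = cnj (A' $$ (j,i))" if "i < ?n" "j < ?n" for i j
    using dag_entry[OF A' that] hermA' by simp
  have e: "e = complex_of_real (Re e)"
    using sym[of 0 0] A'0[of 0] by (metis Reals_cnj_iff of_real_Re zero_less_Suc)
  define A3 where "A3 = mat m m (\<lambda>(i,j). A' $$ (Suc i, Suc j))"
  have A3: "A3 \<in> carrier_mat m m" by (simp add: A3_def)
  have "dag A3 = A3"
  proof (rule eq_matI)
    fix i j assume "i < dim_row A3" "j < dim_col A3"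
    then have ij: "i < m" "j < m" using A3 by auto
    then show "dag A3 $$ (i,j) = A3 $$ (i,j)"
      using sym[of "Suc i" "Suc j"] dag_entry[OF A3, of i j] by (simp add: A3_def)
  qed (use A3 in \<open>auto simp: dag_def\<close>)
  from Suc.IH[OF A3 this] obtain U3 lam3 where U3: "unitary m U3"
    and dec: "A3 = U3 * mat_diag m (\<lambda>i. complex_of_real (lam3 i)) * dag U3" by blast
  have U3c: "U3 \<in> carrier_mat m m" and U3U: "dag U3 * U3 = 1\<^sub>m m" using U3 by (auto simp: unitary_def)
  \<comment> \<open>Block matrix with corner 1 and lower block \<open>U3\<close>, hence the shift of
    indices by one, also in \<open>lam\<close>.\<close>
  define U' where "U' = mat ?n ?n (\<lambda>(i,j). if i = 0 \<or> j = 0 then (if i = j then 1 else 0) else U3 $$ (i - 1, j - 1))"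
  define lam where "lam i = (if i = 0 then Re e else lam3 (i - 1))" for i
  have U'c: "U' \<in> carrier_mat ?n ?n" by (simp add: U'_def)
  have U'00: "U' $$ (0,0) = 1" and U'0S: "\<And>j. j < m \<Longrightarrow> U' $$ (0,Suc j) = 0"
    and U'S0: "\<And>i. i < m \<Longrightarrow> U' $$ (Suc i,0) = 0"
    and U'SS: "\<And>i j. i < m \<Longrightarrow> j < m \<Longrightarrow> U' $$ (Suc i,Suc j) = U3 $$ (i,j)"
    by (auto simp: U'_def)
  have U3orth: "(\<Sum>k<m. cnj (U3 $$ (k,i)) * U3 $$ (k,j)) = (if i = j then 1 else 0)" if "i < m" "j < m" for i j
  proof -
    have "(dag U3 * U3) $$ (i,j) = (\<Sum>k<m. cnj (U3 $$ (k,i)) * U3 $$ (k,j))"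
      using that U3c by (subst mat_mult_entry[of _ m m _ m]) (auto simp: dag_entry[OF U3c])
    then show ?thesis unfolding U3U using that by simp
  qed
  have "dag U' * U' = 1\<^sub>m ?n"
  proof (rule eq_matI)
    fix i j assume "i < dim_row (1\<^sub>m ?n)" "j < dim_col (1\<^sub>m ?n)"
    then have ij: "i < ?n" "j < ?n" by auto
    have "(dag U' * U') $$ (i,j) = (\<Sum>k<?n. cnj (U' $$ (k,i)) * U' $$ (k,j))"
      using ij U'c by (subst mat_mult_entry[of _ ?n ?n _ ?n]) (auto simp: dag_entry[OF U'c])
    also have "\<dots> = (if i = j then 1 else 0)"
      using ij by (cases i; cases j) (simp_all add: sum.lessThan_Suc_shift del: sum.lessThan_Suc cong: sum.cong_simp add: U'00 U'0S U'S0 U'SS U3orth)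
    finally show "(dag U' * U') $$ (i,j) = 1\<^sub>m ?n $$ (i,j)" using ij by simp
  qed (use U'c in \<open>auto simp: dag_def\<close>)
  then have U'u: "unitary ?n U'" using U'c by (simp add: unitary_def)
  let ?D = "mat_diag ?n (\<lambda>i. complex_of_real (lam i))"
  have D: "?D \<in> carrier_mat ?n ?n" by simp
  have UDU: "(U * mat_diag k f * dag U) $$ (i,j) = (\<Sum>l<k. U $$ (i,l) * f l * cnj (U $$ (j,l)))"
    if "U \<in> carrier_mat k k" "i < k" "j < k" for U k f i j
    using that by (subst mat_mult_entry[of _ k k _ k])
      (auto simp: mat_diag_mult_right[OF that(1)] dag_entry[OF that(1)])
  have A'dec: "A' = U' * ?D * dag U'"
  proof (rule eq_matI)
    fix i j assume "i < dim_row (U' * ?D * dag U')" "j < dim_col (U' * ?D * dag U')"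
    then have ij: "i < ?n" "j < ?n" using U'c by (auto simp: dag_def)
    have 3: "A' $$ (Suc i, Suc j) = (\<Sum>l<m. U3 $$ (i,l) * complex_of_real (lam3 l) * cnj (U3 $$ (j,l)))"
      if "i < m" "j < m" for i j
      using UDU[OF U3c that, of "\<lambda>i. complex_of_real (lam3 i)"] that unfolding dec[symmetric] by (simp add: A3_def)
    have row0: "A' $$ (0, Suc j) = 0" if "j < m" for j using sym[of 0 "Suc j"] A'0[of "Suc j"] that by simp
    have A'0S: "A' $$ (Suc i, 0) = 0" if "i < m" for i using A'0[of "Suc i"] that by simp
    have col00: "A' $$ (0,0) = complex_of_real (Re e)" using A'0[of 0] e by simp
    show "A' $$ (i,j) = (U' * ?D * dag U') $$ (i,j)"
      unfolding UDU[OF U'c ij] using ij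
      by (cases i; cases j) (simp_all add: sum.lessThan_Suc_shift del: sum.lessThan_Suc cong: sum.cong_simp add: U'00 U'0S U'S0 U'SS 3 row0 col00 A'0S lam_def)
  qed (use A' U'c in \<open>auto simp: dag_def\<close>)
  have dU': "dag U' \<in> carrier_mat ?n ?n" using U'c by simp
  have "A = (W * dag W) * A * (W * dag W)" using A unfolding WW' by simp
  also have "\<dots> = W * A' * dag W"
  proof -
    have AW: "A * W \<in> carrier_mat ?n ?n" using A W by auto
    have "(W * dag W) * A * (W * dag W) = (W * (dag W * A)) * (W * dag W)"
      using W dW A by (simp add: assoc_mult_mat[of W ?n ?n "dag W" ?n A ?n])
    also have "\<dots> = (W * (dag W * A)) * W * dag W"
      by (rule assoc_mult_mat[symmetric, of _ ?n ?n _ ?n _ ?n]; intro mult_carrier_mat[of _ ?n ?n _ ?n] W dW A U'c dU' D)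
    also have "(W * (dag W * A)) * W = W * ((dag W * A) * W)"
      by (rule assoc_mult_mat[of _ ?n ?n _ ?n _ ?n]; intro mult_carrier_mat[of _ ?n ?n _ ?n] W dW A U'c dU' D)
    also have "(dag W * A) * W = A'"
      unfolding A'_def by (rule assoc_mult_mat[of _ ?n ?n _ ?n _ ?n]; intro mult_carrier_mat[of _ ?n ?n _ ?n] W dW A U'c dU' D)
    finally show ?thesis .
  qed
  also have "\<dots> = (W * U') * ?D * dag (W * U')"
  proof -
    have "W * A' * dag W = W * (U' * (?D * dag U')) * dag W"
      unfolding A'dec using U'c D dU' by (simp add: assoc_mult_mat[of U' ?n ?n ?D ?n "dag U'" ?n])
    also have "W * (U' * (?D * dag U')) = (W * U') * (?D * dag U')"
      by (rule assoc_mult_mat[symmetric, of _ ?n ?n _ ?n _ ?n]; intro mult_carrier_mat[of _ ?n ?n _ ?n] W dW A U'c dU' D)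
    also have "\<dots> = (W * U') * ?D * dag U'"
      by (rule assoc_mult_mat[symmetric, of _ ?n ?n _ ?n _ ?n]; intro mult_carrier_mat[of _ ?n ?n _ ?n] W dW A U'c dU' D)
    also have "\<dots> * dag W = (W * U') * ?D * (dag U' * dag W)"
      by (rule assoc_mult_mat[of _ ?n ?n _ ?n _ ?n]; intro mult_carrier_mat[of _ ?n ?n _ ?n] W dW A U'c dU' D)
    also have "dag U' * dag W = dag (W * U')" using W U'c by (intro dag_mult[symmetric]) auto
    finally show ?thesis .
  qed
  finally have dec': "A = (W * U') * ?D * dag (W * U')" .
  have "unitary ?n (W * U')"
  proof -
    have "dag (W * U') * (W * U') = dag U' * dag W * (W * U')" using W U'c by (simp add: dag_mult[of W ?n ?n U' ?n])
    also have "\<dots> = dag U' * (dag W * (W * U'))" by (rule assoc_mult_mat[of _ ?n ?n _ ?n _ ?n]; intro mult_carrier_mat[of _ ?n ?n _ ?n] W dW A U'c dU' D)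
    also have "dag W * (W * U') = dag W * W * U'" by (rule assoc_mult_mat[symmetric, of _ ?n ?n _ ?n _ ?n]; intro mult_carrier_mat[of _ ?n ?n _ ?n] W dW A U'c dU' D)
    also have "\<dots> = U'" unfolding WW using U'c by simp
    also have "dag U' * U' = 1\<^sub>m ?n" using U'u by (simp add: unitary_def)
    finally show ?thesis using W U'c by (simp add: unitary_def)
  qed
  then show ?case using dec' by blast
qed

section \<open>Mutual information in an eigenbasis\<close>

lemma UDU_entry:
  assumes U: "U \<in> carrier_mat k k" and ij: "i < k" "j < k"
  shows "(U * mat_diag k f * dag U) $$ (i,j) = (\<Sum>l<k. U $$ (i,l) * f l * cnj (U $$ (j,l)))"
  using assms by (subst mat_mult_entry[of _ k k _ k]) (auto simp: mat_diag_mult_right[OF U] dag_entry[OF U])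

lemma unitary_cols:
  assumes "unitary n U" "i < n" "j < n"
  shows "(\<Sum>k<n. cnj (U $$ (k,i)) * U $$ (k,j)) = (if i = j then 1 else 0)"
proof -
  have U: "U \<in> carrier_mat n n" and e: "dag U * U = 1\<^sub>m n" using assms by (auto simp: unitary_def)
  have "(dag U * U) $$ (i,j) = (\<Sum>k<n. cnj (U $$ (k,i)) * U $$ (k,j))"
    by (rule dag_mult_self_entry[OF U assms(2,3)])
  then show ?thesis unfolding e using assms by simp
qed

lemma unitary_rows:
  assumes "unitary n U" "i < n" "j < n"
  shows "(\<Sum>k<n. U $$ (i,k) * cnj (U $$ (j,k))) = (if i = j then 1 else 0)"
proof -
  have U: "U \<in> carrier_mat n n" using assms by (auto simp: unitary_def)
  have "(U * dag U) $$ (i,j) = (\<Sum>k<n. U $$ (i,k) * dag U $$ (k,j))"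
    using U assms by (intro mat_mult_entry) auto
  also have "\<dots> = (\<Sum>k<n. U $$ (i,k) * cnj (U $$ (j,k)))"
    using U assms by (intro sum.cong refl) (simp add: dag_entry[OF U])
  finally show ?thesis unfolding unitary_mult_dag[OF assms(1)] using assms by simp
qed

lemma spectral_eigenvector:
  assumes U: "unitary n U" and A: "A = U * mat_diag n (\<lambda>i. complex_of_real (lam i)) * dag U" and "i < n" "y < n"
  shows "(\<Sum>j<n. A $$ (i,j) * U $$ (j,y)) = complex_of_real (lam y) * U $$ (i,y)"
proof -
  have Uc: "U \<in> carrier_mat n n" using U by (simp add: unitary_def)
  have "(\<Sum>j<n. A $$ (i,j) * U $$ (j,y)) = (\<Sum>j<n. \<Sum>l<n. U $$ (i,l) * complex_of_real (lam l) * (cnj (U $$ (j,l)) * U $$ (j,y)))"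
    unfolding A using assms by (intro sum.cong refl) (simp add: UDU_entry[OF Uc] sum_distrib_right mult.assoc)
  also have "\<dots> = (\<Sum>l<n. \<Sum>j<n. U $$ (i,l) * complex_of_real (lam l) * (cnj (U $$ (j,l)) * U $$ (j,y)))"
    by (rule sum.swap)
  also have "\<dots> = (\<Sum>l<n. U $$ (i,l) * complex_of_real (lam l) * (if l = y then 1 else 0))"
    using assms by (intro sum.cong refl) (simp add: sum_distrib_left[symmetric] unitary_cols[OF U])
  also have "\<dots> = complex_of_real (lam y) * U $$ (i,y)"
    using assms by (simp add: if_distrib[of "\<lambda>a. _ * a"] cong: if_cong)
  finally show ?thesis .
qed

lemma spectral_sandwich:
  assumes U: "unitary n U" and A: "A = U * mat_diag n (\<lambda>i. complex_of_real (lam i)) * dag U" and xy: "x < n" "y < n"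
  shows "(\<Sum>i<n. \<Sum>j<n. cnj (U $$ (i,x)) * U $$ (j,y) * A $$ (i,j)) = (if x = y then complex_of_real (lam x) else 0)"
proof -
  have "(\<Sum>i<n. \<Sum>j<n. cnj (U $$ (i,x)) * U $$ (j,y) * A $$ (i,j)) = (\<Sum>i<n. cnj (U $$ (i,x)) * (\<Sum>j<n. A $$ (i,j) * U $$ (j,y)))"
    by (simp add: sum_distrib_left mult_ac)
  also have "\<dots> = (\<Sum>i<n. complex_of_real (lam y) * (cnj (U $$ (i,x)) * U $$ (i,y)))"
    using xy by (intro sum.cong refl) (simp add: spectral_eigenvector[OF U A])
  also have "\<dots> = complex_of_real (lam y) * (if x = y then 1 else 0)"
    unfolding sum_distrib_left[symmetric] unitary_cols[OF U xy] ..
  finally show ?thesis by simp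
qed

text \<open>The decomposition obtained is the one that the choice operator in \<open>mfun\<close>
  picks, so its independence of the choice never has to be proved.\<close>

lemma mfun_spectral:
  assumes "A \<in> carrier_mat n n" "dag A = A"
  shows "\<exists>U lam. unitary n U \<and> A = U * mat_diag n (\<lambda>i. complex_of_real (lam i)) * dag U \<and>
    mfun g n A = U * mat_diag n (\<lambda>i. complex_of_real (g (lam i))) * dag U"
proof -
  obtain U lam where "unitary n U" "A = U * mat_diag n (\<lambda>i. complex_of_real (lam i)) * dag U"
    using hermitian_spectral[OF assms] by blast
  then have "\<exists>B U lam. unitary n U \<and> A = U * mat_diag n (\<lambda>i. complex_of_real (lam i)) * dag U \<and>
       B = U * mat_diag n (\<lambda>i. complex_of_real (g (lam i))) * dag U" by blast
  then show ?thesis unfolding mfun_def by (rule someI_ex)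
qed

lemma mtrace_spectral:
  assumes R: "R \<in> carrier_mat n n" and U: "unitary n U"
  shows "mtrace (R * (U * mat_diag n g * dag U)) = (\<Sum>y<n. g y * (\<Sum>i<n. \<Sum>j<n. cnj (U $$ (i,y)) * U $$ (j,y) * R $$ (i,j)))"
proof -
  have Uc: "U \<in> carrier_mat n n" using U by (simp add: unitary_def)
  have B: "U * mat_diag n g * dag U \<in> carrier_mat n n" using Uc by (intro mult_carrier_mat[of _ n n _ n]) auto
  have "mtrace (R * (U * mat_diag n g * dag U)) = (\<Sum>i<n. \<Sum>j<n. R $$ (i,j) * (U * mat_diag n g * dag U) $$ (j,i))"
    using R B unfolding mtrace_def by (intro sum.cong mat_mult_entry) auto
  also have "\<dots> = (\<Sum>i<n. \<Sum>j<n. \<Sum>y<n. g y * (cnj (U $$ (i,y)) * U $$ (j,y) * R $$ (i,j)))"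
    by (intro sum.cong refl) (simp add: UDU_entry[OF Uc] sum_distrib_left mult_ac)
  also have "\<dots> = (\<Sum>i<n. \<Sum>y<n. \<Sum>j<n. g y * (cnj (U $$ (i,y)) * U $$ (j,y) * R $$ (i,j)))"
    by (rule sum.cong[OF refl], rule sum.swap)
  also have "\<dots> = (\<Sum>y<n. \<Sum>i<n. \<Sum>j<n. g y * (cnj (U $$ (i,y)) * U $$ (j,y) * R $$ (i,j)))"
    by (rule sum.swap)
  finally show ?thesis unfolding sum_distrib_left .
qed

lemma mtrace_mult_minus:
  assumes "R \<in> carrier_mat n n" "P \<in> carrier_mat n n" "Q \<in> carrier_mat n n"
  shows "mtrace (R * (P - Q)) = mtrace (R * P) - mtrace (R * Q)"
  using assms by (simp add: mult_minus_distrib_mat[of R n n P n Q] mtrace_def sum_subtractf)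

lemma conj_proj_entry:
  assumes M: "M \<in> carrier_mat m k" and \<theta>: "\<theta> \<in> carrier_vec k" and ij: "i < m" "j < m"
  shows "(M * proj \<theta> * dag M) $$ (i,j) = (\<Sum>l<k. M $$ (i,l) * \<theta> $ l) * cnj (\<Sum>l<k. M $$ (j,l) * \<theta> $ l)"
proof -
  have P: "proj \<theta> \<in> carrier_mat k k" using \<theta> by (auto simp: proj_def)
  have MP: "(M * proj \<theta>) $$ (i,l') = (\<Sum>l<k. M $$ (i,l) * \<theta> $ l) * cnj (\<theta> $ l')" if "l' < k" for l'
  proof -
    have "(M * proj \<theta>) $$ (i,l') = (\<Sum>l<k. M $$ (i,l) * proj \<theta> $$ (l,l'))"
      using M P ij that by (intro mat_mult_entry) auto
    also have "\<dots> = (\<Sum>l<k. M $$ (i,l) * \<theta> $ l * cnj (\<theta> $ l'))"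
      using \<theta> that by (intro sum.cong refl) (auto simp: proj_def)
    finally show ?thesis by (simp add: sum_distrib_right)
  qed
  have "(M * proj \<theta> * dag M) $$ (i,j) = (\<Sum>l'<k. (M * proj \<theta>) $$ (i,l') * dag M $$ (l',j))"
    using M P ij by (intro mat_mult_entry[of _ m k _ m]) auto
  also have "\<dots> = (\<Sum>l'<k. (\<Sum>l<k. M $$ (i,l) * \<theta> $ l) * cnj (M $$ (j,l') * \<theta> $ l'))"
    using M ij by (intro sum.cong refl) (simp add: MP dag_entry[OF M] mult_ac del: index_mult_mat)
  finally show ?thesis by (simp add: sum_distrib_left)
qed

text \<open>The entries of \<open>kron K (1\<^sub>m e)\<close> applied to \<open>\<theta>\<close>
  are \<open>w K\<close>, so the output is a sum of rank-one matrices.\<close>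

lemma apply_tensor_proj:
  assumes K: "\<forall>K\<in>set Ks. K \<in> carrier_mat d a" and \<theta>: "\<theta> \<in> carrier_vec (a * e)"
  defines "w \<equiv> \<lambda>K i. \<Sum>x<a. K $$ (i div e, x) * \<theta> $ (x * e + i mod e)"
  shows "apply_channel (d * e) (tensor_id e Ks) (proj \<theta>) \<in> carrier_mat (d * e) (d * e)"
    and "i < d * e \<Longrightarrow> j < d * e \<Longrightarrow>
      apply_channel (d * e) (tensor_id e Ks) (proj \<theta>) $$ (i,j) = (\<Sum>K\<leftarrow>Ks. w K i * cnj (w K j))"
proof -
  have P: "proj \<theta> \<in> carrier_mat (a * e) (a * e)" using \<theta> by (auto simp: proj_def)
  have M: "kron K (1\<^sub>m e) \<in> carrier_mat (d * e) (a * e)" if "K \<in> set Ks" for K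
    using K that by (intro kron_carrier) auto
  have c: "M * proj \<theta> * dag M \<in> carrier_mat (d * e) (d * e)" if "M \<in> set (tensor_id e Ks)" for M
    using that M P by (auto simp: tensor_id_def intro!: mult_carrier_mat[of _ _ "a * e"])
  show "apply_channel (d * e) (tensor_id e Ks) (proj \<theta>) \<in> carrier_mat (d * e) (d * e)"
    unfolding apply_channel_def by (rule foldr_mat_carrier) (rule c)
  assume i: "i < d * e" and j: "j < d * e"
  have e: "e > 0" using i by (cases e) auto
  have kw: "(\<Sum>l<a * e. kron K (1\<^sub>m e) $$ (i,l) * \<theta> $ l) = w K i" if Kin: "K \<in> set Ks" and i: "i < d * e" for K i
  proof -
    have Kc: "K \<in> carrier_mat d a" using K Kin by auto
    have di: "i div e < d" "i mod e < e" using i e by (auto simp: less_mult_imp_div_less)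
    have "(\<Sum>l<a * e. kron K (1\<^sub>m e) $$ (i,l) * \<theta> $ l) = (\<Sum>x<a. \<Sum>y<e. kron K (1\<^sub>m e) $$ ((i div e) * e + i mod e, x * e + y) * \<theta> $ (x * e + y))"
      unfolding sum_lessThan_mult by simp
    also have "\<dots> = (\<Sum>x<a. \<Sum>y<e. if i mod e = y then K $$ (i div e, x) * \<theta> $ (x * e + y) else 0)"
      using di by (intro sum.cong refl) (simp only: kron_entry[OF Kc one_carrier_mat di] lessThan_iff, simp)
    also have "\<dots> = w K i" using di by (simp add: w_def)
    finally show ?thesis .
  qed
  have "apply_channel (d * e) (tensor_id e Ks) (proj \<theta>) $$ (i,j) = (\<Sum>M\<leftarrow>tensor_id e Ks. (M * proj \<theta> * dag M) $$ (i,j))"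
    unfolding apply_channel_def by (rule foldr_mat_entry[OF c i j])
  also have "\<dots> = (\<Sum>K\<leftarrow>Ks. (kron K (1\<^sub>m e) * proj \<theta> * dag (kron K (1\<^sub>m e))) $$ (i,j))"
    by (simp add: tensor_id_def o_def)
  also have "\<dots> = (\<Sum>K\<leftarrow>Ks. w K i * cnj (w K j))"
    using i j by (intro arg_cong[of _ _ sum_list] map_cong refl) (simp only: conj_proj_entry[OF M \<theta> i j] kw)
  finally show "apply_channel (d * e) (tensor_id e Ks) (proj \<theta>) $$ (i,j) = (\<Sum>K\<leftarrow>Ks. w K i * cnj (w K j))" .
qed

lemma sum_pairs_flat:
  fixes g :: "nat \<times> nat \<Rightarrow> 'a :: comm_monoid_add"
  shows "(\<Sum>z\<in>{..<m} \<times> {..<k}. g z) = (\<Sum>i<m * k. g (i div k, i mod k))"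
proof -
  have "(\<Sum>i<m * k. g (i div k, i mod k)) = (\<Sum>x<m. \<Sum>y<k. g ((x * k + y) div k, (x * k + y) mod k))"
    by (rule sum_lessThan_mult)
  also have "\<dots> = (\<Sum>x<m. \<Sum>y<k. g (x, y))"
    by (intro sum.cong refl) auto
  finally show ?thesis by (simp add: sum_Times)
qed

text \<open>\<open>X M\<close> is nilpotent, hence traceless; the spectral decomposition of \<open>X\<^sup>\<dagger> X\<close> makes this elementary.\<close>

lemma trace_zero_if_sandwich_zero:
  fixes X M :: "nat \<Rightarrow> nat \<Rightarrow> complex"
  assumes z: "\<And>a c. a < d \<Longrightarrow> c < d \<Longrightarrow> (\<Sum>i<d. \<Sum>j<d. X a i * M i j * X j c) = 0"
  shows "(\<Sum>a<d. \<Sum>c<d. X a c * M c a) = 0"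
proof -
  define H where "H = mat d d (\<lambda>(i,j). \<Sum>a<d. cnj (X a i) * X a j)"
  have H: "H \<in> carrier_mat d d" by (simp add: H_def)
  have "dag H = H" by (rule eq_matI) (auto simp: H_def dag_def mult.commute)
  then obtain U lam where U: "unitary d U" and dec: "H = U * mat_diag d (\<lambda>i. complex_of_real (lam i)) * dag U"
    using hermitian_spectral[OF H] by blast
  define Xu where "Xu j a = (\<Sum>c<d. X a c * U $$ (c,j))" for j a
  \<comment> \<open>The diagonal entry of \<open>M X\<close> at eigenvector \<open>j\<close> of
    \<open>H\<close>. These entries add up to the trace of \<open>M X\<close>, which is that of
    \<open>X M\<close>, so it suffices that each vanishes.\<close>
  define T where "T j = (\<Sum>c<d. \<Sum>a<d. cnj (U $$ (c,j)) * M c a * Xu j a)" for j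
  have Hu: "(\<Sum>a<d. cnj (X a c) * Xu j a) = complex_of_real (lam j) * U $$ (c,j)" if "j < d" "c < d" for j c
  proof -
    have "(\<Sum>a<d. cnj (X a c) * Xu j a) = (\<Sum>a<d. \<Sum>c'<d. cnj (X a c) * X a c' * U $$ (c',j))"
      by (simp add: Xu_def sum_distrib_left mult.assoc)
    also have "\<dots> = (\<Sum>c'<d. \<Sum>a<d. cnj (X a c) * X a c' * U $$ (c',j))" by (rule sum.swap)
    also have "\<dots> = (\<Sum>c'<d. H $$ (c,c') * U $$ (c',j))"
      using that by (intro sum.cong refl) (simp add: H_def sum_distrib_right)
    also have "\<dots> = complex_of_real (lam j) * U $$ (c,j)"
      using that by (intro spectral_eigenvector[OF U dec])
    finally show ?thesis .
  qed
  have T0: "T j = 0" if j: "j < d" for j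
  proof (cases "lam j = 0")
    \<comment> \<open>The squared norm of \<open>Xu j\<close> is the quadratic form of
      \<open>H\<close> at an eigenvector with eigenvalue 0, so \<open>X\<close> annihilates this
      eigenvector.\<close>
    case True
    have "complex_of_real (\<Sum>a<d. (cmod (Xu j a))\<^sup>2) = (\<Sum>a<d. \<Sum>c<d. cnj (U $$ (c,j)) * (cnj (X a c) * Xu j a))"
      unfolding of_real_sum
    proof (intro sum.cong refl)
      fix a
      have "complex_of_real ((cmod (Xu j a))\<^sup>2) = cnj (Xu j a) * Xu j a" by (metis complex_norm_square mult.commute)
      also have "\<dots> = (\<Sum>c<d. cnj (U $$ (c,j)) * (cnj (X a c) * Xu j a))"
        unfolding Xu_def[of j a] cnj_sum sum_distrib_right by (intro sum.cong refl) (simp add: mult_ac)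
      finally show "complex_of_real ((cmod (Xu j a))\<^sup>2) = (\<Sum>c<d. cnj (U $$ (c,j)) * (cnj (X a c) * Xu j a))" .
    qed
    also have "\<dots> = (\<Sum>c<d. \<Sum>a<d. cnj (U $$ (c,j)) * (cnj (X a c) * Xu j a))" by (rule sum.swap)
    also have "\<dots> = 0" unfolding sum_distrib_left[symmetric] using Hu[OF j] True by simp
    finally have "(\<Sum>a<d. (cmod (Xu j a))\<^sup>2) = 0" by (metis of_real_eq_0_iff)
    then have "Xu j a = 0" if "a < d" for a using that by (simp add: sum_nonneg_eq_0_iff)
    then show ?thesis unfolding T_def by simp
  next
    case False
    \<comment> \<open>The eigenvector times \<open>lam j\<close> is its image under
      \<open>H = X^\<dagger> X\<close>; this substitution creates the product \<open>X M X\<close>,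
      which vanishes by \<open>z\<close>.\<close>
    have "complex_of_real (lam j) * T j = (\<Sum>c<d. \<Sum>a<d. cnj (complex_of_real (lam j) * U $$ (c,j)) * M c a * Xu j a)"
      by (simp add: T_def sum_distrib_left mult.assoc)
    also have "\<dots> = (\<Sum>c<d. \<Sum>a<d. \<Sum>a'<d. \<Sum>c'<d. cnj (Xu j a') * U $$ (c',j) * (X a' c * M c a * X a c'))"
    proof (rule sum.cong[OF refl], rule sum.cong[OF refl])
      fix c a assume "c \<in> {..<d}"
      then have e: "cnj (complex_of_real (lam j) * U $$ (c,j)) = (\<Sum>a'<d. X a' c * cnj (Xu j a'))"
        using Hu[OF j, of c, symmetric] by (simp only: lessThan_iff cnj_sum complex_cnj_mult complex_cnj_cnj)
      have "(\<Sum>a'<d. X a' c * cnj (Xu j a')) * M c a * Xu j a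
        = (\<Sum>a'<d. X a' c * cnj (Xu j a') * M c a) * (\<Sum>c'<d. X a c' * U $$ (c',j))"
        by (simp add: sum_distrib_right Xu_def[of j a])
      also have "\<dots> = (\<Sum>a'<d. \<Sum>c'<d. cnj (Xu j a') * U $$ (c',j) * (X a' c * M c a * X a c'))"
        unfolding sum_product by (intro sum.cong refl) (simp add: mult_ac)
      finally show "cnj (complex_of_real (lam j) * U $$ (c,j)) * M c a * Xu j a
        = (\<Sum>a'<d. \<Sum>c'<d. cnj (Xu j a') * U $$ (c',j) * (X a' c * M c a * X a c'))"
        unfolding e .
    qed
    also have "\<dots> = (\<Sum>p\<in>{..<d} \<times> {..<d}. \<Sum>r\<in>{..<d} \<times> {..<d}. cnj (Xu j (fst r)) * U $$ (snd r,j) * (X (fst r) (fst p) * M (fst p) (snd p) * X (snd p) (snd r)))"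
      by (simp add: sum_Times)
    also have "\<dots> = (\<Sum>r\<in>{..<d} \<times> {..<d}. \<Sum>p\<in>{..<d} \<times> {..<d}. cnj (Xu j (fst r)) * U $$ (snd r,j) * (X (fst r) (fst p) * M (fst p) (snd p) * X (snd p) (snd r)))"
      by (rule sum.swap)
    also have "\<dots> = 0"
    proof (rule sum.neutral, rule ballI)
      fix r assume "r \<in> {..<d} \<times> {..<d}"
      then have "(\<Sum>p\<in>{..<d} \<times> {..<d}. X (fst r) (fst p) * M (fst p) (snd p) * X (snd p) (snd r)) = 0"
        using z[of "fst r" "snd r"] by (auto simp: sum_Times)
      then show "(\<Sum>p\<in>{..<d} \<times> {..<d}. cnj (Xu j (fst r)) * U $$ (snd r,j) * (X (fst r) (fst p) * M (fst p) (snd p) * X (snd p) (snd r))) = 0"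
        unfolding sum_distrib_left[symmetric] by simp
    qed
    finally show ?thesis using False by simp
  qed
  have "(\<Sum>a<d. \<Sum>c<d. X a c * M c a) = (\<Sum>a<d. \<Sum>c<d. \<Sum>c'<d. M c a * X a c' * (if c' = c then 1 else 0))"
  proof (rule sum.cong[OF refl], rule sum.cong[OF refl])
    fix a c assume "c \<in> {..<d}"
    then show "X a c * M c a = (\<Sum>c'<d. M c a * X a c' * (if c' = c then 1 else 0))"
      by (simp add: if_distrib[of "\<lambda>a. _ * a"] cong: if_cong)
  qed
  also have "\<dots> = (\<Sum>a<d. \<Sum>c<d. \<Sum>c'<d. M c a * X a c' * (\<Sum>j<d. U $$ (c',j) * cnj (U $$ (c,j))))"
    by (intro sum.cong refl) (simp only: lessThan_iff unitary_rows[OF U])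
  also have "\<dots> = (\<Sum>a<d. \<Sum>c<d. \<Sum>c'<d. \<Sum>j<d. cnj (U $$ (c,j)) * M c a * (X a c' * U $$ (c',j)))"
    by (simp add: sum_distrib_left mult_ac)
  also have "\<dots> = (\<Sum>a<d. \<Sum>c<d. \<Sum>j<d. \<Sum>c'<d. cnj (U $$ (c,j)) * M c a * (X a c' * U $$ (c',j)))"
    by (rule sum.cong[OF refl], rule sum.cong[OF refl], rule sum.swap)
  also have "\<dots> = (\<Sum>a<d. \<Sum>c<d. \<Sum>j<d. cnj (U $$ (c,j)) * M c a * Xu j a)"
    by (simp add: Xu_def sum_distrib_left)
  also have "\<dots> = (\<Sum>p\<in>{..<d} \<times> {..<d}. \<Sum>j<d. cnj (U $$ (snd p,j)) * M (snd p) (fst p) * Xu j (fst p))"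
    by (simp add: sum_Times)
  also have "\<dots> = (\<Sum>j<d. \<Sum>p\<in>{..<d} \<times> {..<d}. cnj (U $$ (snd p,j)) * M (snd p) (fst p) * Xu j (fst p))"
    by (rule sum.swap)
  also have "\<dots> = (\<Sum>j<d. T j)"
    unfolding T_def sum_Times fst_conv snd_conv by (rule sum.cong[OF refl], rule sum.swap)
  also have "\<dots> = 0" using T0 by simp
  finally show ?thesis .
qed

text \<open>In matrix form, with \<open>X\<close> the transpose of \<open>\<psi>\<close> and
  \<open>M\<close> built from \<open>K\<close> and \<open>v\<close>, the hypothesis reads
  \<open>X M X = 0\<close> and the conclusion is that \<open>X M\<close> has trace zero. It yields
  that the output is supported in the product of its marginals.\<close>

lemma output_support:
  assumes sup: "\<And>a c. a < dA \<Longrightarrow> c < dA \<Longrightarrow>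
    ip ({..<dB} \<times> {..<dA}) v (\<lambda>(b,a'). chan_out dA \<psi> K (b,a) * \<psi> c a') = 0"
  shows "ip ({..<dB} \<times> {..<dA}) v (chan_out dA \<psi> K) = 0"
proof -
  define M where "M c a = (\<Sum>b<dB. K $$ (b,c) * cnj (v (b,a)))" for c a
  have "(\<Sum>a<dA. \<Sum>c<dA. \<psi> c a * M c a) = 0"
  proof (rule trace_zero_if_sandwich_zero)
    fix a c assume ac: "a < dA" "c < dA"
    have "0 = (\<Sum>b<dB. \<Sum>j<dA. \<Sum>i<dA. \<psi> i a * (K $$ (b,i) * cnj (v (b,j))) * \<psi> c j)"
      using sup[OF ac] by (simp add: ip_def sum_Times chan_out_def sum_distrib_left sum_distrib_right mult_ac)
    also have "\<dots> = (\<Sum>b<dB. \<Sum>i<dA. \<Sum>j<dA. \<psi> i a * (K $$ (b,i) * cnj (v (b,j))) * \<psi> c j)"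
      by (rule sum.cong[OF refl], rule sum.swap)
    also have "\<dots> = (\<Sum>i<dA. \<Sum>b<dB. \<Sum>j<dA. \<psi> i a * (K $$ (b,i) * cnj (v (b,j))) * \<psi> c j)"
      by (rule sum.swap)
    also have "\<dots> = (\<Sum>i<dA. \<Sum>j<dA. \<Sum>b<dB. \<psi> i a * (K $$ (b,i) * cnj (v (b,j))) * \<psi> c j)"
      by (rule sum.cong[OF refl], rule sum.swap)
    also have "\<dots> = (\<Sum>i<dA. \<Sum>j<dA. \<psi> i a * M i j * \<psi> c j)"
      by (simp add: M_def sum_distrib_left sum_distrib_right)
    finally show "(\<Sum>i<dA. \<Sum>j<dA. \<psi> i a * M i j * \<psi> c j) = 0" by simp
  qed
  also have "(\<Sum>a<dA. \<Sum>c<dA. \<psi> c a * M c a) = (\<Sum>a<dA. \<Sum>c<dA. \<Sum>b<dB. cnj (v (b,a)) * (K $$ (b,c) * \<psi> c a))"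
    by (simp add: M_def sum_distrib_left mult_ac)
  also have "\<dots> = (\<Sum>a<dA. \<Sum>b<dB. \<Sum>c<dA. cnj (v (b,a)) * (K $$ (b,c) * \<psi> c a))"
    by (rule sum.cong[OF refl], rule sum.swap)
  also have "\<dots> = (\<Sum>b<dB. \<Sum>a<dA. \<Sum>c<dA. cnj (v (b,a)) * (K $$ (b,c) * \<psi> c a))"
    by (rule sum.swap)
  also have "\<dots> = ip ({..<dB} \<times> {..<dA}) v (chan_out dA \<psi> K)"
    by (simp add: ip_def sum_Times chan_out_def sum_distrib_left)
  finally show ?thesis .
qed

lemma gram_flat:
  assumes A: "\<And>i i'. i < m * k \<Longrightarrow> i' < m * k \<Longrightarrow>
    A $$ (i,i') = (\<Sum>j\<in>S. \<xi> j (i div k, i mod k) * cnj (\<xi> j (i' div k, i' mod k)))"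
  shows "(\<Sum>j\<in>S. ip ({..<m} \<times> {..<k}) (\<lambda>(b,a). g (b * k + a)) (\<xi> j) * cnj (ip ({..<m} \<times> {..<k}) (\<lambda>(b,a). g' (b * k + a)) (\<xi> j)))
    = (\<Sum>i<m * k. \<Sum>i'<m * k. cnj (g i) * g' i' * A $$ (i,i'))"
  unfolding gram_kernel sum_pairs_flat by (intro sum.cong refl) (simp add: A)

lemma unitary_orthonormal:
  assumes "unitary (m * k) U"
  shows "orthonormal_on ({..<m} \<times> {..<k}) {..<m * k} (\<lambda>x (b,a). U $$ (b * k + a, x))"
  using unitary_cols[OF assms] by (simp add: orthonormal_on_def ip_def sum_pairs_flat)

lemma unitary_parseval:
  assumes U: "unitary (m * k) U"
  shows "(\<Sum>x<m * k. prb ({..<m} \<times> {..<k}) (\<lambda>(b,a). U $$ (b * k + a, x)) v) = nsq ({..<m} \<times> {..<k}) v"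
proof -
  \<comment> \<open>Parseval is the isometry property of a single operator, the adjoint of
    \<open>U\<close>.\<close>
  have "(\<Sum>l\<in>{0::nat}. nsq {..<m * k} (\<lambda>x. \<Sum>i<m * k. cnj (U $$ (i,x)) * v (i div k, i mod k)))
    = nsq {..<m * k} (\<lambda>i. v (i div k, i mod k))"
    by (rule isometry_nsq) (simp_all add: unitary_rows[OF U])
  then show ?thesis by (simp add: nsq_def ip_def sum_pairs_flat)
qed

text \<open>The output and the product of its marginals are Gram matrices, hence Hermitian, and
  their spectral decompositions supply \<open>e\<close>, \<open>f\<close> and \<open>q\<close>. The
  inclusion of supports excludes the infinite branch of \<open>rel_entropy\<close>, so the mutual
  information equals \<open>info\<close>.\<close>

lemma mutual_info_single_letter:
  fixes dA dB :: nat and \<theta> :: cvec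
  assumes dA: "dA \<ge> 1" and dB: "dB \<ge> 1" and chan: "is_channel dA dB Ks" and unit: "unit_vec_c (dA * dA) \<theta>"
    and c: "ereal c < mutual_info dB dA (apply_channel (dB * dA) (tensor_id dA Ks) (proj \<theta>))"
  defines "\<psi> \<equiv> \<lambda>x y. \<theta> $ (x * dA + y)"
  shows "\<exists>e f q. single_letter dA dB (dB * dA) Ks \<psi> e f q \<and> c < single_letter.info dA dB (dB * dA) Ks \<psi> e f q"
proof -
  define N where "N = dB * dA"
  define \<rho> where "\<rho> = apply_channel N (tensor_id dA Ks) (proj \<theta>)"
  let ?Z = "{..<dB} \<times> {..<dA}"
  let ?o = "chan_out dA \<psi>"
  let ?p = "\<lambda>i. (i div dA, i mod dA)"
  have K: "\<forall>K\<in>set Ks. K \<in> carrier_mat dB dA" and tp: "tp_entries dA dB Ks"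
    using chan by (auto simp: is_channel_iff)
  have \<theta>: "\<theta> \<in> carrier_vec (dA * dA)" and \<theta>1: "(\<Sum>i<dA * dA. (cmod (\<theta> $ i))\<^sup>2) = 1"
    using unit by (auto simp: unit_vec_c_def)
  have unit': "(\<Sum>x<dA. \<Sum>y<dA. (cmod (\<psi> x y))\<^sup>2) = 1"
    using \<theta>1 unfolding sum_lessThan_mult \<psi>_def .
  have \<rho>c: "\<rho> \<in> carrier_mat N N"
    unfolding \<rho>_def N_def by (rule apply_tensor_proj(1)[OF K \<theta>])
  have \<rho>e: "\<rho> $$ (i,j) = (\<Sum>l<length Ks. ?o (Ks ! l) (?p i) * cnj (?o (Ks ! l) (?p j)))" if "i < N" "j < N" for i j
    using apply_tensor_proj(2)[OF K \<theta>, of i j] that unfolding \<rho>_def N_def sum_list_lessThan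
    by (simp add: chan_out_def \<psi>_def)
  have \<rho>p: "\<rho> $$ (b * dA + a, b' * dA + a') = (\<Sum>l<length Ks. ?o (Ks ! l) (b,a) * cnj (?o (Ks ! l) (b',a')))"
    if "b < dB" "a < dA" "b' < dB" "a' < dA" for b a b' a'
  proof -
    have "b * dA + a < N" "b' * dA + a' < N" using that by (simp_all add: N_def mult_add_less)
    from \<rho>e[OF this] show ?thesis using that by simp
  qed
  define \<sigma> where "\<sigma> = kron (ptrace_second dB dA \<rho>) (ptrace_first dB dA \<rho>)"
  have pc: "ptrace_second dB dA \<rho> \<in> carrier_mat dB dB" "ptrace_first dB dA \<rho> \<in> carrier_mat dA dA"
    by (auto simp: ptrace_second_def ptrace_first_def)
  have \<sigma>c: "\<sigma> \<in> carrier_mat N N" unfolding \<sigma>_def N_def by (intro kron_carrier pc)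
  let ?S = "{..<length Ks} \<times> {..<dA} \<times> {..<dA}"
  let ?\<xi> = "\<lambda>(l,a,c) (b,a'). ?o (Ks ! l) (b,a) * \<psi> c a'"
  have p2: "ptrace_second dB dA \<rho> $$ (b,b') = (\<Sum>l<length Ks. \<Sum>a<dA. ?o (Ks ! l) (b,a) * cnj (?o (Ks ! l) (b',a)))"
    if "b < dB" "b' < dB" for b b'
  proof -
    have "ptrace_second dB dA \<rho> $$ (b,b') = (\<Sum>a<dA. \<Sum>l<length Ks. ?o (Ks ! l) (b,a) * cnj (?o (Ks ! l) (b',a)))"
      using that by (simp add: ptrace_second_def \<rho>p)
    then show ?thesis by (subst sum.swap)
  qed
  \<comment> \<open>Tracing out \<open>B\<close> removes the channel, which is trace preserving:
    Bob's half keeps its original state.\<close>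
  have p1: "ptrace_first dB dA \<rho> $$ (a,a') = (\<Sum>c<dA. \<psi> c a * cnj (\<psi> c a'))" if "a < dA" "a' < dA" for a a'
  proof -
    have "(\<Sum>l<length Ks. ip {..<dB} (\<lambda>y. \<Sum>x<dA. (Ks ! l) $$ (y,x) * \<psi> x a') (\<lambda>y. \<Sum>x<dA. (Ks ! l) $$ (y,x) * \<psi> x a))
      = ip {..<dA} (\<lambda>x. \<psi> x a') (\<lambda>x. \<psi> x a)"
      using tp unfolding tp_entries_def sum_list_lessThan by (intro isometry_ip) auto
    moreover have "ptrace_first dB dA \<rho> $$ (a,a') = (\<Sum>b<dB. \<Sum>l<length Ks. ?o (Ks ! l) (b,a) * cnj (?o (Ks ! l) (b,a')))"
      using that by (simp add: ptrace_first_def \<rho>p)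
    moreover have "\<dots> = (\<Sum>l<length Ks. ip {..<dB} (\<lambda>y. \<Sum>x<dA. (Ks ! l) $$ (y,x) * \<psi> x a') (\<lambda>y. \<Sum>x<dA. (Ks ! l) $$ (y,x) * \<psi> x a))"
      by (subst sum.swap) (simp add: ip_def chan_out_def mult.commute)
    ultimately show ?thesis by (simp add: ip_def mult.commute)
  qed
  have \<sigma>e: "\<sigma> $$ (i,j) = (\<Sum>s\<in>?S. ?\<xi> s (?p i) * cnj (?\<xi> s (?p j)))" if ij: "i < N" "j < N" for i j
  proof -
    have d: "i div dA < dB" "i mod dA < dA" "j div dA < dB" "j mod dA < dA"
      using ij dA by (auto simp: N_def less_mult_imp_div_less)
    have "\<sigma> $$ (i,j) = \<sigma> $$ (i div dA * dA + i mod dA, j div dA * dA + j mod dA)" by simp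
    also have "\<dots> = ptrace_second dB dA \<rho> $$ (i div dA, j div dA) * ptrace_first dB dA \<rho> $$ (i mod dA, j mod dA)"
      unfolding \<sigma>_def by (rule kron_entry[OF pc d(1,2,3,4)])
    also have "\<dots> = (\<Sum>s\<in>?S. ?\<xi> s (?p i) * cnj (?\<xi> s (?p j)))"
      unfolding p2[OF d(1,3)] p1[OF d(2,4)]
      by (simp add: sum_Times sum_distrib_left sum_distrib_right mult_ac)
    finally show ?thesis .
  qed
  have herm: "dag A = A" if "A \<in> carrier_mat N N" "\<And>i j. i < N \<Longrightarrow> j < N \<Longrightarrow> A $$ (i,j) = (\<Sum>s\<in>S. x s i * cnj (x s j))"
    for A and x :: "'s \<Rightarrow> nat \<Rightarrow> complex" and S
  proof (rule eq_matI)
    fix i j assume "i < dim_row A" "j < dim_col A"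
    then have "i < N" "j < N" using that(1) by auto
    then show "dag A $$ (i,j) = A $$ (i,j)" using that by (simp add: dag_entry[OF that(1)] mult.commute)
  qed (use that(1) in \<open>auto simp: dag_def\<close>)
  have \<rho>h: "dag \<rho> = \<rho>" by (rule herm[OF \<rho>c \<rho>e])
  have \<sigma>h: "dag \<sigma> = \<sigma>" by (rule herm[OF \<sigma>c \<sigma>e])
  obtain U lam where U: "unitary N U" and \<rho>U: "\<rho> = U * mat_diag N (\<lambda>i. complex_of_real (lam i)) * dag U"
    and lU: "mlog N \<rho> = U * mat_diag N (\<lambda>i. complex_of_real (log 2 (lam i))) * dag U"
    using mfun_spectral[OF \<rho>c \<rho>h, of "log 2"] unfolding mlog_def by blast
  obtain V q where V: "unitary N V" and \<sigma>V: "\<sigma> = V * mat_diag N (\<lambda>i. complex_of_real (q i)) * dag V"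
    and lV: "mlog N \<sigma> = V * mat_diag N (\<lambda>i. complex_of_real (log 2 (q i))) * dag V"
    using mfun_spectral[OF \<sigma>c \<sigma>h, of "log 2"] unfolding mlog_def by blast
  define e where "e = (\<lambda>x (b,a). U $$ (b * dA + a, x))"
  define f where "f = (\<lambda>x (b,a). V $$ (b * dA + a, x))"
  have diag: "(\<Sum>s\<in>?S. ip ?Z (f y) (?\<xi> s) * cnj (ip ?Z (f y') (?\<xi> s))) = (if y = y' then complex_of_real (q y) else 0)"
    if "y < N" "y' < N" for y y'
  proof -
    have "(\<Sum>s\<in>?S. ip ?Z (f y) (?\<xi> s) * cnj (ip ?Z (f y') (?\<xi> s)))
      = (\<Sum>i<dB * dA. \<Sum>i'<dB * dA. cnj (V $$ (i,y)) * V $$ (i',y') * \<sigma> $$ (i,i'))"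
      unfolding f_def by (rule gram_flat) (rule \<sigma>e; simp add: N_def)
    also have "\<dots> = (if y = y' then complex_of_real (q y) else 0)"
      unfolding N_def[symmetric] by (rule spectral_sandwich[OF V \<sigma>V that])
    finally show ?thesis .
  qed
  have sl: "single_letter dA dB (dB * dA) Ks \<psi> e f q"
  proof
    show "dA > 0" "dB > 0" using dA dB by auto
    show "\<forall>K\<in>set Ks. K \<in> carrier_mat dB dA" "tp_entries dA dB Ks" by fact+
    show "(\<Sum>x<dA. \<Sum>y<dA. (cmod (\<psi> x y))\<^sup>2) = 1" by fact
    show "orthonormal_on ?Z {..<dB * dA} e" unfolding e_def using U unfolding N_def by (rule unitary_orthonormal)
    show "orthonormal_on ?Z {..<dB * dA} f" unfolding f_def using V unfolding N_def by (rule unitary_orthonormal)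
    show "(\<Sum>x<dB * dA. prb ?Z (e x) v) = nsq ?Z v" for v
      unfolding e_def using U unfolding N_def by (rule unitary_parseval)
    show "(\<Sum>x<dB * dA. prb ?Z (f x) v) = nsq ?Z v" for v
      unfolding f_def using V unfolding N_def by (rule unitary_parseval)
    show "0 \<le> q y" if "y < dB * dA" for y
    proof -
      have "complex_of_real (q y) = (\<Sum>s\<in>?S. ip ?Z (f y) (?\<xi> s) * cnj (ip ?Z (f y) (?\<xi> s)))"
        using diag[of y y] that by (simp add: N_def)
      also have "\<dots> = complex_of_real (\<Sum>s\<in>?S. prb ?Z (f y) (?\<xi> s))"
        unfolding of_real_sum by (intro sum.cong refl) (rule complex_norm_square[symmetric])
      finally have "q y = (\<Sum>s\<in>?S. prb ?Z (f y) (?\<xi> s))" unfolding of_real_eq_iff .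
      then show ?thesis by (simp add: sum_nonneg)
    qed
    show "(\<Sum>K\<leftarrow>Ks. \<Sum>a<dA. \<Sum>c<dA. ip ?Z (f y) (\<lambda>(b,a'). ?o K (b,a) * \<psi> c a') *
         cnj (ip ?Z (f y') (\<lambda>(b,a'). ?o K (b,a) * \<psi> c a')))
      = (if y = y' then complex_of_real (q y) else 0)" if "y < dB * dA" "y' < dB * dA" for y y'
      using diag[of y y'] that unfolding sum_list_lessThan by (simp add: sum_Times N_def)
  qed
  interpret single_letter dA dB "dB * dA" Ks \<psi> e f q by (rule sl)
  have prob_sand: "complex_of_real (prob (\<lambda>x (b,a). W $$ (b * dA + a, x)) y) = (\<Sum>i<N. \<Sum>j<N. cnj (W $$ (i,y)) * W $$ (j,y) * \<rho> $$ (i,j))" for W y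
  proof -
    have "complex_of_real (prob (\<lambda>x (b,a). W $$ (b * dA + a, x)) y)
      = (\<Sum>l<length Ks. ip ?Z (\<lambda>(b,a). W $$ (b * dA + a, y)) (?o (Ks ! l)) * cnj (ip ?Z (\<lambda>(b,a). W $$ (b * dA + a, y)) (?o (Ks ! l))))"
      unfolding prob_def sum_list_lessThan of_real_sum by (intro sum.cong refl) (rule complex_norm_square)
    also have "\<dots> = (\<Sum>i<dB * dA. \<Sum>i'<dB * dA. cnj (W $$ (i,y)) * W $$ (i',y) * \<rho> $$ (i,i'))"
      by (rule gram_flat) (rule \<rho>e; simp add: N_def)
    finally show ?thesis unfolding N_def .
  qed
  have pe: "prob e x = lam x" if "x < N" for x
  proof -
    have "complex_of_real (prob e x) = complex_of_real (lam x)"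
      unfolding e_def prob_sand using spectral_sandwich[OF U \<rho>U that that] by simp
    then show ?thesis by simp
  qed
  have lc: "mlog N \<rho> \<in> carrier_mat N N" "mlog N \<sigma> \<in> carrier_mat N N"
    unfolding lU lV using U V by (auto simp: unitary_def intro!: mult_carrier_mat[of _ N N _ N])
  have "mtrace (\<rho> * mlog N \<rho>) = (\<Sum>x<N. complex_of_real (log 2 (lam x)) * complex_of_real (prob e x))"
    unfolding lU mtrace_spectral[OF \<rho>c U] e_def prob_sand ..
  also have "\<dots> = complex_of_real (\<Sum>x<N. prob e x * log 2 (prob e x))"
    unfolding of_real_sum by (intro sum.cong refl) (simp add: pe)
  finally have t1: "mtrace (\<rho> * mlog N \<rho>) = complex_of_real (\<Sum>x<N. prob e x * log 2 (prob e x))" .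
  have "mtrace (\<rho> * mlog N \<sigma>) = (\<Sum>y<N. complex_of_real (log 2 (q y)) * complex_of_real (prob f y))"
    unfolding lV mtrace_spectral[OF \<rho>c V] f_def prob_sand ..
  then have t2: "mtrace (\<rho> * mlog N \<sigma>) = complex_of_real (\<Sum>y<N. prob f y * log 2 (q y))"
    by (simp add: mult.commute)
  have "info = (\<Sum>x<N. prob e x * log 2 (prob e x)) - (\<Sum>y<N. prob f y * log 2 (q y))"
    unfolding info_def N_def ..
  then have "mtrace (\<rho> * (mlog N \<rho> - mlog N \<sigma>)) = complex_of_real info"
    unfolding mtrace_mult_minus[OF \<rho>c lc] t1 t2 by simp
  then have tr: "Re (mtrace (\<rho> * (mlog N \<rho> - mlog N \<sigma>))) = info" by simp
  \<comment> \<open>A kernel vector of \<open>\<sigma>\<close> has expectation 0 in a sum of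
    rank-one operators, so it is orthogonal to every \<open>?\<xi> s\<close>;
    \<open>output_support\<close> makes it orthogonal to every Kraus output as well.\<close>
  have supp: "\<rho> *\<^sub>v v = 0\<^sub>v N" if v: "v \<in> carrier_vec N" and \<sigma>v: "\<sigma> *\<^sub>v v = 0\<^sub>v N" for v
  proof -
    define g where "g = (\<lambda>(b,a). v $ (b * dA + a))"
    have mv: "(A *\<^sub>v v) $ i = (\<Sum>j<N. A $$ (i,j) * v $ j)" if "A \<in> carrier_mat N N" "i < N" for A i
      using that v by (auto simp: scalar_prod_def atLeast0LessThan intro!: sum.cong)
    have "complex_of_real (\<Sum>s\<in>?S. prb ?Z g (?\<xi> s)) = (\<Sum>s\<in>?S. ip ?Z g (?\<xi> s) * cnj (ip ?Z g (?\<xi> s)))"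
      unfolding of_real_sum by (intro sum.cong refl) (rule complex_norm_square)
    also have "\<dots> = (\<Sum>i<dB * dA. \<Sum>j<dB * dA. cnj (v $ i) * v $ j * \<sigma> $$ (i,j))"
      unfolding g_def by (rule gram_flat) (rule \<sigma>e; simp add: N_def)
    also have "\<dots> = (\<Sum>i<N. cnj (v $ i) * (\<sigma> *\<^sub>v v) $ i)"
      unfolding N_def[symmetric] by (intro sum.cong refl) (simp add: mv[OF \<sigma>c] sum_distrib_left mult_ac del: index_mult_mat_vec)
    also have "\<dots> = 0" unfolding \<sigma>v by simp
    finally have "(\<Sum>s\<in>?S. prb ?Z g (?\<xi> s)) = 0" by (metis of_real_eq_0_iff)
    then have z: "ip ?Z g (?\<xi> s) = 0" if "s \<in> ?S" for s
      using that by (subst (asm) sum_nonneg_eq_0_iff) auto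
    have orth: "ip ?Z g (?o (Ks ! l)) = 0" if "l < length Ks" for l
    proof (rule output_support)
      fix a c assume "a < dA" "c < dA"
      then show "ip ?Z g (\<lambda>(b,a'). ?o (Ks ! l) (b,a) * \<psi> c a') = 0" using z[of "(l,a,c)"] that by auto
    qed
    show ?thesis
    proof (rule eq_vecI)
      fix i assume "i < dim_vec (0\<^sub>v N :: complex vec)"
      then have i: "i < N" by simp
      have "(\<rho> *\<^sub>v v) $ i = (\<Sum>j<N. \<Sum>l<length Ks. ?o (Ks ! l) (?p i) * (cnj (?o (Ks ! l) (?p j)) * v $ j))"
        unfolding mv[OF \<rho>c i] using i by (intro sum.cong refl) (simp add: \<rho>e sum_distrib_right mult.assoc)
      also have "\<dots> = (\<Sum>l<length Ks. ?o (Ks ! l) (?p i) * (\<Sum>j<N. cnj (?o (Ks ! l) (?p j)) * v $ j))"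
        unfolding sum_distrib_left by (rule sum.swap)
      also have "\<dots> = (\<Sum>l<length Ks. ?o (Ks ! l) (?p i) * ip ?Z (?o (Ks ! l)) g)"
        unfolding ip_def sum_pairs_flat N_def by (simp add: g_def)
      also have "\<dots> = 0" using orth by (intro sum.neutral ballI) (metis cnj_ip complex_cnj_zero lessThan_iff mult_zero_right)
      finally show "(\<rho> *\<^sub>v v) $ i = 0\<^sub>v N $ i" using i by simp
    qed (use \<rho>c in auto)
  qed
  have "mutual_info dB dA \<rho> = rel_entropy N \<rho> \<sigma>"
    unfolding mutual_info_def \<sigma>_def N_def ..
  also have "\<dots> = ereal info"
    unfolding rel_entropy_def using supp tr by simp
  finally have "c < info" using c unfolding \<rho>_def N_def by simp
  then show ?thesis using sl by blast
qed

section \<open>From tests to codes\<close>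

lemma psd_gram:
  assumes A: "A \<in> carrier_mat n n"
    and e: "\<And>i j. i < n \<Longrightarrow> j < n \<Longrightarrow> A $$ (i,j) = (\<Sum>s\<in>S. x s i * cnj (x s j))"
  shows "psd n A"
  unfolding psd_def Let_def
proof (intro conjI ballI)
  fix v :: "complex vec" assume "v \<in> carrier_vec n"
  have "(\<Sum>i<n. \<Sum>j<n. cnj (v $ i) * A $$ (i,j) * v $ j)
     = (\<Sum>i<n. \<Sum>j<n. cnj (v $ i) * v $ j * (\<Sum>s\<in>S. x s i * cnj (x s j)))"
    by (intro sum.cong refl) (simp add: e mult_ac)
  also have "\<dots> = (\<Sum>s\<in>S. ip {..<n} (\<lambda>i. v $ i) (x s) * cnj (ip {..<n} (\<lambda>i. v $ i) (x s)))"
    by (rule gram_kernel[symmetric])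
  also have "\<dots> = complex_of_real (\<Sum>s\<in>S. prb {..<n} (\<lambda>i. v $ i) (x s))"
    unfolding of_real_sum by (intro sum.cong refl) (rule complex_norm_square[symmetric])
  finally have eq: "(\<Sum>i<n. \<Sum>j<n. cnj (v $ i) * A $$ (i,j) * v $ j) = \<dots>" .
  show "Im (\<Sum>i<n. \<Sum>j<n. cnj (v $ i) * A $$ (i,j) * v $ j) = 0"
    and "0 \<le> Re (\<Sum>i<n. \<Sum>j<n. cnj (v $ i) * A $$ (i,j) * v $ j)"
    unfolding eq by (simp_all only: Im_complex_of_real Re_complex_of_real) (intro sum_nonneg, simp)
qed (rule A)

lemma mtrace_gram:
  assumes A: "A \<in> carrier_mat n n" and B: "B \<in> carrier_mat n n"
    and Ae: "\<And>i j. i < n \<Longrightarrow> j < n \<Longrightarrow> A $$ (i,j) = (\<Sum>s\<in>S. x s i * cnj (x s j))"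
    and Be: "\<And>i j. i < n \<Longrightarrow> j < n \<Longrightarrow> B $$ (i,j) = (\<Sum>p\<in>P. y p i * cnj (y p j))"
  shows "mtrace (A * B) = complex_of_real (\<Sum>p\<in>P. \<Sum>s\<in>S. prb {..<n} (x s) (y p))"
proof -
  have "mtrace (A * B) = (\<Sum>i<n. \<Sum>j<n. A $$ (i,j) * B $$ (j,i))"
    using A B unfolding mtrace_def by (intro sum.cong mat_mult_entry) auto
  also have "\<dots> = (\<Sum>i<n. \<Sum>j<n. \<Sum>s\<in>S. x s i * cnj (x s j) * B $$ (j,i))"
    by (intro sum.cong refl) (simp add: Ae sum_distrib_right)
  also have "\<dots> = (\<Sum>r\<in>{..<n} \<times> {..<n}. \<Sum>s\<in>S. x s (fst r) * cnj (x s (snd r)) * B $$ (snd r, fst r))"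
    by (simp add: sum_Times)
  also have "\<dots> = (\<Sum>s\<in>S. \<Sum>r\<in>{..<n} \<times> {..<n}. x s (fst r) * cnj (x s (snd r)) * B $$ (snd r, fst r))"
    by (rule sum.swap)
  also have "\<dots> = (\<Sum>s\<in>S. \<Sum>j<n. \<Sum>i<n. cnj (x s j) * x s i * B $$ (j,i))"
    unfolding sum_Times fst_conv snd_conv by (rule sum.cong[OF refl], subst sum.swap) (simp add: mult_ac)
  also have "\<dots> = (\<Sum>s\<in>S. \<Sum>p\<in>P. ip {..<n} (x s) (y p) * cnj (ip {..<n} (x s) (y p)))"
    unfolding gram_kernel by (intro sum.cong refl) (simp add: Be)
  also have "\<dots> = (\<Sum>s\<in>S. \<Sum>p\<in>P. complex_of_real (prb {..<n} (x s) (y p)))"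
    by (intro sum.cong refl) (rule complex_norm_square[symmetric])
  also have "\<dots> = (\<Sum>p\<in>P. \<Sum>s\<in>S. complex_of_real (prb {..<n} (x s) (y p)))"
    by (rule sum.swap)
  finally show ?thesis unfolding of_real_sum .
qed

lemma sum_list_compose_channel:
  fixes f :: "cmat \<Rightarrow> 'a :: comm_monoid_add"
  shows "(\<Sum>M\<leftarrow>compose_channel Ns Es. f M) = (\<Sum>K\<leftarrow>Ns. \<Sum>E\<leftarrow>Es. f (K * E))"
  by (simp add: compose_channel_def sum_list_map_concat o_def)

text \<open>There is one copy per pair \<open>(i, m)\<close>, and both shared registers have the
  functions in \<open>E\<close> as basis, numbered by \<open>h\<close>. Alice picks the copy using
  her knowledge of \<open>i\<close>; Bob's element for \<open>m\<close> merges the copies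
  \<open>(i, m)\<close> over all \<open>i\<close>, so that he need not know the channel.\<close>

lemma one_shot_code:
  fixes s a b :: nat and N :: "nat \<Rightarrow> cmat list" and \<psi> :: "nat \<Rightarrow> nat \<Rightarrow> nat \<Rightarrow> complex"
    and J :: "nat \<Rightarrow> 'j set" and t :: "nat \<Rightarrow> 'j \<Rightarrow> nat \<times> nat \<Rightarrow> complex"
  assumes N: "\<And>i. i < s \<Longrightarrow> \<forall>K\<in>set (N i). K \<in> carrier_mat b a" and tp: "\<And>i. i < s \<Longrightarrow> tp_entries a b (N i)"
    and unit: "\<And>i. i < s \<Longrightarrow> (\<Sum>x<a. \<Sum>y<a. (cmod (\<psi> i x y))\<^sup>2) = 1"
    and fJ: "\<And>i. i < s \<Longrightarrow> finite (J i)"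
    and contr: "\<And>i v. i < s \<Longrightarrow> (\<Sum>j\<in>J i. prb ({..<b} \<times> {..<a}) (t i j) v) \<le> nsq ({..<b} \<times> {..<a}) v"
    and coll: "\<And>i \<beta>. i < s \<Longrightarrow> (\<Sum>c<a. \<Sum>j\<in>J i. prb ({..<b} \<times> {..<a}) (t i j) (\<lambda>(y,x). \<beta> y * \<psi> i c x)) \<le> lam * nsq {..<b} \<beta>"
    and succ: "\<And>i. i < s \<Longrightarrow> 1 - eps \<le> (\<Sum>l<length (N i). \<Sum>j\<in>J i. prb ({..<b} \<times> {..<a}) (t i j) (chan_out a (\<psi> i) (N i ! l)))"
    and lam: "0 \<le> lam" and tot: "2 * eps + 4 * (real s * real (nat \<lceil>2 powr R\<rceil>)) * lam \<le> tot_err"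
  shows "ea_code_informed s a b N R tot_err"
proof -
  define M where "M = nat \<lceil>2 powr R\<rceil>"
  have M: "M > 0" by (simp add: M_def)
  define I where "I = {..<s} \<times> {..<M}"
  interpret position_code I "{..<a}" "{..<b}" "\<lambda>(i,m). {..<length (N i)}" "\<lambda>(i,m) l y x. (N i ! l) $$ (y,x)"
    "\<lambda>(i,m). \<psi> i" "\<lambda>(i,m). J i" "\<lambda>(i,m). t i" eps lam
  proof unfold_locales
    show "(\<Sum>l\<in>(case k of (i,m) \<Rightarrow> {..<length (N i)}). \<Sum>y\<in>{..<b}. cnj ((case k of (i,m) \<Rightarrow> \<lambda>l y x. (N i ! l) $$ (y,x)) l y x) * (case k of (i,m) \<Rightarrow> \<lambda>l y x. (N i ! l) $$ (y,x)) l y x') = (if x = x' then 1 else 0)"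
      if "k \<in> I" "x \<in> {..<a}" "x' \<in> {..<a}" for k x x'
      using tp that unfolding tp_entries_def sum_list_lessThan by (auto simp: I_def)
    show "1 - eps \<le> (\<Sum>l\<in>(case k of (i,m) \<Rightarrow> {..<length (N i)}). \<Sum>j\<in>(case k of (i,m) \<Rightarrow> J i).
       prb ({..<b} \<times> {..<a}) ((case k of (i,m) \<Rightarrow> t i) j) (\<lambda>(y,x'). \<Sum>x\<in>{..<a}. (case k of (i,m) \<Rightarrow> \<lambda>l y x. (N i ! l) $$ (y,x)) l y x * (case k of (i,m) \<Rightarrow> \<psi> i) x x'))"
      if "k \<in> I" for k
      using succ that by (auto simp: I_def chan_out_def)
  qed (use unit fJ contr coll lam in \<open>auto simp: I_def\<close>)
  let ?Z = "{..<b} \<times> E"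
  define q where "q = card E"
  obtain h where h: "bij_betw h {..<q} E"
    using ex_bij_betw_nat_finite[OF finE] unfolding q_def atLeast0LessThan by blast
  have sumh: "(\<Sum>j<q. g (h j)) = (\<Sum>e\<in>E. g e)" for g :: "_ \<Rightarrow> 'z :: comm_monoid_add"
    using sum.reindex_bij_betw[OF h, of g] .
  have hE: "h j \<in> E" if "j < q" for j using h that by (auto simp: bij_betw_def)
  have hinj: "h j = h j' \<longleftrightarrow> j = j'" if "j < q" "j' < q" for j j'
    using h that by (auto simp: bij_betw_def inj_on_def)
  define z where "z i = (i div q, h (i mod q))" for i
  have zZ: "z i \<in> ?Z" and qpos: "0 < q" if "i < b * q" for i
  proof -
    show "0 < q" using that by (cases q) auto
    then show "z i \<in> ?Z" using that hE by (auto simp: z_def less_mult_imp_div_less)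
  qed
  have zinj: "z i = z j \<longleftrightarrow> i = j" if "i < b * q" "j < b * q" for i j
  proof -
    have "i mod q < q" "j mod q < q" using qpos[OF that(1)] by auto
    then show ?thesis unfolding z_def using hinj by (auto) (metis div_mult_mod_eq)
  qed
  have sumz: "(\<Sum>p\<in>?Z. g p) = (\<Sum>i<b * q. g (z i))" for g :: "_ \<Rightarrow> 'z :: comm_monoid_add"
  proof -
    have "(\<Sum>p\<in>?Z. g p) = (\<Sum>y<b. \<Sum>j<q. g (y, h j))"
      unfolding sum_Times sumh[symmetric] ..
    also have "\<dots> = (\<Sum>p\<in>{..<b} \<times> {..<q}. g (fst p, h (snd p)))" by (simp add: sum_Times)
    finally show ?thesis unfolding sum_pairs_flat z_def by simp
  qed
  have ipz: "ip ?Z u v = ip {..<b * q} (\<lambda>i. u (z i)) (\<lambda>i. v (z i))" for u v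
    unfolding ip_def by (rule sumz)
  define \<theta> where "\<theta> = vec (q * q) (\<lambda>i. wt I (h (i div q)) (h (i mod q)))"
  have \<theta>c: "\<theta> \<in> carrier_vec (q * q)" by (simp add: \<theta>_def)
  have \<theta>e: "\<theta> $ (x * q + y) = wt I (h x) (h y)" if "x < q" "y < q" for x y
    using that by (simp add: \<theta>_def mult_add_less)
  have \<theta>u: "unit_vec_c (q * q) \<theta>"
  proof -
    have "(\<Sum>i<q * q. (cmod (\<theta> $ i))\<^sup>2) = (\<Sum>x<q. \<Sum>y<q. (cmod (wt I (h x) (h y)))\<^sup>2)"
      unfolding sum_lessThan_mult by (intro sum.cong refl) (simp add: \<theta>e)
    also have "\<dots> = (\<Sum>r\<in>E. \<Sum>e\<in>E. (cmod (wt I r e))\<^sup>2)"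
      unfolding sumh[of "\<lambda>e. (cmod (wt I _ e))\<^sup>2"] by (rule sumh)
    also have "\<dots> = 1" by (rule wt_total) simp
    finally show ?thesis using \<theta>c by (simp add: unit_vec_c_def)
  qed
  define rl where "rl k = (SOME xs. set xs = Er k \<and> distinct xs)" for k
  have rl: "set (rl k) = Er k" "distinct (rl k)" for k
    using someI_ex[OF finite_distinct_list[OF finEr[of k]]] unfolding rl_def by auto
  have sumrl: "(\<Sum>r\<leftarrow>rl k. g r) = (\<Sum>r\<in>Er k. g r)" for k and g :: "_ \<Rightarrow> complex"
    using sum_list_distinct_conv_sum_set[OF rl(2)] rl(1) by metis
  \<comment> \<open>The half in slot \<open>k\<close> becomes the channel input and the other halves
    are found at \<open>r\<close>: for varying \<open>r\<close> these are Kraus operators of a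
    partial trace.\<close>
  define enc where "enc k r = mat a q (\<lambda>(x,j). if h j = r(k := x) then 1 else (0::complex))" for k r
  have encc: "enc k r \<in> carrier_mat a q" for k r by (simp add: enc_def)
  define Enc where "Enc i m = map (enc (i,m)) (rl (i,m))" for i m
  have kE: "r(k := x) \<in> E" if "k \<in> I" "r \<in> Er k" "x < a" for k r x
    using that by (auto simp: PiE_def Pi_def extensional_def)
  have chanE: "is_channel q a (Enc i m)" if "i < s" "m < M" for i m
    unfolding is_channel_iff
  proof
    let ?k = "(i,m)"
    have k: "?k \<in> I" using that by (simp add: I_def)
    show "\<forall>K\<in>set (Enc i m). K \<in> carrier_mat a q" by (auto simp: Enc_def enc_def)
    show "tp_entries q a (Enc i m)" unfolding tp_entries_def
    proof (intro allI impI)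
      fix j j' assume j: "j < q" and j': "j' < q"
      have "(\<Sum>K\<leftarrow>Enc i m. \<Sum>x<a. cnj (K $$ (x,j)) * K $$ (x,j')) = (\<Sum>r\<in>Er ?k. \<Sum>x<a. cnj (enc ?k r $$ (x,j)) * enc ?k r $$ (x,j'))"
        unfolding Enc_def by (simp add: o_def sumrl)
      also have "\<dots> = (\<Sum>r\<in>Er ?k. \<Sum>x<a. if h j = r(?k := x) then (if h j' = r(?k := x) then 1 else 0) else 0)"
        using j j' by (intro sum.cong refl) (simp add: enc_def)
      also have "\<dots> = (\<Sum>e\<in>E. if h j = e then (if h j' = e then 1 else 0) else 0)"
        by (rule sum_PiE_split[OF k, symmetric])
      also have "\<dots> = (if j = j' then 1 else 0)"
        using finE hE[OF j] hinj[OF j j'] by (auto simp: sum.delta)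
      finally show "(\<Sum>K\<leftarrow>Enc i m. \<Sum>x<a. cnj (K $$ (x,j)) * K $$ (x,j')) = (if j = j' then 1 else 0)" .
    qed
  qed
  have "\<exists>v w. (\<forall>x\<in>?Z. \<forall>y\<in>?Z.
      (\<Sum>k\<in>I. \<Sum>j\<in>(case k of (i,m) \<Rightarrow> J i) \<times> Er k. v k j x * cnj (v k j y)) + (\<Sum>z\<in>?Z. w z x * cnj (w z y)) = (if x = y then 1 else 0)) \<and>
    (\<forall>k\<in>I. 1 - (\<Sum>l\<in>(case k of (i,m) \<Rightarrow> {..<length (N i)}). \<Sum>r\<in>Er k. \<Sum>j\<in>(case k of (i,m) \<Rightarrow> J i) \<times> Er k.
        prb ?Z (v k j) (st k l r)) \<le> 2 * eps + 4 * real (card I) * lam)" (is "\<exists>v w. ?compl v w \<and> ?bound v")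
    by (rule povm_exists)
  then obtain v w where compl: "?compl v w" and bound: "?bound v" by (elim exE conjE)
  \<comment> \<open>The inconclusive outcome \<open>w\<close> must be given to some message for the
    elements to add up to the identity; message 0 exists since \<open>M > 0\<close>.\<close>
  define SS where "SS m = (SIGMA i:{..<s}. J i \<times> Er (i,m)) <+> (if m = 0 then ?Z else {})" for m
  define xx where "xx m = case_sum (\<lambda>(i,j). v (i,m) j) w" for m
  have finS: "finite (SIGMA i:{..<s}. J i \<times> Er (i,m))" "finite (if m = 0 then ?Z else {})" for m
    using fJ finE finEr by auto
  define Lam where "Lam m = mat (b * q) (b * q) (\<lambda>(i,j). \<Sum>p\<in>SS m. xx m p (z i) * cnj (xx m p (z j)))" for m
  have Lamc: "Lam m \<in> carrier_mat (b * q) (b * q)" for m by (simp add: Lam_def)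
  have Lame: "Lam m $$ (i,j) = (\<Sum>p\<in>SS m. xx m p (z i) * cnj (xx m p (z j)))" if "i < b * q" "j < b * q" for m i j
    using that by (simp add: Lam_def)
  have SSsum: "(\<Sum>p\<in>SS m. g (xx m p)) = (\<Sum>i<s. \<Sum>j\<in>J i \<times> Er (i,m). g (v (i,m) j)) + (if m = 0 then (\<Sum>u\<in>?Z. g (w u)) else 0)"
    for m and g :: "_ \<Rightarrow> 'z :: comm_monoid_add"
  proof -
    have "(\<Sum>p\<in>SS m. g (xx m p)) = (\<Sum>p\<in>(SIGMA i:{..<s}. J i \<times> Er (i,m)). g (xx m (Inl p))) + (\<Sum>p\<in>(if m = 0 then ?Z else {}). g (xx m (Inr p)))"
      unfolding SS_def by (subst sum.Plus[OF finS]) simp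
    also have "(\<Sum>p\<in>(SIGMA i:{..<s}. J i \<times> Er (i,m)). g (xx m (Inl p))) = (\<Sum>i<s. \<Sum>j\<in>J i \<times> Er (i,m). g (v (i,m) j))"
      using fJ finEr by (subst sum.Sigma) (auto simp: xx_def split_def)
    finally show ?thesis by (simp add: xx_def)
  qed
  have psdL: "psd (b * q) (Lam m)" for m
    by (rule psd_gram[OF Lamc Lame])
  have sumL: "foldr (\<lambda>m acc. Lam m + acc) [0..<M] (0\<^sub>m (b * q) (b * q)) = 1\<^sub>m (b * q)" (is "?F = _")
  proof (rule eq_matI)
    have Fc: "?F \<in> carrier_mat (b * q) (b * q)" by (rule foldr_mat_carrier) (rule Lamc)
    then show "dim_row ?F = dim_row (1\<^sub>m (b * q))" "dim_col ?F = dim_col (1\<^sub>m (b * q))" by auto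
    fix i j assume "i < dim_row (1\<^sub>m (b * q))" "j < dim_col (1\<^sub>m (b * q))"
    then have ij: "i < b * q" "j < b * q" by auto
    have "?F $$ (i,j) = (\<Sum>m\<leftarrow>[0..<M]. Lam m $$ (i,j))"
      by (rule foldr_mat_entry[OF Lamc ij])
    also have "\<dots> = (\<Sum>m<M. \<Sum>p\<in>SS m. xx m p (z i) * cnj (xx m p (z j)))"
      unfolding sum_list_lessThan using ij by (simp add: Lame)
    also have "\<dots> = (\<Sum>m<M. \<Sum>i'<s. \<Sum>p\<in>J i' \<times> Er (i',m). v (i',m) p (z i) * cnj (v (i',m) p (z j)))
       + (\<Sum>m<M. if m = 0 then (\<Sum>u\<in>?Z. w u (z i) * cnj (w u (z j))) else 0)"
      unfolding SSsum[of "\<lambda>f. f (z i) * cnj (f (z j))"] sum.distrib ..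
    also have "(\<Sum>m<M. \<Sum>i'<s. \<Sum>p\<in>J i' \<times> Er (i',m). v (i',m) p (z i) * cnj (v (i',m) p (z j)))
       = (\<Sum>k\<in>I. \<Sum>p\<in>(case k of (i,m) \<Rightarrow> J i) \<times> Er k. v k p (z i) * cnj (v k p (z j)))"
      unfolding I_def sum_Times[of _ "{..<s}"] by (subst sum.swap) simp
    also have "(\<Sum>m<M. if m = 0 then (\<Sum>u\<in>?Z. w u (z i) * cnj (w u (z j))) else 0) = (\<Sum>u\<in>?Z. w u (z i) * cnj (w u (z j)))"
      using M by simp
    also have "(\<Sum>k\<in>I. \<Sum>p\<in>(case k of (i,m) \<Rightarrow> J i) \<times> Er k. v k p (z i) * cnj (v k p (z j))) + (\<Sum>u\<in>?Z. w u (z i) * cnj (w u (z j))) = (if z i = z j then 1 else 0)"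
      by (rule bspec[OF bspec[OF compl zZ[OF ij(1)]] zZ[OF ij(2)]])
    finally show "?F $$ (i,j) = 1\<^sub>m (b * q) $$ (i,j)" using zinj[OF ij] ij by simp
  qed
  have err: "1 - Re (mtrace (Lam m * apply_channel (b * q) (tensor_id q (compose_channel (N i) (Enc i m))) (proj \<theta>)))
     \<le> tot_err" if i: "i < s" and m: "m < M" for i m
  proof -
    let ?k = "(i,m)"
    have k: "?k \<in> I" using i m by (simp add: I_def)
    let ?C = "compose_channel (N i) (Enc i m)"
    let ?\<rho> = "apply_channel (b * q) (tensor_id q ?C) (proj \<theta>)"
    have C: "\<forall>K\<in>set ?C. K \<in> carrier_mat b q"
      using N[OF i] encc by (auto simp: compose_channel_def Enc_def intro!: mult_carrier_mat[of _ b a _ q])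
    have \<rho>c: "?\<rho> \<in> carrier_mat (b * q) (b * q)" by (rule apply_tensor_proj(1)[OF C \<theta>c])
    \<comment> \<open>Kraus operator \<open>r\<close> of the encoder followed by Kraus operator
      \<open>l\<close> of the channel turns the shared state into the vector \<open>st\<close> of
      the abstract analysis.\<close>
    have out: "(\<Sum>x<q. (N i ! l * enc ?k r) $$ (j div q, x) * \<theta> $ (x * q + j mod q)) = st ?k l r (z j)"
      if l: "l < length (N i)" and r: "r \<in> Er ?k" and j: "j < b * q" for l r j
    proof -
      let ?y = "j div q" and ?e = "h (j mod q)"
      have Kc: "N i ! l \<in> carrier_mat b a" using N[OF i] l by auto
      have dj: "?y < b" "j mod q < q" using j qpos[OF j] by (auto simp: less_mult_imp_div_less)
      have "(\<Sum>x<q. (N i ! l * enc ?k r) $$ (?y, x) * \<theta> $ (x * q + j mod q))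
        = (\<Sum>x<q. \<Sum>c<a. (if h x = r(?k := c) then (N i ! l) $$ (?y,c) * wt I (h x) ?e else 0))"
      proof (rule sum.cong[OF refl])
        fix x assume "x \<in> {..<q}"
        then have x: "x < q" by simp
        have KE: "(N i ! l * enc ?k r) $$ (?y, x) = (\<Sum>c<a. (N i ! l) $$ (?y,c) * enc ?k r $$ (c,x))"
          by (rule mat_mult_entry[OF Kc encc dj(1) x])
        show "(N i ! l * enc ?k r) $$ (?y, x) * \<theta> $ (x * q + j mod q) = (\<Sum>c<a. (if h x = r(?k := c) then (N i ! l) $$ (?y,c) * wt I (h x) ?e else 0))"
          unfolding KE \<theta>e[OF x dj(2)] sum_distrib_right using x by (intro sum.cong refl) (simp add: enc_def)
      qed
      also have "\<dots> = (\<Sum>e\<in>E. \<Sum>c<a. (if e = r(?k := c) then (N i ! l) $$ (?y,c) * wt I e ?e else 0))"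
        by (rule sumh)
      also have "\<dots> = (\<Sum>c<a. \<Sum>e\<in>E. (if e = r(?k := c) then (N i ! l) $$ (?y,c) * wt I e ?e else 0))"
        by (rule sum.swap)
      also have "\<dots> = (\<Sum>c<a. (N i ! l) $$ (?y,c) * wt I (r(?k := c)) ?e)"
        using finE kE[OF k r] by (intro sum.cong refl) simp
      also have "\<dots> = (\<Sum>c<a. (N i ! l) $$ (?y,c) * \<psi> i c (?e ?k)) * wt (I - {?k}) r ?e"
      proof -
        have "wt I (r(?k := c)) ?e = \<psi> i c (?e ?k) * wt (I - {?k}) r ?e" for c
          unfolding wt_def prod.remove[OF finI k] by (intro arg_cong2[where f = "(*)"] prod.cong refl) auto
        then show ?thesis by (simp add: sum_distrib_right mult.assoc)
      qed
      also have "\<dots> = st ?k l r (z j)" by (simp add: st_def out_def z_def)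
      finally show ?thesis .
    qed
    let ?P = "{..<length (N i)} \<times> Er ?k"
    have \<rho>e: "?\<rho> $$ (j,j') = (\<Sum>p\<in>?P. st ?k (fst p) (snd p) (z j) * cnj (st ?k (fst p) (snd p) (z j')))"
      if j: "j < b * q" and j': "j' < b * q" for j j'
    proof -
      have "?\<rho> $$ (j,j') = (\<Sum>l<length (N i). \<Sum>r\<in>Er ?k.
          (\<Sum>x<q. (N i ! l * enc ?k r) $$ (j div q, x) * \<theta> $ (x * q + j mod q)) *
          cnj (\<Sum>x<q. (N i ! l * enc ?k r) $$ (j' div q, x) * \<theta> $ (x * q + j' mod q)))"
        unfolding apply_tensor_proj(2)[OF C \<theta>c j j'] sum_list_compose_channel sum_list_lessThan[of _ "N i"]
        unfolding Enc_def map_map o_def sumrl ..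
      also have "\<dots> = (\<Sum>l<length (N i). \<Sum>r\<in>Er ?k. st ?k l r (z j) * cnj (st ?k l r (z j')))"
        by (intro sum.cong refl) (simp only: out j j' lessThan_iff)
      finally show ?thesis by (simp add: sum_Times)
    qed
    have "mtrace (Lam m * ?\<rho>) = complex_of_real (\<Sum>p\<in>?P. \<Sum>s\<in>SS m. (cmod (ip {..<b * q} (\<lambda>i. xx m s (z i)) (\<lambda>i. st ?k (fst p) (snd p) (z i))))\<^sup>2)"
      by (rule mtrace_gram[OF Lamc \<rho>c Lame \<rho>e])
    then have "Re (mtrace (Lam m * ?\<rho>)) = (\<Sum>p\<in>?P. \<Sum>s\<in>SS m. prb ?Z (xx m s) (st ?k (fst p) (snd p)))"
      unfolding ipz by simp
    \<comment> \<open>Of the elements merged into \<open>Lam m\<close> only that of the copy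
      actually sent is kept.\<close>
    also have "\<dots> \<ge> (\<Sum>p\<in>?P. \<Sum>j\<in>J i \<times> Er ?k. prb ?Z (v ?k j) (st ?k (fst p) (snd p)))"
    proof (intro sum_mono)
      fix p
      let ?g = "\<lambda>f. prb ?Z f (st ?k (fst p) (snd p))"
      have "(\<Sum>j\<in>J i \<times> Er ?k. ?g (v ?k j)) \<le> (\<Sum>i<s. \<Sum>j\<in>J i \<times> Er (i,m). ?g (v (i,m) j))"
      proof (rule member_le_sum[of i "{..<s}" "\<lambda>i. \<Sum>j\<in>J i \<times> Er (i,m). ?g (v (i,m) j)"])
        show "i \<in> {..<s}" using i by simp
        show "0 \<le> (\<Sum>j\<in>J x \<times> Er (x,m). ?g (v (x,m) j))" for x by (rule sum_nonneg) simp
      qed simp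
      also have "\<dots> \<le> (\<Sum>s\<in>SS m. ?g (xx m s))"
        unfolding SSsum[of ?g m] by (simp add: sum_nonneg)
      finally show "(\<Sum>j\<in>J i \<times> Er ?k. ?g (v ?k j)) \<le> (\<Sum>s\<in>SS m. ?g (xx m s))" .
    qed
    finally have "(\<Sum>l<length (N i). \<Sum>r\<in>Er ?k. \<Sum>j\<in>J i \<times> Er ?k. prb ?Z (v ?k j) (st ?k l r)) \<le> Re (mtrace (Lam m * ?\<rho>))"
      by (simp add: sum_Times)
    moreover have "1 - (\<Sum>l<length (N i). \<Sum>r\<in>Er ?k. \<Sum>j\<in>J i \<times> Er ?k. prb ?Z (v ?k j) (st ?k l r)) \<le> 2 * eps + 4 * real (card I) * lam"
      using bspec[OF bound k] by simp
    moreover have "4 * real (card I) * lam = 4 * (real s * real M) * lam" by (simp add: I_def)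
    ultimately show ?thesis using tot unfolding M_def[symmetric] by linarith
  qed
  show ?thesis
    unfolding ea_code_informed_def Let_def M_def[symmetric]
    using \<theta>u chanE psdL sumL err by (intro exI[of _ q] exI[of _ q] exI[of _ \<theta>] exI[of _ Enc] exI[of _ Lam] conjI) auto
qed

text \<open>There is a single message when \<open>R \<le> 0\<close>: a fixed input and the identity
  as only measurement element never err, since the channel preserves the trace.\<close>

lemma trivial_code:
  assumes N: "\<And>i. i < s \<Longrightarrow> \<forall>K\<in>set (N i). K \<in> carrier_mat b a" and tp: "\<And>i. i < s \<Longrightarrow> tp_entries a b (N i)"
    and a: "a > 0" and R: "R \<le> 0" and eps: "0 \<le> eps"
  shows "ea_code_informed s a b N R eps"
proof -
  have "2 powr R \<le> 1" using R by (metis one_le_numeral powr_mono powr_zero_eq_one zero_neq_numeral)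
  then have "\<lceil>2 powr R\<rceil> = 1" by (intro ceiling_unique) auto
  then have M: "nat \<lceil>2 powr R\<rceil> = 1" by simp
  define \<theta> :: cvec where "\<theta> = vec 1 (\<lambda>_. 1)"
  define E where "E = mat a 1 (\<lambda>(x,j). if x = 0 then 1 else (0::complex))"
  have Ec: "E \<in> carrier_mat a 1" by (simp add: E_def)
  have \<theta>c: "\<theta> \<in> carrier_vec (1 * 1)" by (simp add: \<theta>_def)
  have chan: "is_channel 1 a [E]"
    unfolding is_channel_iff tp_entries_def using a Ec
    by (auto simp: E_def if_distrib[of cnj] if_distrib[of "\<lambda>c. c * _"] cong: if_cong)
  have tr: "mtrace (1\<^sub>m (b * 1) * apply_channel (b * 1) (tensor_id 1 (compose_channel (N i) [E])) (proj \<theta>)) = 1"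
    if i: "i < s" for i
  proof -
    let ?C = "compose_channel (N i) [E]"
    let ?\<rho> = "apply_channel (b * 1) (tensor_id 1 ?C) (proj \<theta>)"
    have C: "\<forall>K\<in>set ?C. K \<in> carrier_mat b 1"
      using N[OF i] Ec by (auto simp: compose_channel_def)
    have \<rho>c: "?\<rho> \<in> carrier_mat (b * 1) (b * 1)" by (rule apply_tensor_proj(1)[OF C \<theta>c])
    have KE: "(K * E) $$ (y,0) = K $$ (y,0)" if "K \<in> set (N i)" "y < b" for K y
    proof -
      have "(K * E) $$ (y,0) = (\<Sum>x<a. K $$ (y,x) * E $$ (x,0))"
        using N[OF i] that Ec by (intro mat_mult_entry) auto
      also have "\<dots> = (\<Sum>x<a. if x = 0 then K $$ (y,x) else 0)"
        by (intro sum.cong refl) (simp add: E_def)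
      finally show ?thesis using a by simp
    qed
    have "mtrace (1\<^sub>m (b * 1) * ?\<rho>) = (\<Sum>y<b. ?\<rho> $$ (y,y))"
      using \<rho>c by (simp add: mtrace_def)
    also have "\<dots> = (\<Sum>y<b. \<Sum>K\<leftarrow>N i. K $$ (y,0) * cnj (K $$ (y,0)))"
    proof (intro sum.cong refl)
      fix y assume "y \<in> {..<b}"
      then have y: "y < b * 1" by simp
      show "?\<rho> $$ (y,y) = (\<Sum>K\<leftarrow>N i. K $$ (y,0) * cnj (K $$ (y,0)))"
        unfolding apply_tensor_proj(2)[OF C \<theta>c y y] sum_list_compose_channel
        using y by (intro arg_cong[of _ _ sum_list] map_cong refl) (simp add: KE \<theta>_def del: index_mult_mat)
    qed
    also have "\<dots> = (\<Sum>K\<leftarrow>N i. \<Sum>y<b. cnj (K $$ (y,0)) * K $$ (y,0))"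
      unfolding sum_list_lessThan by (subst sum.swap) (simp add: mult.commute)
    also have "\<dots> = 1" using tp[OF i] a unfolding tp_entries_def by simp
    finally show ?thesis .
  qed
  have psd1: "psd (b * 1) (1\<^sub>m (b * 1))"
    by (rule psd_gram[where S = "{..<b * 1}" and x = "\<lambda>s i. if s = i then 1 else 0"])
       (auto simp: if_distrib[of cnj] if_distrib[of "\<lambda>c. c * _"] cong: if_cong)
  show ?thesis
    unfolding ea_code_informed_def Let_def M
    by (intro exI[of _ 1] exI[of _ \<theta>] exI[of _ "\<lambda>_ _. [E]"] exI[of _ "\<lambda>_. 1\<^sub>m (b * 1)"] conjI)
       (use chan psd1 tr eps in \<open>auto simp: unit_vec_c_def \<theta>_def\<close>)
qed

theorem theorem4:
  fixes s dA dB :: nat and N :: "nat \<Rightarrow> cmat list" and C \<epsilon> \<delta> :: real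
  assumes "s \<ge> 1" and "dA \<ge> 1" and "dB \<ge> 1"
    and "\<forall>i<s. is_channel dA dB (N i)"
    and "ereal C \<le> Min ((\<lambda>i. max_mutual_info dA dB (N i)) ` {..<s})"
    and "0 < \<epsilon>" and "\<epsilon> < 1" and "\<delta> > 0"
  shows "\<forall>\<^sub>F n in sequentially.
           ea_code_informed s (dA ^ n) (dB ^ n) (\<lambda>i. channel_pow n (N i))
             (real n * (C - \<delta>)) (2 * \<epsilon>)"
proof (cases "C - \<delta> \<le> 0")
  \<comment> \<open>Treated apart because rounding \<open>2 powr (real n * (C - \<delta>))\<close>
    up to an integer need not stay within a factor 2 when the exponent is negative.\<close>
  case True
  have K: "\<forall>K\<in>set (N i). K \<in> carrier_mat dB dA" "tp_entries dA dB (N i)" if "i < s" for i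
    using assms(4) that by (auto simp: is_channel_iff)
  have "ea_code_informed s (dA ^ n) (dB ^ n) (\<lambda>i. channel_pow n (N i)) (real n * (C - \<delta>)) (2 * \<epsilon>)" for n
  proof (rule trivial_code)
    show "real n * (C - \<delta>) \<le> 0" using True by (simp add: mult_nonneg_nonpos)
    show "\<forall>K\<in>set (channel_pow n (N i)). K \<in> carrier_mat (dB ^ n) (dA ^ n)" if "i < s" for i
      using K[OF that] by (intro channel_pow_carrier)
    show "tp_entries (dA ^ n) (dB ^ n) (channel_pow n (N i))" if "i < s" for i
      using K[OF that] by (intro tp_entries_channel_pow)
  qed (use assms in auto)
  then show ?thesis by simp
next
  case False
  then have C\<delta>: "C - \<delta> > 0" by simp
  \<comment> \<open>One half of \<open>\<delta>\<close> puts \<open>R\<close> strictly below the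
    supremum of the mutual information, so that some input exceeds \<open>R\<close> even if no
    maximiser is known; the other half makes the number of messages times
    \<open>2 powr (- real n * R)\<close> vanish.\<close>
  define R where "R = C - \<delta> / 2"
  have K: "\<forall>K\<in>set (N i). K \<in> carrier_mat dB dA" "tp_entries dA dB (N i)" if "i < s" for i
    using assms(4) that by (auto simp: is_channel_iff)
  have "\<exists>\<psi> e f q. single_letter dA dB (dB * dA) (N i) \<psi> e f q \<and> R < single_letter.info dA dB (dB * dA) (N i) \<psi> e f q"
    if i: "i < s" for i
  proof -
    have "ereal R < ereal C" using assms(8) by (simp add: R_def)
    also have "\<dots> \<le> max_mutual_info dA dB (N i)"
      using assms(5) i by (subst (asm) Min_ge_iff) auto
    finally obtain \<theta> where "unit_vec_c (dA * dA) \<theta>"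
      "ereal R < mutual_info dB dA (apply_channel (dB * dA) (tensor_id dA (N i)) (proj \<theta>))"
      unfolding max_mutual_info_def less_SUP_iff by blast
    then show ?thesis
      using mutual_info_single_letter[OF assms(2,3), of "N i" \<theta> R] assms(4) i by blast
  qed
  then obtain \<psi> where "\<forall>i<s. \<exists>e f q. single_letter dA dB (dB * dA) (N i) (\<psi> i) e f q \<and> R < single_letter.info dA dB (dB * dA) (N i) (\<psi> i) e f q"
    by metis
  then have psi: "\<exists>e f q. single_letter dA dB (dB * dA) (N i) (\<psi> i) e f q \<and> R < single_letter.info dA dB (dB * dA) (N i) (\<psi> i) e f q"
    if "i < s" for i using that by blast
  define T where "T n i X t \<longleftrightarrow> finite X \<and>
     (\<forall>v. (\<Sum>x\<in>X. prb ({..<dB ^ n} \<times> {..<dA ^ n}) (t x) v) \<le> nsq ({..<dB ^ n} \<times> {..<dA ^ n}) v) \<and>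
     (\<forall>\<beta>. (\<Sum>c<dA ^ n. \<Sum>x\<in>X. prb ({..<dB ^ n} \<times> {..<dA ^ n}) (t x) (\<lambda>(b,a). \<beta> b * psi_pow dA n (\<psi> i) c a)) \<le> 2 powr (- real n * R) * nsq {..<dB ^ n} \<beta>) \<and>
     1 - \<epsilon> / 2 \<le> (\<Sum>l<length (channel_pow n (N i)). \<Sum>x\<in>X. prb ({..<dB ^ n} \<times> {..<dA ^ n}) (t x) (chan_out (dA ^ n) (psi_pow dA n (\<psi> i)) (channel_pow n (N i) ! l)))"
    for n i and X :: "(nat \<Rightarrow> nat) set" and t
  \<comment> \<open>Finitely many channels: from some \<open>n\<close> on, the tests exist for all
    of them simultaneously.\<close>
  have tests: "\<forall>\<^sub>F n in sequentially. \<forall>i\<in>{..<s}. \<exists>X t. T n i X t"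
  proof (rule eventually_ball_finite)
    show "\<forall>i\<in>{..<s}. \<forall>\<^sub>F n in sequentially. \<exists>X t. T n i X t"
    proof
      fix i assume "i \<in> {..<s}"
      then obtain e f q where sl: "single_letter dA dB (dB * dA) (N i) (\<psi> i) e f q"
        and R: "R < single_letter.info dA dB (dB * dA) (N i) (\<psi> i) e f q" using psi by blast
      show "\<forall>\<^sub>F n in sequentially. \<exists>X t. T n i X t"
        unfolding T_def using single_letter.asymptotic_test[OF sl R, of "\<epsilon> / 2"] assms(6) by simp
    qed
  qed simp
  \<comment> \<open>The 8 is 4 from the measurement bound times 2 from rounding up the number of
    messages.\<close>
  have "(\<lambda>n. 8 * real s * 2 powr (- real n * (\<delta> / 2))) \<longlonglongrightarrow> 0"
    using assms(8) by real_asymp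
  then have "\<forall>\<^sub>F n in sequentially. 8 * real s * 2 powr (- real n * (\<delta> / 2)) < \<epsilon>"
    using assms(6) by (rule order_tendstoD(2))
  then show ?thesis using tests
  proof eventually_elim
    case (elim n)
    let ?R = "real n * (C - \<delta>)" and ?lam = "2 powr (- real n * R)"
    obtain X t where Xt: "\<And>i. i < s \<Longrightarrow> T n i (X i) (t i)"
      using elim(2) by (metis lessThan_iff)
    show ?case
    proof (rule one_shot_code[where \<psi> = "\<lambda>i. psi_pow dA n (\<psi> i)" and J = X and t = t and eps = "\<epsilon> / 2" and lam = ?lam])
      \<comment> \<open>The measurement doubles the test error \<open>\<epsilon> / 2\<close> to
        \<open>\<epsilon>\<close>; the collisions may use the other
        \<open>\<epsilon>\<close>.\<close>
      show "2 * (\<epsilon> / 2) + 4 * (real s * real (nat \<lceil>2 powr ?R\<rceil>)) * ?lam \<le> 2 * \<epsilon>"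
      proof -
        have "1 \<le> 2 powr ?R" using C\<delta> by (intro ge_one_powr_ge_zero) auto
        then have "real (nat \<lceil>2 powr ?R\<rceil>) \<le> 2 * 2 powr ?R" by linarith
        then have "real (nat \<lceil>2 powr ?R\<rceil>) * ?lam \<le> 2 * 2 powr ?R * ?lam" by (intro mult_right_mono) auto
        also have "\<dots> = 2 * 2 powr (- real n * (\<delta> / 2))"
          unfolding mult.assoc powr_add[symmetric] R_def by (simp add: algebra_simps)
        finally have "4 * real s * (real (nat \<lceil>2 powr ?R\<rceil>) * ?lam) \<le> 4 * real s * (2 * 2 powr (- real n * (\<delta> / 2)))"
          by (intro mult_left_mono) auto
        moreover have "4 * (real s * m) * l = 4 * real s * (m * l)" "4 * real s * (2 * m) = 8 * real s * m" for m l :: real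
          by simp_all
        ultimately show ?thesis using elim(1) by linarith
      qed
      fix i assume i: "i < s"
      show "\<forall>K\<in>set (channel_pow n (N i)). K \<in> carrier_mat (dB ^ n) (dA ^ n)"
        using K[OF i] by (intro channel_pow_carrier)
      show "tp_entries (dA ^ n) (dB ^ n) (channel_pow n (N i))"
        using K[OF i] by (intro tp_entries_channel_pow)
      obtain e f q where "single_letter dA dB (dB * dA) (N i) (\<psi> i) e f q" using psi[OF i] by blast
      then show "(\<Sum>x<dA ^ n. \<Sum>y<dA ^ n. (cmod (psi_pow dA n (\<psi> i) x y))\<^sup>2) = 1"
        unfolding single_letter_def by (intro psi_pow_unit) auto
    qed (use Xt in \<open>auto simp: T_def\<close>)
  qed
qed

end
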